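(* Let $m$ be a positive integer and $E_m=\{z\in\mathbb{C}:z^m\in[-2,2]\}$. Then $$\lim_{n\to\infty}\mathcal{W}_{n,2}(E_m)^2=\lim_{n\to\infty}\mathcal{W}_{n,\infty}(E_m).$$
   Context: For a compact set $E\subset\mathbb{C}$ with positive logarithmic capacity $\operatorname{Cap}(E)$, $T_n^E$ denotes the $n$th Chebyshev polynomial of $E$, i.e. the unique monic polynomial of degree $n$ minimising the supremum norm $\|P\|_E=\max_{z\in E}|P(z)|$ among all monic polynomials $P$ of degree $n$ with complex coefficients, and $\mathcal{W}_{n,\infty}(E)=\|T_n^E\|_E/\operatorname{Cap}(E)^n$. $\mu_E$ denotes the equilibrium measure of $E$ (the probability measure on $E$ of minimal logarithmic energy). $P_n^{\mu_E}$ denotes the monic orthogonal polynomial of degree $n$ with respect to $\mu_E$; equivalently, the monic polynomial of degree $n$ of minimal norm in $L^2(\mu_E)$. Set $\mathcal{W}_{n,2}(E)=\|P_n^{\mu_E}\|_{L^2(\mu_E)}/\operatorname{Cap}(E)^n$. The assertion includes that both limits exist. *)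

theory Defs
  imports "HOL-Probability.Probability_Measure" "HOL-Computational_Algebra.Polynomial"
begin

definition prob_measures_on :: "complex set \<Rightarrow> complex measure set" where
  "prob_measures_on E = {\<mu>. prob_space \<mu> \<and> sets \<mu> = sets borel \<and> emeasure \<mu> E = 1}"

text \<open>
  The logarithmic energy \<open>\<integral>\<integral> log (1 / \<bar>z - w\<bar>) d\<mu>(w) d\<mu>(z)\<close>, written as the integral of the
  positive part of the kernel minus that of its negative part. The kernel is \<open>\<infinity>\<close> on the diagonal
  (where \<open>ln 0 = 0\<close> would give the wrong value). If \<open>\<mu>\<close> lives on a bounded set, the negative part
  has finite integral, so the difference is meaningful and lies in \<open>(-\<infinity>, \<infinity>]\<close>.
\<close>

definition log_energy :: "complex measure \<Rightarrow> ereal" where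
  "log_energy \<mu> =
     enn2ereal (\<integral>\<^sup>+ z. \<integral>\<^sup>+ w. (if z = w then \<infinity> else ennreal (- ln (cmod (z - w)))) \<partial>\<mu> \<partial>\<mu>)
   - enn2ereal (\<integral>\<^sup>+ z. \<integral>\<^sup>+ w. (if z = w then 0 else ennreal (ln (cmod (z - w)))) \<partial>\<mu> \<partial>\<mu>)"

definition minimal_energy :: "complex set \<Rightarrow> ereal" where
  "minimal_energy E = (INF \<mu>\<in>prob_measures_on E. log_energy \<mu>)"

definition log_capacity :: "complex set \<Rightarrow> real" where
  "log_capacity E =
     (if minimal_energy E = \<infinity> then 0 else exp (- real_of_ereal (minimal_energy E)))"

text \<open>
  The descriptions below are meaningful for compact sets of positive capacity, where the
  minimiser, respectively the polynomial, exists and is unique.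
\<close>

definition equilibrium_measure :: "complex set \<Rightarrow> complex measure" where
  "equilibrium_measure E =
     (THE \<mu>. \<mu> \<in> prob_measures_on E \<and> (\<forall>\<nu>\<in>prob_measures_on E. log_energy \<mu> \<le> log_energy \<nu>))"

definition monic_polys :: "nat \<Rightarrow> complex poly set" where
  "monic_polys n = {p. degree p = n \<and> lead_coeff p = 1}"

definition sup_norm_on :: "complex set \<Rightarrow> complex poly \<Rightarrow> real" where
  "sup_norm_on E p = (SUP z\<in>E. cmod (poly p z))"

definition chebyshev_poly :: "complex set \<Rightarrow> nat \<Rightarrow> complex poly" where
  "chebyshev_poly E n =
     (THE p. p \<in> monic_polys n \<and> (\<forall>q\<in>monic_polys n. sup_norm_on E p \<le> sup_norm_on E q))"

definition widom_sup :: "complex set \<Rightarrow> nat \<Rightarrow> real" where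
  "widom_sup E n = sup_norm_on E (chebyshev_poly E n) / log_capacity E ^ n"

definition L2_norm_poly :: "complex measure \<Rightarrow> complex poly \<Rightarrow> real" where
  "L2_norm_poly \<mu> p = sqrt (\<integral>z. (cmod (poly p z))\<^sup>2 \<partial>\<mu>)"

definition orthogonal_poly :: "complex measure \<Rightarrow> nat \<Rightarrow> complex poly" where
  "orthogonal_poly \<mu> n =
     (THE p. p \<in> monic_polys n \<and>
        (\<forall>q. degree q < n \<longrightarrow> (\<integral>z. poly p z * cnj (poly q z) \<partial>\<mu>) = 0))"

definition widom_L2 :: "complex set \<Rightarrow> nat \<Rightarrow> real" where
  "widom_L2 E n =
     L2_norm_poly (equilibrium_measure E) (orthogonal_poly (equilibrium_measure E) n)
       / log_capacity E ^ n"

definition star_set :: "nat \<Rightarrow> complex set" where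
  "star_set m = {z. z ^ m \<in> complex_of_real ` {-2..2}}"

end

theory Submission
  imports Defs "HOL-Complex_Analysis.Complex_Analysis" "HOL-Probability.Probability_Mass_Function"
begin

text \<open>
  Both limits equal 2. The logarithmic kernel is conditionally positive definite because
  \<open>-ln \<bar>z - w\<bar>\<close> differs by a sum \<open>a(z) + a(w)\<close> from a power series with nonnegative coefficients in
  \<open>\<bar>1 + z cnj w\<bar>\<^sup>2 / ((1 + \<bar>z\<bar>\<^sup>2)(1 + \<bar>w\<bar>\<^sup>2))\<close>, and every power of the latter is a positive definite kernel.
  Hence a measure on \<open>E\<close> with vanishing potential on \<open>E\<close> is the equilibrium measure, and \<open>E\<close> has
  capacity 1; on \<open>star_set m\<close> this is the pullback of the arcsine law under \<open>z \<mapsto> z^m\<close>.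

  Averaging over the rotations of \<open>star_set m\<close> reduces degree \<open>km + l\<close> to polynomials of degree \<open>k\<close> on
  \<open>[-2, 2]\<close> with weight \<open>\<bar>x\<bar>^(l/m)\<close>. For the weights \<open>1 / \<bar>H(u)\<bar>\<close>, where \<open>x = u + 1/u\<close> and \<open>H\<close> is a real
  polynomial without zeros in the closed disc and \<open>H(0) = 1\<close>, both extremal problems have the explicit
  solution \<open>2 Re (u^k cnj (H u))\<close> with extremal value 2. The weight \<open>\<bar>x\<bar>^b\<close> is \<open>\<bar>1 + u\<^sup>2\<bar>^b\<close>, approximated by
  truncating the binomial series of \<open>(1 + r u\<^sup>2)^b\<close>, \<open>r < 1\<close>. Its zero at \<open>x = 0\<close> obstructs the lower bound;
  this is avoided by bounding \<open>x Q(x)\<close> with weight \<open>\<bar>x\<bar>^(l/m - 1)\<close> instead of \<open>Q\<close>.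
\<close>

section \<open>The uniform measure on the unit circle\<close>

text \<open>The number 2 has two origins: \<open>2 cos t\<close> has maximum 2, and its square has
  mean 2. After division by |H| the extremal polynomial is twice the cosine of a phase, which is why
  the squared L2 norm and the sup norm meet. The normalisation H(0) = 1 does the rest: by the mean
  value property the weight 1/|H| has geometric mean 1, so neither weight nor degree leaves a factor
  in the extremal value. The weights |x|^b share this normalisation, since ln |1 + u^2| has mean 0
  on the circle. The obstruction in the lower bound: 1 - e <= |H| |x|^b cannot hold at x = 0 for b >
  0, as H is bounded on the circle. For x Q(x) the requirement becomes (1 - e) |x|^(1 - b) <= |H|,
  which can be met, and the extra degree is free because the value 2 does not depend on it. The
  equilibrium measure and both polynomials are definite descriptions, so existence and uniqueness
  have to be proved for each. For the measure, uniqueness is strictness of the positive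
  definiteness: equal moments force equal measures.\<close>

definition circle_measure :: "complex measure" where
  "circle_measure = distr (uniform_measure lborel {0..1}) borel (\<lambda>t. cis (2 * pi * t))"

lemma cis_borel_measurable [measurable]: "(\<lambda>t. cis (2 * pi * t)) \<in> borel_measurable borel"
  by (intro borel_measurable_continuous_onI continuous_intros)

lemma sets_circle_measure [simp, measurable_cong]: "sets circle_measure = sets borel"
  and space_circle_measure [simp]: "space circle_measure = UNIV"
  by (simp_all add: circle_measure_def)

lemma prob_space_uniform01: "prob_space (uniform_measure lborel {0..1::real})"
  by (rule prob_space_uniform_measure) auto

interpretation circle: prob_space circle_measure
  unfolding circle_measure_def
  by (rule prob_space.prob_space_distr[OF prob_space_uniform01]) measurable

lemma AE_circle_measure: "AE u in circle_measure. norm u = 1"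
  unfolding circle_measure_def by (subst AE_distr_iff) auto

lemma uniform01_density: "uniform_measure lborel {0..1::real} = density lborel (\<lambda>t. ennreal (indicator {0..1} t))"
  unfolding uniform_measure_def by (intro density_cong) (auto simp: indicator_def divide_ennreal_def)

lemma integral_circle_measure:
  fixes f :: "complex \<Rightarrow> complex"
  assumes [measurable]: "f \<in> borel_measurable borel"
  shows "(\<integral>u. f u \<partial>circle_measure) = (LINT t:{0..1}|lborel. f (cis (2 * pi * t)))"
  unfolding circle_measure_def uniform01_density
  by (subst integral_distr) (auto simp: integral_density set_lebesgue_integral_def)

lemma circle_integrable_bounded:
  fixes f :: "complex \<Rightarrow> 'a :: {banach, second_countable_topology}"
  assumes "f \<in> borel_measurable borel" "\<And>u. norm u = 1 \<Longrightarrow> norm (f u) \<le> B"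
  shows "integrable circle_measure f"
  using AE_circle_measure assms by (intro circle.integrable_const_bound[of f B]) auto

lemma circle_integrable_continuous:
  fixes f :: "complex \<Rightarrow> 'a :: {banach, second_countable_topology}"
  assumes "f \<in> borel_measurable borel" "continuous_on (sphere 0 1) f"
  shows "integrable circle_measure f"
proof -
  have "bounded (f ` sphere 0 1)"
    by (intro compact_imp_bounded compact_continuous_image assms) auto
  then obtain B where "\<forall>x\<in>f ` sphere 0 1. norm x \<le> B"
    unfolding bounded_iff by blast
  hence "\<And>u. norm u = 1 \<Longrightarrow> norm (f u) \<le> B" by simp
  with assms(1) show ?thesis by (rule circle_integrable_bounded)
qed

text \<open>Cauchy's formula at the centre, read in the angular parameter. The exact means below
  come from recognising an integrand as boundary values of a function holomorphic on the disc. Borel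
  measurability is asked separately because holomorphy constrains \<open>f\<close> only on the
  disc.\<close>

lemma circle_mean_value:
  assumes meas: "f \<in> borel_measurable borel" and hol: "f holomorphic_on cball 0 1"
  shows "(\<integral>u. f u \<partial>circle_measure) = f 0"
proof -
  have cont: "continuous_on (sphere 0 1) f"
    using hol holomorphic_on_imp_continuous_on continuous_on_subset sphere_cball by blast
  have "((\<lambda>u. f u/(u-0)) has_contour_integral (2 * of_real pi * \<i> * f 0)) (circlepath 0 1)"
    using Cauchy_integral_circlepath_simple[OF hol, of 0] by simp
  hence "((\<lambda>t. f (circlepath 0 1 t)/(circlepath 0 1 t) * vector_derivative (circlepath 0 1) (at t within {0..1})) has_integral (2 * of_real pi * \<i> * f 0)) {0..1}"
    unfolding has_contour_integral_def by simp
  \<comment> \<open>The derivative \<open>2 pi i u\<close> of the path cancels the division by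
    \<open>u\<close>.\<close>
  hence "((\<lambda>t. (2 * pi * \<i>) * f (cis (2 * pi * t))) has_integral (2 * of_real pi * \<i> * f 0)) {0..1}"
    by (rule has_integral_eq[rotated])
       (simp add: vector_derivative_circlepath01, simp add: circlepath cis_conv_exp mult_ac)
  from has_integral_mult_right[OF this, of "1 / (2 * pi * \<i>)"]
  have hi: "((\<lambda>t. f (cis (2 * pi * t))) has_integral f 0) {0..1}"
    by (simp add: mult.assoc[symmetric])
  have "set_integrable lborel {0..1} (\<lambda>t. f (cis (2 * pi * t)))"
    by (intro borel_integrable_atLeastAtMost' continuous_on_compose2[OF cont] continuous_intros) auto
  from set_borel_integral_eq_integral(2)[OF this] hi
  show ?thesis by (simp add: integral_circle_measure[OF meas] integral_unique)
qed

lemma poly_borel_measurable [measurable]: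
  fixes p :: "'a :: real_normed_field poly"
  shows "(\<lambda>z. poly p z) \<in> borel_measurable borel"
  by (intro borel_measurable_continuous_onI continuous_intros)

section \<open>Monic polynomials\<close>

lemma monic_polys_pCons: "p \<in> monic_polys n \<Longrightarrow> pCons a p \<in> monic_polys (Suc n)"
  by (auto simp: monic_polys_def)

lemma monic_polys_add_lower:
  assumes "p \<in> monic_polys n" "degree q < n"
  shows "p + q \<in> monic_polys n"
  using assms by (auto simp: monic_polys_def degree_add_eq_left coeff_eq_0)

text \<open>The zero case is listed separately because the zero polynomial has degree 0, which is
  not below \<open>n\<close> when \<open>n = 0\<close>.\<close>

lemma monic_polys_diff:
  assumes "p \<in> monic_polys n" "q \<in> monic_polys n"
  shows "p - q = 0 \<or> degree (p - q) < n"
proof (cases "n = 0")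
  case True
  hence "p = 1" "q = 1" using assms by (auto simp: monic_polys_def elim!: degree_eq_zeroE)
  thus ?thesis by simp
next
  case False
  have "degree (p - q) \<le> n" using assms by (intro degree_diff_le) (auto simp: monic_polys_def)
  moreover have "coeff (p - q) n = 0" using assms by (auto simp: monic_polys_def)
  ultimately show ?thesis
    by (metis le_neq_implies_less leading_coeff_0_iff)
qed

lemma monic_polys_diff_lower:
  assumes "p \<in> monic_polys n" "q = 0 \<or> degree q < n"
  shows "p - q \<in> monic_polys n"
proof (cases "q = 0")
  case False
  hence "degree (- q) < n" using assms by simp
  thus ?thesis
    using assms(1) degree_add_eq_left[of "- q" p] by (auto simp: monic_polys_def coeff_eq_0)
qed (use assms in simp)

lemma monom_monic: "monom 1 n \<in> monic_polys n"
  by (simp add: monic_polys_def degree_monom_eq)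

text \<open>Rebuilds a polynomial from its synthetic quotient \<open>q\<close> at \<open>c\<close>
  and its value \<open>d\<close> there. With \<open>monic_polys_synthetic_div\<close> it drives the
  induction on the degree in the compactness argument for monic polynomials.\<close>

lemma monic_polys_linear_mult:
  assumes "q \<in> monic_polys n"
  shows "[:- c, 1:] * q + [:d:] \<in> monic_polys (Suc n)"
proof -
  have "pCons d q - smult c q \<in> monic_polys (Suc n)"
    using assms by (intro monic_polys_diff_lower monic_polys_pCons disjI2 le_less_trans[OF degree_smult_le])
      (auto simp: monic_polys_def)
  moreover have "[:- c, 1:] * q + [:d:] = pCons d q - smult c q" by simp
  ultimately show ?thesis by (simp only:)
qed

lemma monic_polys_synthetic_div:
  assumes "p \<in> monic_polys (Suc n)"
  shows "synthetic_div p c \<in> monic_polys n"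
proof -
  let ?q = "synthetic_div p c"
  have dp: "degree p = Suc n" "lead_coeff p = 1" using assms by (auto simp: monic_polys_def)
  have dq: "degree ?q = n" using dp by (simp add: degree_synthetic_div)
  have "coeff p (Suc n) = coeff ([:- c, 1:] * ?q + [:poly p c:]) (Suc n)"
    by (simp only: synthetic_div_correct')
  also have "\<dots> = coeff ?q n" using dq by (simp add: coeff_eq_0)
  finally show ?thesis using dp dq by (simp add: monic_polys_def)
qed

lemma prod_linear_monic: "(\<Prod>j<n. [:- f j, 1:]) \<in> monic_polys n"
proof (induction n)
  case (Suc n)
  thus ?case using monic_polys_linear_mult[OF Suc, of "f n" 0] by (simp add: mult.commute)
qed (simp add: monic_polys_def)

text \<open>These are the rotation-symmetric trial polynomials \<open>z^l P(z^m)\<close> of the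
  upper bounds.\<close>

lemma monic_polys_pcompose_monom:
  assumes m: "m > 0" and "P \<in> monic_polys k"
  shows "monom 1 l * pcompose P (monom 1 m) \<in> monic_polys (k * m + l)"
proof -
  have P: "degree P = k" "lead_coeff P = 1" "P \<noteq> 0" using assms(2) by (auto simp: monic_polys_def)
  have d: "degree (pcompose P (monom 1 m)) = k * m" using P by (simp add: degree_pcompose degree_monom_eq)
  have lc: "lead_coeff (pcompose P (monom 1 m)) = 1"
    using P m by (subst lead_coeff_comp) (simp_all add: degree_monom_eq)
  hence nz: "pcompose P (monom 1 m) \<noteq> 0" by auto
  have "degree (monom 1 l * pcompose P (monom 1 m)) = k * m + l"
    using nz d by (subst degree_mult_eq) (auto simp: degree_monom_eq)
  moreover have "lead_coeff (monom 1 l * pcompose P (monom 1 m)) = 1"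
    unfolding lead_coeff_mult lc by (simp add: degree_monom_eq)
  ultimately show ?thesis by (simp add: monic_polys_def)
qed

section \<open>Bernstein-Szego weights\<close>

lemma cnj_eq_inverse: "norm u = 1 \<Longrightarrow> cnj u = inverse u"
  by (rule inverse_unique[symmetric]) (simp add: complex_norm_square[symmetric])

text \<open>On the unit circle this is \<open>u + 1/u\<close>.\<close>

definition xproj :: "complex \<Rightarrow> complex" where
  "xproj u = of_real (2 * Re u)"

lemma xproj_eq: "xproj u = u + cnj u"
  by (simp add: xproj_def complex_add_cnj)

lemma cnj_xproj [simp]: "cnj (xproj u) = xproj u"
  by (simp add: xproj_def)

lemma continuous_on_xproj [continuous_intros]:
  "continuous_on A f \<Longrightarrow> continuous_on A (\<lambda>u. xproj (f u))"
  unfolding xproj_def by (intro continuous_intros)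

lemma xproj_borel_measurable [measurable]: "xproj \<in> borel_measurable borel"
  by (intro borel_measurable_continuous_onI continuous_intros)

lemma cnj_borel_measurable [measurable]: "cnj \<in> borel_measurable borel"
  by (intro borel_measurable_continuous_onI continuous_intros)

text \<open>The rescaled Chebyshev polynomials \<open>2 T_n(x/2)\<close>, that is,
  \<open>u^n + u^(-n)\<close> in terms of \<open>x = u + 1/u\<close>. The start value 2 fits the
  recursion, so that only positive indices give monic polynomials.\<close>

fun dickson_poly :: "nat \<Rightarrow> complex poly" where
  "dickson_poly 0 = [:2:]"
| "dickson_poly (Suc 0) = [:0, 1:]"
| "dickson_poly (Suc (Suc n)) = [:0, 1:] * dickson_poly (Suc n) - dickson_poly n"

lemma poly_dickson_poly:
  assumes "norm u = 1"
  shows "poly (dickson_poly n) (xproj u) = of_real (2 * Re (u ^ n))"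
proof -
  have uu: "u * cnj u = 1" using assms by (simp add: complex_norm_square[symmetric])
  have "poly (dickson_poly n) (u + cnj u) = u ^ n + cnj u ^ n"
  proof (induction n rule: dickson_poly.induct)
    case (3 n)
    have "(u + cnj u) * (u ^ Suc n + cnj u ^ Suc n)
        = u ^ Suc (Suc n) + cnj u ^ Suc (Suc n) + (u * cnj u) * (u ^ n + cnj u ^ n)"
      by (simp add: algebra_simps)
    thus ?case using 3 by (simp add: uu)
  qed auto
  thus ?thesis unfolding xproj_eq using complex_add_cnj[of "u ^ n"] by simp
qed

lemma dickson_poly_monic: "dickson_poly (Suc n) \<in> monic_polys (Suc n)"
  and degree_dickson_poly: "degree (dickson_poly n) = n"
proof -
  have "dickson_poly (Suc n) \<in> monic_polys (Suc n) \<and> degree (dickson_poly n) = n" for n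
  proof (induction n)
    case (Suc n)
    have "dickson_poly (Suc (Suc n)) = pCons 0 (dickson_poly (Suc n)) + (- dickson_poly n)" by simp
    moreover have "pCons 0 (dickson_poly (Suc n)) + (- dickson_poly n) \<in> monic_polys (Suc (Suc n))"
      using Suc by (intro monic_polys_add_lower monic_polys_pCons) auto
    ultimately show ?case using Suc by (metis (mono_tags, lifting) mem_Collect_eq monic_polys_def)
  qed (auto simp: monic_polys_def)
  thus "dickson_poly (Suc n) \<in> monic_polys (Suc n)" "degree (dickson_poly n) = n" by auto
qed

lemma poly_map_of_real_cnj:
  "poly (map_poly complex_of_real h) (cnj z) = cnj (poly (map_poly complex_of_real h) z)"
  by (induction h) (simp_all add: map_poly_pCons)

text \<open>On the circle \<open>u^k cnj (h(u))\<close> is a combination of the powers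
  \<open>u^(k - i)\<close> with the real coefficients of \<open>h\<close>, so twice its real part is
  the same combination of Dickson polynomials. The term \<open>i = 0\<close> has coefficient
  \<open>h(0) = 1\<close> and makes the result monic.\<close>

lemma bernstein_szego_poly_exists:
  fixes h :: "real poly"
  assumes "poly h 0 = 1" "degree h < k"
  obtains P where "P \<in> monic_polys k"
    "\<And>u. norm u = 1 \<Longrightarrow>
       poly P (xproj u) = of_real (2 * Re (u ^ k * cnj (poly (map_poly of_real h) u)))"
proof
  define d where "d = degree h"
  define L where "L = (\<Sum>i=1..d. smult (of_real (coeff h i)) (dickson_poly (k - i)))"
  define P where "P = dickson_poly k + L"
  have dL: "degree L < k"
  proof -
    have "degree L \<le> k - 1" unfolding L_def
      by (intro degree_sum_le) (auto intro!: order.trans[OF degree_smult_le] simp: degree_dickson_poly)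
    thus ?thesis using assms(2) by simp
  qed
  have "dickson_poly k \<in> monic_polys k"
    using dickson_poly_monic[of "k - 1"] assms(2) by simp
  thus "P \<in> monic_polys k" unfolding P_def using dL by (rule monic_polys_add_lower)
  have h0: "coeff h 0 = 1" using assms(1) by (simp add: poly_0_coeff_0)
  fix u :: complex assume u: "norm u = 1"
  have pw: "u ^ k * cnj u ^ i = u ^ (k - i)" if "i \<le> d" for i
  proof -
    have "i \<le> k" using that assms(2) d_def by simp
    hence "u ^ k = u ^ (k - i) * u ^ i" by (simp add: power_add[symmetric])
    moreover have "u ^ i * cnj u ^ i = 1"
      using u by (simp add: power_mult_distrib[symmetric] complex_norm_square[symmetric])
    ultimately show ?thesis by (simp add: mult.assoc)
  qed
  have P: "P = (\<Sum>i\<le>d. smult (of_real (coeff h i)) (dickson_poly (k - i)))"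
    unfolding P_def L_def atMost_atLeast0 using h0 by (simp add: sum.atLeast_Suc_atMost)
  have "poly P (xproj u) = (\<Sum>i\<le>d. of_real (coeff h i) * of_real (2 * Re (u ^ (k - i))))"
    unfolding P poly_sum poly_smult poly_dickson_poly[OF u] ..
  also have "\<dots> = of_real (2 * Re (\<Sum>i\<le>d. of_real (coeff h i) * u ^ (k - i)))"
    by (simp add: sum_distrib_left mult_ac)
  also have "(\<Sum>i\<le>d. of_real (coeff h i) * u ^ (k - i)) = u ^ k * cnj (poly (map_poly of_real h) u)"
    by (simp add: poly_altdef coeff_map_poly degree_map_poly d_def[symmetric] sum_distrib_left
        pw[symmetric] mult_ac)
  finally show "poly P (xproj u) = of_real (2 * Re (u ^ k * cnj (poly (map_poly of_real h) u)))" .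
qed

text \<open>The factor \<open>u^k\<close> clears the pole of \<open>R(u + 1/u)\<close> at 0, and
  what remains there is the leading coefficient. This is how monicity enters the mean value
  formulas.\<close>

lemma circle_lift_monic:
  fixes R :: "complex poly"
  assumes "R \<in> monic_polys k"
  obtains g where "g holomorphic_on UNIV" "g 0 = 1"
    "\<And>u. norm u = 1 \<Longrightarrow> g u = u ^ k * poly R (xproj u)"
proof
  define g where "g = (\<lambda>u::complex. \<Sum>i\<le>k. coeff R i * (u\<^sup>2 + 1) ^ i * u ^ (k - i))"
  show "g holomorphic_on UNIV" unfolding g_def by (intro holomorphic_intros)
  have "g 0 = (\<Sum>i\<le>k. if i = k then coeff R i else 0)"
    unfolding g_def by (intro sum.cong) auto
  thus "g 0 = 1" using assms by (auto simp: monic_polys_def)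
  fix u :: complex assume u: "norm u = 1"
  have uu: "u * cnj u = 1" using u by (simp add: complex_norm_square[symmetric])
  have "u ^ k * (u + cnj u) ^ i = (u\<^sup>2 + 1) ^ i * u ^ (k - i)" if "i \<le> k" for i
  proof -
    have "u ^ k = u ^ i * u ^ (k - i)" using that by (simp add: power_add[symmetric])
    moreover have "u ^ i * (u + cnj u) ^ i = (u\<^sup>2 + 1) ^ i"
      by (simp add: power_mult_distrib[symmetric] distrib_left uu power2_eq_square)
    ultimately show ?thesis by (simp add: mult_ac)
  qed
  moreover have "degree R = k" using assms by (simp add: monic_polys_def)
  ultimately show "g u = u ^ k * poly R (xproj u)"
    unfolding g_def xproj_eq poly_altdef sum_distrib_left by (intro sum.cong) (auto simp: mult_ac)
qed

text \<open>\<open>1 / H\<close> plays the part of the Szego function of the weight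
  \<open>1 / |H|\<close>: without zeros of \<open>H\<close> in the closed disc it is holomorphic
  there, and its value 1 at the centre makes the geometric mean of the weight equal to 1.\<close>

locale bernstein_szego =
  fixes h :: "real poly" and k :: nat and H :: "complex \<Rightarrow> complex"
  assumes h0: "poly h 0 = 1"
    and deg_h: "degree h < k"
    and H_def: "H = poly (map_poly complex_of_real h)"
    and H_nz: "\<And>z. norm z \<le> 1 \<Longrightarrow> H z \<noteq> 0"
begin

lemma H_meas [measurable]: "H \<in> borel_measurable borel"
  unfolding H_def by measurable

lemma H_hol [holomorphic_intros]: "H holomorphic_on A"
  unfolding H_def by (intro holomorphic_intros)

lemma H_0: "H 0 = 1"
  using h0 by (simp add: H_def poly_0_coeff_0 coeff_map_poly)

text \<open>The integrand is the boundary value of \<open>g G / H\<close>, holomorphic on the disc,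
  with \<open>g(0) = H(0) = 1\<close>. The free factor \<open>G\<close> is 1 for the L2 problem and
  a Cauchy kernel for the sup norm.\<close>

lemma mean_monic:
  assumes R: "R \<in> monic_polys k" and G: "G holomorphic_on cball 0 1"
    and [measurable]: "G \<in> borel_measurable borel"
  shows "(\<integral>u. u ^ k * poly R (xproj u) / H u * G u \<partial>circle_measure) = G 0"
proof -
  obtain g where g: "g holomorphic_on UNIV" "g 0 = 1"
    "\<And>u. norm u = 1 \<Longrightarrow> g u = u ^ k * poly R (xproj u)"
    using circle_lift_monic[OF R] by blast
  have [measurable]: "g \<in> borel_measurable borel"
    using g(1) by (intro borel_measurable_continuous_onI holomorphic_on_imp_continuous_on) auto
  have "(\<integral>u. u ^ k * poly R (xproj u) / H u * G u \<partial>circle_measure)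
      = (\<integral>u. g u / H u * G u \<partial>circle_measure)"
    by (intro integral_cong_AE) (use AE_circle_measure in \<open>auto simp: g(3)\<close>)
  also have "\<dots> = g 0 / H 0 * G 0"
    by (rule circle_mean_value)
       (use H_nz holomorphic_on_subset[OF g(1)] in \<open>auto intro!: holomorphic_intros G\<close>)
  finally show ?thesis by (simp add: g(2) H_0)
qed

text \<open>The conjugate of \<open>mean_monic\<close> for the polynomial with conjugated
  coefficients, which takes conjugate values because \<open>xproj u\<close> is real.\<close>

lemma mean_monic_cnj:
  assumes R: "R \<in> monic_polys k" and G: "G holomorphic_on cball 0 1"
    and [measurable]: "G \<in> borel_measurable borel"
  shows "(\<integral>u. cnj u ^ k * poly R (xproj u) / cnj (H u) * cnj (G u) \<partial>circle_measure)
    = cnj (G 0)"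
proof -
  define R' where "R' = map_poly cnj R"
  have pR: "poly R' (xproj x) = cnj (poly R (xproj x))" for x
    unfolding R'_def by (induction R) (simp_all add: map_poly_pCons)
  have "R' \<in> monic_polys k"
    using R by (auto simp: monic_polys_def R'_def degree_map_poly coeff_map_poly)
  from mean_monic[OF this G assms(3)]
  have "cnj (\<integral>u. u ^ k * poly R' (xproj u) / H u * G u \<partial>circle_measure) = cnj (G 0)"
    by (rule arg_cong)
  thus ?thesis
    unfolding Bochner_Integration.integral_cnj[symmetric] pR complex_cnj_mult complex_cnj_divide complex_cnj_power
      complex_cnj_cnj .
qed

lemma cont_H_quot [continuous_intros]:
  assumes "continuous_on (sphere 0 1) f"
  shows "continuous_on (sphere 0 1) (\<lambda>u. f u / H u)"
  by (intro continuous_intros assms holomorphic_on_imp_continuous_on H_hol) (use H_nz in auto)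

lemma cont_H_quot_norm [continuous_intros]:
  fixes f :: "complex \<Rightarrow> real"
  assumes "continuous_on (sphere 0 1) f"
  shows "continuous_on (sphere 0 1) (\<lambda>u. f u / (norm (H u))\<^sup>2)"
  by (intro continuous_intros assms holomorphic_on_imp_continuous_on H_hol) (use H_nz in auto)

lemma cont_H_quot_norm_complex [continuous_intros]:
  fixes f :: "complex \<Rightarrow> complex"
  assumes "continuous_on (sphere 0 1) f"
  shows "continuous_on (sphere 0 1) (\<lambda>u. f u / of_real ((norm (H u))\<^sup>2))"
  by (intro continuous_intros assms holomorphic_on_imp_continuous_on H_hol) (use H_nz in auto)

definition extremal_value :: "complex \<Rightarrow> real" where
  "extremal_value u = 2 * Re (u ^ k * cnj (H u))"

lemma extremal_poly_exists:
  obtains P where "P \<in> monic_polys k"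
    "\<And>u. norm u = 1 \<Longrightarrow> poly P (xproj u) = of_real (extremal_value u)"
proof -
  obtain P where P: "P \<in> monic_polys k" "\<And>u. norm u = 1 \<Longrightarrow>
      poly P (xproj u) = of_real (2 * Re (u ^ k * cnj (poly (map_poly of_real h) u)))"
    using bernstein_szego_poly_exists[OF h0 deg_h] by metis
  have "poly P (xproj u) = of_real (extremal_value u)" if "norm u = 1" for u
    unfolding extremal_value_def using that by (simp only: P(2) H_def)
  from that[OF P(1) this] show ?thesis .
qed

lemma abs_extremal_value:
  assumes "norm u = 1"
  shows "\<bar>extremal_value u\<bar> \<le> 2 * norm (H u)"
proof -
  have "norm (u ^ k * cnj (H u)) = norm (H u)"
    using assms by (simp add: norm_mult norm_power)
  with abs_Re_le_cmod[of "u ^ k * cnj (H u)"] show ?thesis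
    unfolding extremal_value_def abs_mult by linarith
qed

lemma extremal_value_meas [measurable]: "extremal_value \<in> borel_measurable borel"
  unfolding extremal_value_def by measurable

lemma extremal_value_cont [continuous_intros]: "continuous_on A extremal_value"
  unfolding extremal_value_def by (intro continuous_intros holomorphic_on_imp_continuous_on H_hol)

lemma extremal_square_integrable:
  "integrable circle_measure (\<lambda>u. (extremal_value u)\<^sup>2 / (norm (H u))\<^sup>2)"
  by (intro circle_integrable_continuous continuous_intros) measurable

text \<open>Since \<open>extremal_value / |H|^2 = u^k / H + cnj (u^k / H)\<close> on the circle, the
  mean splits into two holomorphic or antiholomorphic halves, each equal to 1. The value being the
  same for all monic \<open>R\<close>, the extremal polynomial is the orthogonal one for
  \<open>1 / |H|^2\<close>.\<close>

lemma mean_monic_extremal: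
  assumes R: "R \<in> monic_polys k"
  shows "(\<integral>u. poly R (xproj u) * extremal_value u / (norm (H u))\<^sup>2 \<partial>circle_measure) = 2"
proof -
  let ?f = "\<lambda>u. u ^ k * poly R (xproj u) / H u * 1"
  let ?g = "\<lambda>u. cnj u ^ k * poly R (xproj u) / cnj (H u) * cnj 1"
  have "(\<integral>u. poly R (xproj u) * extremal_value u / (norm (H u))\<^sup>2 \<partial>circle_measure)
      = (\<integral>u. ?f u + ?g u \<partial>circle_measure)"
  proof (intro integral_cong_AE)
    show "AE u in circle_measure. poly R (xproj u) * extremal_value u / (norm (H u))\<^sup>2 = ?f u + ?g u"
      using AE_circle_measure
    proof eventually_elim
      fix u :: complex assume "norm u = 1"
      hence "H u \<noteq> 0" using H_nz by simp
      moreover have "complex_of_real (extremal_value u) = u ^ k * cnj (H u) + cnj u ^ k * H u"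
        unfolding extremal_value_def by (subst complex_add_cnj[symmetric]) simp
      ultimately show "poly R (xproj u) * extremal_value u / (norm (H u))\<^sup>2 = ?f u + ?g u"
        using complex_norm_square[of "H u"] by (simp add: field_simps)
    qed
  qed measurable
  also have "\<dots> = (\<integral>u. ?f u \<partial>circle_measure) + (\<integral>u. ?g u \<partial>circle_measure)"
  proof (rule Bochner_Integration.integral_add)
    show "integrable circle_measure ?f"
      by (intro circle_integrable_continuous continuous_intros) measurable
    have "integrable circle_measure (\<lambda>u. cnj (u ^ k * cnj (poly R (xproj u)) / H u))"
      by (intro integrable_cnj circle_integrable_continuous continuous_intros) measurable
    thus "integrable circle_measure ?g" by simp
  qed
  also have "\<dots> = 2"
    using mean_monic[OF R, of "\<lambda>_. 1"] mean_monic_cnj[OF R, of "\<lambda>_. 1"] by simp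
  finally show ?thesis .
qed

lemma mean_square_extremal:
  "(\<integral>u. (extremal_value u)\<^sup>2 / (norm (H u))\<^sup>2 \<partial>circle_measure) = 2"
proof -
  obtain P where P: "P \<in> monic_polys k"
    "\<And>u. norm u = 1 \<Longrightarrow> poly P (xproj u) = of_real (extremal_value u)"
    using extremal_poly_exists by blast
  have "complex_of_real (\<integral>u. (extremal_value u)\<^sup>2 / (norm (H u))\<^sup>2 \<partial>circle_measure)
     = (\<integral>u. complex_of_real ((extremal_value u)\<^sup>2 / (norm (H u))\<^sup>2) \<partial>circle_measure)"
    by (rule integral_complex_of_real[symmetric])
  also have "\<dots> = (\<integral>u. poly P (xproj u) * extremal_value u / (norm (H u))\<^sup>2 \<partial>circle_measure)"
  proof (intro integral_cong_AE)
    show "AE u in circle_measure. complex_of_real ((extremal_value u)\<^sup>2 / (norm (H u))\<^sup>2)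
        = poly P (xproj u) * extremal_value u / (norm (H u))\<^sup>2"
      using AE_circle_measure by eventually_elim (simp add: P(2), simp add: power2_eq_square)
  qed measurable
  also have "\<dots> = of_real 2" using mean_monic_extremal[OF P(1)] by simp
  finally show ?thesis unfolding of_real_eq_iff .
qed

text \<open>Expanding the mean of \<open>|R - extremal_value|^2 / |H|^2\<close> gives the mean of
  \<open>|R|^2 / |H|^2\<close> minus \<open>2 * 2\<close> plus 2, and it is nonnegative.\<close>

lemma mean_square_ge:
  assumes R: "R \<in> monic_polys k"
  shows "(\<integral>u. (norm (poly R (xproj u)))\<^sup>2 / (norm (H u))\<^sup>2 \<partial>circle_measure) \<ge> 2"
proof -
  let ?R = "\<lambda>u. poly R (xproj u)"
  let ?a = "\<lambda>u. (norm (?R u))\<^sup>2 / (norm (H u))\<^sup>2"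
  let ?b = "\<lambda>u. Re (?R u) * extremal_value u / (norm (H u))\<^sup>2"
  let ?b' = "\<lambda>u. ?R u * extremal_value u / (norm (H u))\<^sup>2"
  let ?c = "\<lambda>u. (extremal_value u)\<^sup>2 / (norm (H u))\<^sup>2"
  have b: "?b u = Re (?b' u)" for u
    by (simp flip: of_real_power of_real_mult)
  have ib': "integrable circle_measure ?b'"
    by (intro circle_integrable_continuous continuous_intros) measurable
  have i: "integrable circle_measure ?a" "integrable circle_measure ?b" "integrable circle_measure ?c"
    by (intro circle_integrable_continuous continuous_intros; measurable)+
  have "0 \<le> (\<integral>u. (norm (?R u - extremal_value u))\<^sup>2 / (norm (H u))\<^sup>2 \<partial>circle_measure)"
    by (intro integral_nonneg_AE) auto
  also have "\<dots> = (\<integral>u. ?a u - 2 * ?b u + ?c u \<partial>circle_measure)"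
  proof (intro Bochner_Integration.integral_cong refl)
    fix u
    have "(norm (?R u - extremal_value u))\<^sup>2 = (norm (?R u))\<^sup>2 - 2 * (Re (?R u) * extremal_value u) + (extremal_value u)\<^sup>2"
      unfolding cmod_power2 by (simp add: power2_eq_square algebra_simps)
    thus "(norm (?R u - extremal_value u))\<^sup>2 / (norm (H u))\<^sup>2 = ?a u - 2 * ?b u + ?c u"
      by (simp add: add_divide_distrib diff_divide_distrib)
  qed
  also have "\<dots> = (\<integral>u. ?a u \<partial>circle_measure) - 2 * (\<integral>u. ?b u \<partial>circle_measure) + (\<integral>u. ?c u \<partial>circle_measure)"
    by (simp only: i Bochner_Integration.integral_add Bochner_Integration.integral_diff
        Bochner_Integration.integrable_diff integrable_mult_right integral_mult_right_zero)
  also have "(\<integral>u. ?b u \<partial>circle_measure) = Re (\<integral>u. ?b' u \<partial>circle_measure)"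
    unfolding b using ib' by (rule integral_Re)
  also have "\<dots> = 2" using mean_monic_extremal[OF R] by simp
  finally show ?thesis unfolding mean_square_extremal by simp
qed


text \<open>
  \<open>blaschke\<close> is the square of the unimodular function \<open>u^k cnj (H u) / \<bar>H u\<bar>\<close> whose real part is
  \<open>extremal_value / (2 \<bar>H\<bar>)\<close>; it is a finite Blaschke product. Averaging against its Poisson kernel
  with \<open>s \<longrightarrow> 1\<close> mimics averaging over the alternation points.
\<close>

definition blaschke :: "complex \<Rightarrow> complex" where
  "blaschke u = u ^ (2 * k - degree h) * poly (reflect_poly (map_poly complex_of_real h)) u / H u"

lemma blaschke_meas [measurable]: "blaschke \<in> borel_measurable borel"
  unfolding blaschke_def by measurable

lemma blaschke_hol: "blaschke holomorphic_on cball 0 1"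
  unfolding blaschke_def by (intro holomorphic_intros) (use H_nz in auto)

lemma blaschke_0: "blaschke 0 = 0"
  using deg_h by (simp add: blaschke_def)

text \<open>The reflected polynomial is \<open>u^d h(1/u)\<close> with \<open>d\<close> the degree
  of \<open>h\<close>; on the circle \<open>1/u = cnj u\<close>, and real coefficients turn
  \<open>h(cnj u)\<close> into \<open>cnj (H u)\<close>.\<close>

lemma blaschke_circle:
  assumes "norm u = 1"
  shows "blaschke u = u ^ (2 * k) * cnj (H u) / H u"
proof -
  have u: "u \<noteq> 0" using assms by auto
  have "u ^ (2 * k - degree h) * u ^ degree h = u ^ (2 * k)"
    using deg_h by (simp add: power_add[symmetric])
  moreover have "poly (map_poly complex_of_real h) (inverse u) = cnj (H u)"
    unfolding cnj_eq_inverse[OF assms, symmetric] H_def by (rule poly_map_of_real_cnj)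
  ultimately show ?thesis
    unfolding blaschke_def poly_reflect_poly_nz[OF u] by (simp add: degree_map_poly mult.assoc[symmetric])
qed

lemma norm_blaschke_circle: "norm u = 1 \<Longrightarrow> norm (blaschke u) = 1"
  using H_nz[of u] by (simp add: blaschke_circle norm_mult norm_divide norm_power)

lemma norm_blaschke_le: "norm u \<le> 1 \<Longrightarrow> norm (blaschke u) \<le> 1"
  by (rule maximum_modulus_frontier[of blaschke "cball 0 1"])
     (auto simp: norm_blaschke_circle blaschke_hol intro: holomorphic_on_subset[OF blaschke_hol]
        holomorphic_on_imp_continuous_on)

text \<open>A duality argument. The Poisson kernel \<open>?P\<close> of the Blaschke product is a
  positive density of mean 1, and \<open>u^k R / H\<close> has mean exactly \<open>1 + s\<close>
  against it, while its modulus is at most \<open>M\<close>. Hence \<open>1 + s <= M\<close> for all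
  \<open>s < 1\<close>.\<close>

lemma sup_ge:
  assumes R: "R \<in> monic_polys k"
    and M: "\<And>u. norm u = 1 \<Longrightarrow> norm (poly R (xproj u)) \<le> M * norm (H u)"
  shows "2 \<le> M"
proof -
  have "1 + s \<le> M" if s: "0 < s" "s < 1" for s :: real
  proof -
    \<comment> \<open>The Cauchy kernel in \<open>blaschke u\<close>, holomorphic on the closed disc
      because \<open>s < 1\<close> and the Blaschke product is bounded by 1 there.\<close>
    define G where "G = (\<lambda>u. 1 / (1 - of_real s * blaschke u))"
    have nz: "1 - of_real s * blaschke u \<noteq> 0" if "norm u \<le> 1" for u
    proof
      assume "1 - of_real s * blaschke u = 0"
      hence "norm (of_real s * blaschke u) = norm (1::complex)" by (metis eq_iff_diff_eq_0)
      hence "s * norm (blaschke u) = 1" using s by (simp add: norm_mult)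
      moreover have "s * norm (blaschke u) \<le> s * 1"
        using norm_blaschke_le[OF that] s by (intro mult_left_mono) auto
      ultimately show False using s by simp
    qed
    have G_hol: "G holomorphic_on cball 0 1"
      unfolding G_def by (intro holomorphic_intros blaschke_hol) (use nz in auto)
    have G_meas [measurable]: "G \<in> borel_measurable borel" unfolding G_def by measurable
    have G0: "G 0 = 1" by (simp add: G_def blaschke_0)
    have G_cont: "continuous_on (sphere 0 1) G"
      using G_hol holomorphic_on_imp_continuous_on continuous_on_subset sphere_cball by blast
    let ?R = "\<lambda>u. poly R (xproj u)"
    let ?f = "\<lambda>u. u ^ k * ?R u / H u * G u"
    let ?g = "\<lambda>u. cnj u ^ k * ?R u / cnj (H u) * cnj (G u)"
    let ?P = "\<lambda>u. (1 - s\<^sup>2) * (norm (G u))\<^sup>2"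
    have int_f: "integrable circle_measure ?f"
      by (intro circle_integrable_continuous continuous_intros G_cont) measurable
    have "integrable circle_measure (\<lambda>u. cnj (u ^ k * cnj (?R u) / H u * G u))"
      by (intro integrable_cnj circle_integrable_continuous continuous_intros G_cont) measurable
    hence int_g: "integrable circle_measure ?g" by simp
    have int_P: "integrable circle_measure ?P"
      by (intro circle_integrable_continuous continuous_intros G_cont) measurable
    \<comment> \<open>With \<open>|B| = 1\<close>, the Poisson kernel
      \<open>(1 - s^2) / |1 - s B|^2\<close> is \<open>1 / (1 - s B)\<close> plus
      \<open>s cnj B / (1 - s cnj B)\<close>.\<close>
    have Peq: "of_real (?P u) = G u + of_real s * cnj (blaschke u) * cnj (G u)" if u: "norm u = 1" for u
    proof -
      have bb: "blaschke u * cnj (blaschke u) = 1"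
        using norm_blaschke_circle[OF u] by (simp add: complex_norm_square[symmetric])
      define D where "D = 1 - of_real s * blaschke u"
      have D: "D \<noteq> 0" using nz[of u] u unfolding D_def by simp
      have GD: "G u = 1 / D" unfolding G_def D_def ..
      have "complex_of_real ((norm (1 / D))\<^sup>2) = 1 / D * cnj (1 / D)"
        by (rule complex_norm_square)
      hence "of_real (?P u) = (1 - (of_real s)\<^sup>2) * (1 / D * cnj (1 / D))"
        unfolding GD by simp
      also have "1 - (of_real s)\<^sup>2 = cnj D + of_real s * cnj (blaschke u) * D"
        unfolding D_def using bb by (simp add: algebra_simps power2_eq_square)
      also have "\<dots> * (1 / D * cnj (1 / D)) = 1 / D + of_real s * cnj (blaschke u) * cnj (1 / D)"
        using D by (simp add: field_simps)
      finally show ?thesis unfolding GD .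
    qed
    have "(\<integral>u. of_real (?P u) \<partial>circle_measure)
        = (\<integral>u. G u + cnj (of_real s * blaschke u * G u) \<partial>circle_measure)"
    proof (intro integral_cong_AE)
      show "AE u in circle_measure. complex_of_real (?P u) = G u + cnj (of_real s * blaschke u * G u)"
        using AE_circle_measure by eventually_elim (simp only: Peq, simp)
    qed measurable
    also have "\<dots> = (\<integral>u. G u \<partial>circle_measure) + (\<integral>u. cnj (of_real s * blaschke u * G u) \<partial>circle_measure)"
      by (intro Bochner_Integration.integral_add integrable_cnj circle_integrable_continuous
          continuous_intros G_cont continuous_on_subset[OF holomorphic_on_imp_continuous_on[OF blaschke_hol]])
         auto
    also have "(\<integral>u. G u \<partial>circle_measure) = 1"
      using circle_mean_value[OF G_meas G_hol] G0 by simp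
    \<comment> \<open>The Blaschke product vanishes at the centre, so this half contributes
      nothing.\<close>
    also have "(\<integral>u. cnj (of_real s * blaschke u * G u) \<partial>circle_measure) = 0"
      unfolding Bochner_Integration.integral_cnj
      by (subst circle_mean_value) (auto intro!: holomorphic_intros blaschke_hol G_hol simp: blaschke_0)
    finally have "complex_of_real (\<integral>u. ?P u \<partial>circle_measure) = of_real 1"
      unfolding integral_complex_of_real by simp
    hence mean_P: "(\<integral>u. ?P u \<partial>circle_measure) = 1" unfolding of_real_eq_iff .
    \<comment> \<open>Applied with \<open>b = cnj (blaschke u)\<close>: on the circle
      \<open>cnj u^k / cnj (H u)\<close> equals \<open>u^k cnj (blaschke u) / H u\<close>, so the
      holomorphic and antiholomorphic parts recombine into one factor times the Poisson
      kernel.\<close>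
    have regroup: "A * r / a * g + t * (c * r / a' * g') = A * r / a * (g + t * b * g')"
      if "a \<noteq> 0" "a' \<noteq> 0" "c = A * b * a' / a" for A r a a' g g' b c t :: complex
      using that by (simp add: field_simps)
    have "(\<integral>u. ?f u + of_real s * ?g u \<partial>circle_measure)
        = (\<integral>u. ?f u \<partial>circle_measure) + of_real s * (\<integral>u. ?g u \<partial>circle_measure)"
      by (subst Bochner_Integration.integral_add[OF int_f integrable_mult_right[OF int_g]])
         (simp only: integral_mult_right_zero)
    also have "\<dots> = of_real (1 + s)"
      by (simp only: mean_monic[OF R G_hol G_meas] mean_monic_cnj[OF R G_hol G_meas] G0) simp
    finally have "1 + s = norm (\<integral>u. ?f u + of_real s * ?g u \<partial>circle_measure)"
      using s by (simp only: norm_of_real)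
    also have "\<dots> \<le> (\<integral>u. norm (?f u + of_real s * ?g u) \<partial>circle_measure)"
      by (rule integral_norm_bound)
    also have "\<dots> \<le> (\<integral>u. M * ?P u \<partial>circle_measure)"
    proof (intro integral_mono_AE)
      show "integrable circle_measure (\<lambda>u. norm (?f u + of_real s * ?g u))"
        by (intro integrable_norm Bochner_Integration.integrable_add integrable_mult_right int_f int_g)
      show "integrable circle_measure (\<lambda>u. M * ?P u)"
        by (rule integrable_mult_right[OF int_P])
      show "AE u in circle_measure. norm (?f u + of_real s * ?g u) \<le> M * ?P u"
        using AE_circle_measure
      proof eventually_elim
        fix u :: complex assume u: "norm u = 1"
        have Hu: "H u \<noteq> 0" using H_nz u by simp
        have "u ^ k * cnj u ^ k = 1"
          using u by (simp add: power_mult_distrib[symmetric] complex_norm_square[symmetric])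
        hence "cnj u ^ k = u ^ k * cnj (blaschke u) * cnj (H u) / H u"
          using Hu unfolding blaschke_circle[OF u]
          by (simp add: power_mult mult_2 power_add power2_eq_square mult.assoc[symmetric])
        hence "?f u + of_real s * ?g u
            = u ^ k * ?R u / H u * (G u + of_real s * cnj (blaschke u) * cnj (G u))"
          using Hu by (intro regroup) auto
        hence "?f u + of_real s * ?g u = u ^ k * ?R u / H u * of_real (?P u)"
          by (simp only: Peq[OF u])
        hence "norm (?f u + of_real s * ?g u) = norm (?R u) / norm (H u) * norm (complex_of_real (?P u))"
          using u by (simp only: norm_mult norm_divide norm_power power_one mult_1_left)
        also have "norm (complex_of_real (?P u)) = ?P u"
          unfolding norm_of_real using s by (intro abs_of_nonneg mult_nonneg_nonneg) (auto simp: power_le_one)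
        also have "norm (?R u) / norm (H u) * ?P u \<le> M * ?P u"
          using M[OF u] Hu s
          by (intro mult_right_mono mult_nonneg_nonneg) (auto simp: field_simps power_le_one)
        finally show "norm (?f u + of_real s * ?g u) \<le> M * ?P u" .
      qed
    qed
    also have "\<dots> = M" using mean_P by (simp only: integral_mult_right_zero)
    finally show ?thesis .
  qed
  hence "\<forall>\<^sub>F s in at_left 1. 1 + s \<le> M"
    by (intro eventually_mono[OF eventually_at_left_real[of 0 1]]) auto
  moreover have "((\<lambda>s::real. 1 + s) \<longlongrightarrow> 1 + 1) (at_left 1)"
    by (intro tendsto_intros)
  ultimately have "1 + 1 \<le> M"
    by (intro tendsto_upperbound[of "\<lambda>s. 1 + s" "1 + 1" "at_left 1" M]) auto
  thus ?thesis by simp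
qed

end

section \<open>Approximation of the weights\<close>

lemma poly_map_of_real_pcompose_square:
  "poly (map_poly complex_of_real (pcompose g [:0, 0, 1:])) u = poly (map_poly of_real g) (u\<^sup>2)"
  by (induction g) (simp_all add: pcompose_pCons map_poly_pCons power2_eq_square mult.assoc)

lemma gbinomial_of_real: "(complex_of_real b) gchoose n = of_real (b gchoose n)"
  by (simp add: gbinomial_prod_rev)

text \<open>For \<open>r < 1\<close> the binomial series converges absolutely and uniformly on the
  closed disc, and \<open>|1 + r z|^b\<close> is bounded below there by some \<open>c > 0\<close>. A
  tail below \<open>e c\<close> is therefore a relative error of at most \<open>e\<close>.\<close>

lemma binomial_poly_approx:
  fixes b r e :: real
  assumes r: "0 < r" "r < 1" and e: "0 < e"
  obtains h :: "real poly" where "poly h 0 = 1"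
    "\<And>z :: complex. norm z \<le> 1 \<Longrightarrow>
      norm (poly (map_poly of_real h) z - (1 + of_real r * z) powr of_real b) \<le> e * norm (1 + of_real r * z) powr b"
proof -
  \<comment> \<open>The minimum covers both signs of \<open>b\<close>: the lower bound is reached at
    \<open>1 - r\<close> for \<open>b >= 0\<close> and at \<open>1 + r\<close> for
    \<open>b < 0\<close>.\<close>
  define c where "c = min ((1 - r) powr b) ((1 + r) powr b)"
  have c: "c > 0" using r by (simp add: c_def)
  have nz: "1 - r \<le> norm (1 + of_real r * z)" "norm (1 + of_real r * z) \<le> 1 + r" if "norm z \<le> 1" for z :: complex
  proof -
    have n: "norm (of_real r * z) \<le> r" using that r by (simp add: norm_mult mult_left_le)
    show "1 - r \<le> norm (1 + of_real r * z)"
      using norm_diff_ineq[of 1 "of_real r * z"] n by simp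
    show "norm (1 + of_real r * z) \<le> 1 + r"
      using norm_triangle_ineq[of 1 "of_real r * z"] n by simp
  qed
  have cle: "c \<le> norm (1 + of_real r * z) powr b" if "norm z \<le> 1" for z :: complex
  proof (cases "b \<ge> 0")
    case True
    hence "(1 - r) powr b \<le> norm (1 + of_real r * z) powr b"
      using nz[OF that] r by (intro powr_mono2) auto
    thus ?thesis by (simp add: c_def)
  next
    case False
    moreover have "norm (1 + of_real r * z) > 0" using nz[OF that] r by linarith
    ultimately have "(1 + r) powr b \<le> norm (1 + of_real r * z) powr b"
      using nz[OF that] r by (intro powr_mono2') auto
    thus ?thesis by (simp add: c_def)
  qed
  define a where "a = (\<lambda>n. (b gchoose n) * r ^ n)"
  have summ: "summable (\<lambda>n. \<bar>a n\<bar>)"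
  proof -
    \<comment> \<open>Convergence at a radius between \<open>r\<close> and 1 gives absolute
      convergence at \<open>r\<close>.\<close>
    define r' where "r' = (1 + r) / 2"
    have r': "r < r'" "r' < 1" "0 < r'" using r by (auto simp: r'_def)
    have "summable (\<lambda>n. (complex_of_real b gchoose n) * of_real r' ^ n)"
      using gen_binomial_complex[of "of_real r'" "of_real b"] r' by (auto simp: sums_iff)
    hence "summable (\<lambda>n. norm ((complex_of_real b gchoose n) * of_real r ^ n))"
      by (rule powser_insidea) (use r r' in auto)
    thus ?thesis using r by (simp add: a_def gbinomial_of_real norm_mult norm_power abs_mult power_abs)
  qed
  have sums: "(\<lambda>n. of_real (a n) * z ^ n) sums (1 + of_real r * z) powr of_real b" if "norm z \<le> 1" for z :: complex
  proof -
    have "norm (of_real r * z) \<le> r" using that r by (simp add: norm_mult mult_left_le)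
    hence "norm (of_real r * z) < 1" using r by simp
    from gen_binomial_complex[OF this, of "of_real b"] show ?thesis
      by (simp add: a_def gbinomial_of_real power_mult_distrib mult.assoc)
  qed
  have "(\<lambda>N. \<Sum>n. \<bar>a (n + N)\<bar>) \<longlonglongrightarrow> 0"
    by (rule suminf_exist_split2) (use summ in auto)
  moreover have "e * c > 0" using e c by simp
  ultimately obtain N0 where N0: "\<And>N. N \<ge> N0 \<Longrightarrow> norm (\<Sum>n. \<bar>a (n + N)\<bar>) < e * c"
    using LIMSEQ_D by fastforce
  \<comment> \<open>At least one term is kept, so the constant coefficient 1 is not lost.\<close>
  define N where "N = Suc N0"
  define h where "h = (\<Sum>n<N. monom (a n) n)"
  have ph: "poly (map_poly of_real h) z = (\<Sum>n<N. of_real (a n) * z ^ n)" for z :: complex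
  proof -
    have "map_poly complex_of_real h = (\<Sum>n<N. monom (of_real (a n)) n)"
      by (rule poly_eqI) (simp add: h_def coeff_map_poly coeff_sum)
    thus ?thesis by (simp add: poly_sum poly_monom)
  qed
  show ?thesis
  proof
    show "poly h 0 = 1"
      by (simp add: h_def poly_sum poly_monom N_def sum.lessThan_Suc_shift a_def)
    fix z :: complex assume z: "norm z \<le> 1"
    have s: "(\<lambda>n. of_real (a (n + N)) * z ^ (n + N)) sums ((1 + of_real r * z) powr of_real b - poly (map_poly of_real h) z)"
      unfolding ph by (subst sums_iff_shift) (use sums[OF z] in simp)
    have b1: "norm (of_real (a (n + N)) * z ^ (n + N)) \<le> \<bar>a (n + N)\<bar>" for n
      using z by (simp add: norm_mult norm_power mult_left_le power_le_one)
    have s2: "summable (\<lambda>n. \<bar>a (n + N)\<bar>)" using summ by (rule summable_ignore_initial_segment)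
    have "norm ((1 + of_real r * z) powr of_real b - poly (map_poly of_real h) z) \<le> (\<Sum>n. \<bar>a (n + N)\<bar>)"
      using norm_suminf_le[OF b1 s2] s by (simp add: sums_iff)
    also have "\<dots> \<le> e * c" using N0[of N] by (simp add: N_def)
    also have "\<dots> \<le> e * norm (1 + of_real r * z) powr b"
      using cle[OF z] e by simp
    finally show "norm (poly (map_poly of_real h) z - (1 + of_real r * z) powr of_real b) \<le> e * norm (1 + of_real r * z) powr b"
      by (simp add: norm_minus_commute)
  qed
qed

text \<open>The difference of the squares is \<open>(1 - r)^2 (1 - Re v) / 2\<close>. The loss
  factor tends to 1 with \<open>r\<close> and is uniform up to the zero \<open>v = -1\<close>, so
  the bound survives where the two moduli are not comparable in the other direction.\<close>

lemma norm_one_plus_scaled_ge: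
  fixes v :: complex
  assumes "norm v = 1" "0 < r" "r < 1"
  shows "(1 + r) / 2 * norm (1 + v) \<le> norm (1 + of_real r * v)"
proof (rule power2_le_imp_le)
  have v: "(Re v)\<^sup>2 + (Im v)\<^sup>2 = 1" using assms(1) by (simp add: cmod_def)
  have "Re v \<le> 1" using abs_Re_le_cmod[of v] assms(1) by simp
  hence "0 \<le> (1 - r)\<^sup>2 * (1 - Re v) / 2" by simp
  also have "\<dots> = 1 + 2 * r * Re v + r\<^sup>2 - ((1 + r) / 2)\<^sup>2 * (2 + 2 * Re v)"
    by (simp add: power2_eq_square field_simps)
  also have "1 + 2 * r * Re v + r\<^sup>2 = (norm (1 + of_real r * v))\<^sup>2"
  proof -
    have "(norm (1 + of_real r * v))\<^sup>2 = 1 + 2 * r * Re v + r\<^sup>2 * ((Re v)\<^sup>2 + (Im v)\<^sup>2)"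
      unfolding cmod_power2 by (simp add: power2_eq_square algebra_simps)
    thus ?thesis by (simp only: v)
  qed
  also have "2 + 2 * Re v = (norm (1 + v))\<^sup>2"
  proof -
    have "(norm (1 + v))\<^sup>2 = 1 + 2 * Re v + ((Re v)\<^sup>2 + (Im v)\<^sup>2)"
      unfolding cmod_power2 by (simp add: power2_eq_square algebra_simps)
    thus ?thesis by (simp only: v)
  qed
  finally show "((1 + r) / 2 * norm (1 + v))\<^sup>2 \<le> (norm (1 + of_real r * v))\<^sup>2"
    by (simp only: power_mult_distrib)
qed simp

lemma norm_xproj:
  assumes "norm u = 1"
  shows "norm (1 + u\<^sup>2) = norm (xproj u)"
proof -
  have "1 + u\<^sup>2 = u * xproj u"
    using assms by (simp add: xproj_eq distrib_left power2_eq_square complex_norm_square[symmetric])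
  thus ?thesis using assms by (simp add: norm_mult)
qed

text \<open>Substitutes \<open>z = u^2\<close>. The error being relative, the lower bound is
  positive and also excludes zeros in the closed disc.\<close>

lemma szego_function_approx:
  fixes b r e :: real
  assumes r: "0 < r" "r < 1" and e: "0 < e" "e < 1"
  obtains h :: "real poly" where "poly h 0 = 1"
    "\<And>u. norm u \<le> 1 \<Longrightarrow> poly (map_poly complex_of_real h) u \<noteq> 0"
    "\<And>u. norm u \<le> 1 \<Longrightarrow> (1 - e) * norm (1 + of_real r * u\<^sup>2) powr b \<le> norm (poly (map_poly complex_of_real h) u)"
    "\<And>u. norm u \<le> 1 \<Longrightarrow> norm (poly (map_poly complex_of_real h) u) \<le> (1 + e) * norm (1 + of_real r * u\<^sup>2) powr b"
proof -
  obtain g :: "real poly" where g: "poly g 0 = 1" "\<And>z :: complex. norm z \<le> 1 \<Longrightarrow>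
      norm (poly (map_poly of_real g) z - (1 + of_real r * z) powr of_real b) \<le> e * norm (1 + of_real r * z) powr b"
    using binomial_poly_approx[OF r e(1)] by blast
  define h where "h = pcompose g [:0, 0, 1:]"
  have mh: "poly (map_poly complex_of_real h) u = poly (map_poly of_real g) (u\<^sup>2)" for u
    unfolding h_def by (rule poly_map_of_real_pcompose_square)
  have nz: "1 + of_real r * u\<^sup>2 \<noteq> 0" if "norm u \<le> 1" for u :: complex
  proof
    assume "1 + of_real r * u\<^sup>2 = 0"
    hence "norm (of_real r * u\<^sup>2) = norm (-1 :: complex)" by (metis add_eq_0_iff)
    hence "r * (norm u)\<^sup>2 = 1" using r by (simp add: norm_mult norm_power)
    moreover have "r * (norm u)\<^sup>2 \<le> r * 1" using that r by (intro mult_left_mono) (auto simp: power_le_one)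
    ultimately show False using r by simp
  qed
  have main: "\<bar>norm (poly (map_poly complex_of_real h) u) - norm (1 + of_real r * u\<^sup>2) powr b\<bar>
      \<le> e * norm (1 + of_real r * u\<^sup>2) powr b" if "norm u \<le> 1" for u :: complex
  proof -
    have u2: "norm (u\<^sup>2) \<le> 1" using that by (simp add: norm_power power_le_one)
    have "\<bar>norm (poly (map_poly complex_of_real h) u) - norm ((1 + of_real r * u\<^sup>2) powr of_real b)\<bar>
       \<le> norm (poly (map_poly complex_of_real h) u - (1 + of_real r * u\<^sup>2) powr of_real b)"
      by (rule norm_triangle_ineq3)
    also have "\<dots> \<le> e * norm (1 + of_real r * u\<^sup>2) powr b"
      unfolding mh by (rule g(2)[OF u2])
    finally show ?thesis by (simp add: norm_powr_real_powr')
  qed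
  show ?thesis
  proof (rule that)
    show "poly h 0 = 1" by (simp add: h_def poly_pcompose g)
    fix u :: complex assume u: "norm u \<le> 1"
    show l: "(1 - e) * norm (1 + of_real r * u\<^sup>2) powr b \<le> norm (poly (map_poly complex_of_real h) u)"
      and "norm (poly (map_poly complex_of_real h) u) \<le> (1 + e) * norm (1 + of_real r * u\<^sup>2) powr b"
      using main[OF u] by (auto simp: algebra_simps abs_le_iff)
    have "0 < (1 - e) * norm (1 + of_real r * u\<^sup>2) powr b" using nz[OF u] e by simp
    with l show "poly (map_poly complex_of_real h) u \<noteq> 0" by auto
  qed
qed

text \<open>Only a one-sided comparison is possible: \<open>|x| powr b\<close> vanishes at
  \<open>x = 0\<close>, whereas the polynomial has no zero on the circle.\<close>

lemma weight_minorant: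
  fixes b e :: real
  assumes b: "0 \<le> b" "b \<le> 1" and e: "0 < e" "e < 1"
  obtains h :: "real poly" where "poly h 0 = 1"
    "\<And>u. norm u \<le> 1 \<Longrightarrow> poly (map_poly complex_of_real h) u \<noteq> 0"
    "\<And>u. norm u = 1 \<Longrightarrow> (1 - e) * norm (xproj u) powr b \<le> norm (poly (map_poly complex_of_real h) u)"
proof -
  \<comment> \<open>With \<open>q = (1 + r) / 2 = 1 - e / 4\<close>, truncation and scaling together
    lose the factor \<open>(1 - e/2) (1 - e/4)\<close>, which is at least
    \<open>1 - e\<close>.\<close>
  define r where "r = 1 - e / 2"
  have r: "0 < r" "r < 1" using e by (auto simp: r_def)
  obtain h :: "real poly" where h: "poly h 0 = 1"
    "\<And>u. norm u \<le> 1 \<Longrightarrow> poly (map_poly complex_of_real h) u \<noteq> 0"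
    "\<And>u. norm u \<le> 1 \<Longrightarrow> (1 - e / 2) * norm (1 + of_real r * u\<^sup>2) powr b \<le> norm (poly (map_poly complex_of_real h) u)"
  proof (rule szego_function_approx[OF r, of "e / 2" b])
    show "0 < e / 2" "e / 2 < 1" using e by auto
  qed (rule that)
  show ?thesis
  proof (rule that[OF h(1,2)])
    fix u :: complex assume u: "norm u = 1"
    define q where "q = (1 + r) / 2"
    have q: "0 < q" "q \<le> 1" using r by (auto simp: q_def)
    \<comment> \<open>\<open>q <= q powr b\<close> because \<open>q <= 1\<close> and
      \<open>b <= 1\<close>.\<close>
    have "q * norm (xproj u) powr b \<le> q powr b * norm (xproj u) powr b"
      using q b powr_mono'[of b 1 q] by (intro mult_right_mono) auto
    also have "\<dots> = (q * norm (xproj u)) powr b" using q by (simp add: powr_mult)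
    also have "\<dots> \<le> norm (1 + of_real r * u\<^sup>2) powr b"
      using norm_one_plus_scaled_ge[of "u\<^sup>2" r] r u q b
      by (intro powr_mono2) (auto simp: norm_power norm_xproj q_def)
    finally have 1: "q * norm (xproj u) powr b \<le> norm (1 + of_real r * u\<^sup>2) powr b" .
    have "1 - e \<le> (1 - e / 2) * q" unfolding q_def r_def using e by (simp add: field_simps)
    hence "(1 - e) * norm (xproj u) powr b \<le> (1 - e / 2) * q * norm (xproj u) powr b"
      by (intro mult_right_mono) auto
    also have "\<dots> \<le> (1 - e / 2) * norm (1 + of_real r * u\<^sup>2) powr b"
      using mult_left_mono[OF 1, of "1 - e / 2"] e by (simp add: mult.assoc)
    also have "\<dots> \<le> norm (poly (map_poly complex_of_real h) u)" using h(3)[of u] u by simp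
    finally show "(1 - e) * norm (xproj u) powr b \<le> norm (poly (map_poly complex_of_real h) u)" .
  qed
qed

text \<open>Uses the exponent \<open>-b\<close>: for fixed \<open>r < 1\<close> the function
  \<open>|1 + r u^2|^(-b)\<close> stays bounded even though \<open>|x|^(-b)\<close> does not when
  \<open>b > 0\<close>, and multiplication by \<open>|x|^b\<close> is harmless at
  \<open>x = 0\<close>.\<close>

lemma weight_majorant:
  fixes b e :: real
  assumes b: "0 \<le> b" "b \<le> 1" and e: "0 < e" "e < 1"
  obtains h :: "real poly" where "poly h 0 = 1"
    "\<And>u. norm u \<le> 1 \<Longrightarrow> poly (map_poly complex_of_real h) u \<noteq> 0"
    "\<And>u. norm u = 1 \<Longrightarrow> norm (poly (map_poly complex_of_real h) u) * norm (xproj u) powr b \<le> 1 + e"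
proof -
  \<comment> \<open>Now \<open>q = 1 - e / 8\<close>, and the constants are such that
    \<open>(1 + e/4) / q <= 1 + e\<close>.\<close>
  define r where "r = 1 - e / 4"
  have r: "0 < r" "r < 1" using e by (auto simp: r_def)
  obtain h :: "real poly" where h: "poly h 0 = 1"
    "\<And>u. norm u \<le> 1 \<Longrightarrow> poly (map_poly complex_of_real h) u \<noteq> 0"
    "\<And>u. norm u \<le> 1 \<Longrightarrow> norm (poly (map_poly complex_of_real h) u) \<le> (1 + e / 4) * norm (1 + of_real r * u\<^sup>2) powr (- b)"
  proof (rule szego_function_approx[OF r, of "e / 4" "- b"])
    show "0 < e / 4" "e / 4 < 1" using e by auto
  qed (rule that)
  show ?thesis
  proof (rule that[OF h(1,2)])
    fix u :: complex assume u: "norm u = 1"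
    define q where "q = (1 + r) / 2"
    have q: "0 < q" "q \<le> 1" using r by (auto simp: q_def)
    let ?y = "norm (1 + of_real r * u\<^sup>2)"
    have y: "?y > 0"
    proof -
      have "norm (complex_of_real r * u\<^sup>2) = r" using r u by (simp add: norm_mult norm_power)
      hence "1 - r \<le> norm (1 + complex_of_real r * u\<^sup>2)"
        using norm_diff_ineq[of 1 "complex_of_real r * u\<^sup>2"] by simp
      thus ?thesis using r by linarith
    qed
    have "q * norm (xproj u) powr b \<le> q powr b * norm (xproj u) powr b"
      using q b powr_mono'[of b 1 q] by (intro mult_right_mono) auto
    also have "\<dots> = (q * norm (xproj u)) powr b" using q by (simp add: powr_mult)
    also have "\<dots> \<le> ?y powr b"
      using norm_one_plus_scaled_ge[of "u\<^sup>2" r] r u q b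
      by (intro powr_mono2) (auto simp: norm_power norm_xproj q_def)
    finally have 1: "norm (xproj u) powr b \<le> ?y powr b / q" using q by (simp add: field_simps)
    have "norm (poly (map_poly complex_of_real h) u) * norm (xproj u) powr b
        \<le> ((1 + e / 4) * ?y powr (- b)) * (?y powr b / q)"
      using h(3)[of u] u 1 e by (intro mult_mono mult_nonneg_nonneg) auto
    also have "\<dots> = (1 + e / 4) * (?y powr (- b) * ?y powr b) / q" by simp
    also have "?y powr (- b) * ?y powr b = 1" using y by (simp add: powr_add[symmetric])
    also have "(1 + e / 4) * 1 / q = (1 + e / 4) / q" by simp
    also have "\<dots> \<le> 1 + e"
    proof -
      have "e * e \<le> e" using e by (simp add: mult_left_le)
      moreover have "(1 + e) * q = 1 + 7 / 8 * e - e * e / 8"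
        unfolding q_def r_def by (simp add: field_simps)
      ultimately have "1 + e / 4 \<le> (1 + e) * q" using e by linarith
      thus ?thesis using q by (simp add: field_simps)
    qed
    finally show "norm (poly (map_poly complex_of_real h) u) * norm (xproj u) powr b \<le> 1 + e" .
  qed
qed

section \<open>Energy and equilibrium measure\<close>

text \<open>The squared modulus of the inner product of the unit vectors of C^2 in the directions
  \<open>(1, z)\<close> and \<open>(1, w)\<close>. Thus \<open>1 - chordal z w\<close> is the
  squared chordal distance on a sphere of diameter 1.\<close>

definition chordal :: "complex \<Rightarrow> complex \<Rightarrow> real" where
  "chordal z w = (norm (1 + z * cnj w))\<^sup>2 / ((1 + (norm z)\<^sup>2) * (1 + (norm w)\<^sup>2))"

text \<open>The one-variable correction that turns \<open>-ln |z - w|\<close> into the nonnegative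
  kernel \<open>-ln (1 - chordal z w) / 2\<close>.\<close>

definition half_log :: "complex \<Rightarrow> real" where
  "half_log z = ln (1 + (norm z)\<^sup>2) / 2"

text \<open>The power series of \<open>-ln (1 - s) / 2\<close> at \<open>s = chordal z w\<close>,
  with values in the extended nonnegative reals so that it is infinite on the diagonal of its own
  accord.\<close>

definition chordal_kernel :: "complex \<Rightarrow> complex \<Rightarrow> ennreal" where
  "chordal_kernel z w = (\<Sum>n. ennreal (chordal z w ^ Suc n / (2 * real (Suc n))))"

lemma chordal_nonneg [simp]: "0 \<le> chordal z w"
  by (simp add: chordal_def)

lemma one_plus_norm_square_pos [simp]: "0 < 1 + (norm z)\<^sup>2" "1 + (norm z)\<^sup>2 \<noteq> 0"
proof -
  show "0 < 1 + (norm z)\<^sup>2" using zero_le_power2[of "norm z"] by linarith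
  thus "1 + (norm z)\<^sup>2 \<noteq> 0" by linarith
qed

text \<open>Lagrange's identity for the vectors \<open>(1, z)\<close> and
  \<open>(1, w)\<close>.\<close>

lemma one_minus_chordal:
  "1 - chordal z w = (norm (z - w))\<^sup>2 / ((1 + (norm z)\<^sup>2) * (1 + (norm w)\<^sup>2))"
proof -
  have "(norm (1 + z * cnj w))\<^sup>2 + (norm (z - w))\<^sup>2 = (1 + (norm z)\<^sup>2) * (1 + (norm w)\<^sup>2)"
    unfolding cmod_power2 by (simp add: power2_eq_square algebra_simps)
  hence "1 - chordal z w = ((norm (1 + z * cnj w))\<^sup>2 + (norm (z - w))\<^sup>2 - (norm (1 + z * cnj w))\<^sup>2)
      / ((1 + (norm z)\<^sup>2) * (1 + (norm w)\<^sup>2))"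
    unfolding chordal_def diff_divide_distrib by simp
  thus ?thesis by simp
qed

lemma chordal_le_1: "chordal z w \<le> 1"
proof -
  have "0 \<le> 1 - chordal z w" unfolding one_minus_chordal by simp
  thus ?thesis by simp
qed

lemma chordal_eq_1_iff: "chordal z w = 1 \<longleftrightarrow> z = w"
proof -
  have "chordal z w = 1 \<longleftrightarrow> 1 - chordal z w = 0" by auto
  also have "\<dots> \<longleftrightarrow> z = w" unfolding one_minus_chordal by simp
  finally show ?thesis .
qed

lemma half_log_nonneg: "0 \<le> half_log z"
  by (simp add: half_log_def)

lemma half_log_diff_ln:
  assumes "z \<noteq> w"
  shows "half_log z + half_log w - ln (norm (z - w)) = - ln (1 - chordal z w) / 2"
proof -
  have "ln (d\<^sup>2 / (p * q)) = 2 * ln d - (ln p + ln q)" if "p > 0" "q > 0" "d > 0" for p q d :: real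
    using that by (simp add: ln_div ln_mult ln_realpow)
  from this[of "1 + (norm z)\<^sup>2" "1 + (norm w)\<^sup>2" "norm (z - w)"] assms
  show ?thesis unfolding one_minus_chordal half_log_def by simp
qed

text \<open>Divergence of the harmonic series, in agreement with the value that
  \<open>log_energy\<close> puts on the diagonal.\<close>

lemma chordal_kernel_diag: "chordal_kernel z z = top"
proof -
  have "\<not> summable (\<lambda>n. 1 / (2 * real (Suc n)))"
  proof
    assume "summable (\<lambda>n. 1 / (2 * real (Suc n)))"
    moreover have "2 * (1 / (2 * real (Suc n))) = inverse (real (Suc n))" for n
      by (simp add: divide_simps)
    ultimately have "summable (\<lambda>n. inverse (real (Suc n)))"
      using summable_mult[of "\<lambda>n. 1 / (2 * real (Suc n))" 2] by simp
    thus False using not_summable_harmonic[where 'a = real] summable_Suc_iff[of "\<lambda>n. inverse (real n)"] by simp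
  qed
  hence "(\<Sum>n. ennreal (1 / (2 * real (Suc n)))) = top"
    using summable_suminf_not_top[of "\<lambda>n. 1 / (2 * real (Suc n))"]
    by (metis divide_nonneg_nonneg mult_nonneg_nonneg of_nat_0_le_iff zero_le_numeral zero_le_one)
  thus ?thesis unfolding chordal_kernel_def using chordal_eq_1_iff[of z z] by simp
qed

lemma chordal_kernel_off_diag:
  assumes "z \<noteq> w"
  shows "chordal_kernel z w = ennreal (half_log z + half_log w - ln (norm (z - w)))"
proof -
  let ?s = "chordal z w"
  have s: "0 \<le> ?s" "?s < 1" using chordal_le_1[of z w] chordal_eq_1_iff[of z w] assms by auto
  have "(\<lambda>n. - ((- (- ?s)) ^ n) / real n) sums ln (1 + - ?s)"
    by (rule Complex_Transcendental.ln_series') (use s in auto)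
  hence "(\<lambda>n. - (?s ^ Suc n) / real (Suc n)) sums ln (1 - ?s)"
    by (subst sums_Suc_iff) simp
  from sums_mult[OF this, of "-1 / 2"]
  have "(\<lambda>n. ?s ^ Suc n / (2 * real (Suc n))) sums (- ln (1 - ?s) / 2)"
    by (simp add: field_simps)
  hence "chordal_kernel z w = ennreal (- ln (1 - ?s) / 2)"
    unfolding chordal_kernel_def using s by (subst suminf_ennreal2) (auto simp: sums_iff)
  thus ?thesis by (simp only: half_log_diff_ln[OF assms])
qed

lemma chordal_meas [measurable]: "(\<lambda>(z, w). chordal z w) \<in> borel_measurable (borel \<Otimes>\<^sub>M borel)"
proof -
  have "(\<lambda>p. chordal (fst p) (snd p)) \<in> borel_measurable (borel \<Otimes>\<^sub>M borel)"
    unfolding borel_prod chordal_def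
    by (intro borel_measurable_continuous_onI continuous_intros) auto
  thus ?thesis by (simp add: case_prod_unfold)
qed

lemma chordal_kernel_meas [measurable]:
  "(\<lambda>(z, w). chordal_kernel z w) \<in> borel_measurable (borel \<Otimes>\<^sub>M borel)"
  unfolding chordal_kernel_def by measurable

lemma half_log_cont: "continuous_on A half_log"
  unfolding half_log_def by (intro continuous_intros) auto

lemma half_log_meas [measurable]: "half_log \<in> borel_measurable borel"
  by (intro borel_measurable_continuous_onI half_log_cont)

text \<open>Negative contributions are moved to the other side, so the identity holds between
  nonnegative extended quantities and can be integrated without any subtraction.\<close>

lemma log_kernel_decomp:
  "(if z = w then \<infinity> else ennreal (- ln (cmod (z - w)))) + ennreal (half_log z + half_log w)
    = chordal_kernel z w + (if z = w then 0 else ennreal (ln (cmod (z - w))))"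
proof (cases "z = w")
  case False
  let ?l = "ln (norm (z - w))" and ?a = "half_log z + half_log w"
  have a: "?a \<ge> 0" using half_log_nonneg[of z] half_log_nonneg[of w] by simp
  have k: "?a - ?l \<ge> 0"
  proof -
    have "1 - chordal z w > 0" using chordal_le_1[of z w] chordal_eq_1_iff[of z w] False by auto
    hence "ln (1 - chordal z w) \<le> 0" by simp
    thus ?thesis unfolding half_log_diff_ln[OF False] by simp
  qed
  show ?thesis
  proof (cases "?l \<le> 0")
    case True
    thus ?thesis using False a k
      by (simp add: chordal_kernel_off_diag ennreal_neg ennreal_plus[symmetric] del: ennreal_plus)
  next
    case l: False
    thus ?thesis using False a k
      by (simp add: chordal_kernel_off_diag ennreal_neg ennreal_plus[symmetric] del: ennreal_plus)
  qed
qed (simp add: chordal_kernel_diag)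

section \<open>Energies of probability measures on a compact set\<close>

locale prob_on_compact = 
  fixes E :: "complex set" and \<nu> :: "complex measure"
  assumes compact_E: "compact E" and on_E: "\<nu> \<in> prob_measures_on E"
begin

sublocale prob_space \<nu>
  using on_E by (simp add: prob_measures_on_def)

lemma sets_eq [simp, measurable_cong]: "sets \<nu> = sets borel"
  using on_E by (simp add: prob_measures_on_def)

lemma space_eq [simp]: "space \<nu> = UNIV"
  using sets_eq_imp_space_eq[OF sets_eq] by simp

lemma AE_in: "AE z in \<nu>. z \<in> E"
proof -
  have "emeasure \<nu> E = 1" using on_E by (simp add: prob_measures_on_def)
  moreover have "E \<in> sets \<nu>" using compact_E by (simp add: borel_closed compact_imp_closed)
  ultimately show ?thesis by (simp add: AE_in_set_eq_1 emeasure_eq_measure)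
qed

lemma integrable_cont:
  fixes f :: "complex \<Rightarrow> 'b :: {banach, second_countable_topology}"
  assumes "f \<in> borel_measurable borel" "continuous_on E f"
  shows "integrable \<nu> f"
proof -
  have "bounded (f ` E)" by (intro compact_imp_bounded compact_continuous_image assms compact_E)
  then obtain B where "\<forall>x\<in>f ` E. norm x \<le> B" unfolding bounded_iff by blast
  hence "AE z in \<nu>. norm (f z) \<le> B" using AE_in by auto
  thus ?thesis using assms(1) by (intro integrable_const_bound) auto
qed

end

definition mutual :: "nat \<Rightarrow> complex measure \<Rightarrow> complex measure \<Rightarrow> real" where
  "mutual n \<nu> \<rho> = (\<integral>z. \<integral>w. chordal z w ^ n \<partial>\<rho> \<partial>\<nu>)"

definition chordal_energy :: "complex measure \<Rightarrow> complex measure \<Rightarrow> ennreal" where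
  "chordal_energy \<nu> \<rho> = (\<integral>\<^sup>+z. \<integral>\<^sup>+w. chordal_kernel z w \<partial>\<rho> \<partial>\<nu>)"

text \<open>An explicit feature map: up to binomial weights, these are the coordinates in which the
  n-th power of the chordal kernel is an inner product.\<close>

definition feature :: "nat \<Rightarrow> nat \<Rightarrow> nat \<Rightarrow> complex \<Rightarrow> complex" where
  "feature n j l z = z ^ j * cnj z ^ l / of_real ((1 + (norm z)\<^sup>2) ^ n)"

lemma feature_cont: "continuous_on A (feature n j l)"
  unfolding feature_def
  by (intro continuous_intros) (metis of_real_eq_0_iff one_plus_norm_square_pos(2) power_not_zero)

lemma feature_meas [measurable]: "feature n j l \<in> borel_measurable borel"
  by (intro borel_measurable_continuous_onI feature_cont)

text \<open>Binomial expansion of \<open>(1 + z cnj w)^n\<close> and of its conjugate. The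
  coefficients are nonnegative, which exhibits the power as a positive definite kernel.\<close>

lemma chordal_power_eq:
  "of_real (chordal z w ^ n)
    = (\<Sum>j\<le>n. \<Sum>l\<le>n. of_nat ((n choose j) * (n choose l)) * (feature n j l z * cnj (feature n j l w)))"
proof -
  let ?d = "\<lambda>z. complex_of_real (1 + (norm z)\<^sup>2) ^ n"
  have b: "(1 + z * cnj w) ^ n = (\<Sum>j\<le>n. of_nat (n choose j) * (z * cnj w) ^ j)"
    using binomial_ring[of "z * cnj w" 1 n] by (simp add: add.commute)
  have b': "cnj ((1 + z * cnj w) ^ n) = (\<Sum>l\<le>n. of_nat (n choose l) * (cnj z * w) ^ l)"
    unfolding b by simp
  have "of_real (chordal z w ^ n) = complex_of_real ((norm ((1 + z * cnj w) ^ n))\<^sup>2) / (?d z * ?d w)"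
    by (simp add: chordal_def power_divide power_mult_distrib norm_power power_mult[symmetric] mult.commute)
  also have "\<dots> = (1 + z * cnj w) ^ n * cnj ((1 + z * cnj w) ^ n) / (?d z * ?d w)"
    by (simp only: complex_norm_square)
  also have "\<dots> = (\<Sum>j\<le>n. \<Sum>l\<le>n. of_nat (n choose j) * (z * cnj w) ^ j
        * (of_nat (n choose l) * (cnj z * w) ^ l) / (?d z * ?d w))"
    by (simp only: b', simp only: b sum_product sum_divide_distrib)
  also have "\<dots> = (\<Sum>j\<le>n. \<Sum>l\<le>n. of_nat ((n choose j) * (n choose l)) * (feature n j l z * cnj (feature n j l w)))"
    by (intro sum.cong refl) (simp add: feature_def power_mult_distrib mult_ac)
  finally show ?thesis .
qed

locale prob_pair = \<nu>: prob_on_compact E \<nu> + \<rho>: prob_on_compact E \<rho> for E \<nu> \<rho>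
begin

lemma feature_integrable: "integrable \<nu> (feature n j l)" "integrable \<rho> (feature n j l)"
  by (intro \<nu>.integrable_cont \<rho>.integrable_cont feature_cont feature_meas)+

lemma mutual_eq:
  "of_real (mutual n \<nu> \<rho>) = (\<Sum>j\<le>n. \<Sum>l\<le>n. of_nat ((n choose j) * (n choose l)) *
      ((\<integral>z. feature n j l z \<partial>\<nu>) * cnj (\<integral>z. feature n j l z \<partial>\<rho>)))"
proof -
  have "of_real (mutual n \<nu> \<rho>) = (\<integral>z. \<integral>w. complex_of_real (chordal z w ^ n) \<partial>\<rho> \<partial>\<nu>)"
    unfolding mutual_def by (simp only: integral_complex_of_real)
  also have "\<dots> = (\<integral>z. (\<Sum>j\<le>n. \<Sum>l\<le>n. of_nat ((n choose j) * (n choose l)) *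
      (feature n j l z * cnj (\<integral>w. feature n j l w \<partial>\<rho>))) \<partial>\<nu>)"
    unfolding chordal_power_eq
    by (simp add: Bochner_Integration.integral_sum feature_integrable)
  also have "\<dots> = (\<Sum>j\<le>n. \<Sum>l\<le>n. of_nat ((n choose j) * (n choose l)) *
      ((\<integral>z. feature n j l z \<partial>\<nu>) * cnj (\<integral>z. feature n j l z \<partial>\<rho>)))"
    by (simp add: Bochner_Integration.integral_sum feature_integrable)
  finally show ?thesis .
qed

lemma mutual_eq_Re:
  "mutual n \<nu> \<rho> = (\<Sum>j\<le>n. \<Sum>l\<le>n. real ((n choose j) * (n choose l)) *
      Re ((\<integral>z. feature n j l z \<partial>\<nu>) * cnj (\<integral>z. feature n j l z \<partial>\<rho>)))"
proof -
  have "Re (of_nat k * c) = real k * Re c" for k c by simp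
  hence "Re (of_real (mutual n \<nu> \<rho>)) = (\<Sum>j\<le>n. \<Sum>l\<le>n. real ((n choose j) * (n choose l)) *
      Re ((\<integral>z. feature n j l z \<partial>\<nu>) * cnj (\<integral>z. feature n j l z \<partial>\<rho>)))"
    by (simp only: mutual_eq Re_sum)
  thus ?thesis by simp
qed

lemma mutual_nonneg: "0 \<le> mutual n \<nu> \<rho>"
  unfolding mutual_def by (intro Bochner_Integration.integral_nonneg) simp

text \<open>All terms are nonnegative, so the sum leaves both integrals. Each term is a finite real,
  which later lets energies be subtracted term by term.\<close>

lemma chordal_energy_eq: "chordal_energy \<nu> \<rho> = (\<Sum>n. ennreal (mutual (Suc n) \<nu> \<rho> / (2 * real (Suc n))))"
proof -
  have m [measurable]: "(\<lambda>(z, w). chordal z w) \<in> borel_measurable (borel \<Otimes>\<^sub>M \<rho>)"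
    by measurable
  have 1: "(\<integral>\<^sup>+w. ennreal (chordal z w ^ n / c) \<partial>\<rho>) = ennreal ((\<integral>w. chordal z w ^ n \<partial>\<rho>) / c)"
    if "c > 0" for z n c
  proof -
    have "integrable \<rho> (\<lambda>w. chordal z w ^ n / c)"
      using that by (intro \<rho>.integrable_const_bound[of _ "1 / c"])
         (auto simp: chordal_le_1 power_le_one divide_right_mono)
    hence "(\<integral>\<^sup>+w. ennreal (chordal z w ^ n / c) \<partial>\<rho>) = ennreal (\<integral>w. chordal z w ^ n / c \<partial>\<rho>)"
      using that by (intro nn_integral_eq_integral) auto
    thus ?thesis by simp
  qed
  have 2: "(\<integral>\<^sup>+z. ennreal ((\<integral>w. chordal z w ^ n \<partial>\<rho>) / c) \<partial>\<nu>) = ennreal (mutual n \<nu> \<rho> / c)"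
    if "c > 0" for n c
  proof -
    have nn: "0 \<le> (\<integral>w. chordal z w ^ n \<partial>\<rho>)" for z
      by (intro Bochner_Integration.integral_nonneg) simp
    have le: "(\<integral>w. chordal z w ^ n \<partial>\<rho>) \<le> 1" for z
    proof -
      have "(\<integral>w. chordal z w ^ n \<partial>\<rho>) \<le> (\<integral>w. 1 \<partial>\<rho>)"
        by (intro integral_mono \<rho>.integrable_const_bound[of _ 1]) (auto simp: chordal_le_1 power_le_one)
      thus ?thesis using \<rho>.prob_space by simp
    qed
    have [measurable]: "(\<lambda>z. \<integral>w. chordal z w ^ n \<partial>\<rho>) \<in> borel_measurable borel"
      by (intro \<rho>.borel_measurable_lebesgue_integral) measurable
    have "integrable \<nu> (\<lambda>z. (\<integral>w. chordal z w ^ n \<partial>\<rho>) / c)"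
      using that nn le by (intro \<nu>.integrable_const_bound[of _ "1 / c"]) (auto simp: divide_right_mono)
    hence "(\<integral>\<^sup>+z. ennreal ((\<integral>w. chordal z w ^ n \<partial>\<rho>) / c) \<partial>\<nu>)
        = ennreal (\<integral>z. (\<integral>w. chordal z w ^ n \<partial>\<rho>) / c \<partial>\<nu>)"
      using that nn by (intro nn_integral_eq_integral) auto
    thus ?thesis by (simp add: mutual_def)
  qed
  have "chordal_energy \<nu> \<rho> = (\<integral>\<^sup>+z. (\<Sum>n. \<integral>\<^sup>+w. ennreal (chordal z w ^ Suc n / (2 * real (Suc n))) \<partial>\<rho>) \<partial>\<nu>)"
    unfolding chordal_energy_def chordal_kernel_def
    by (intro nn_integral_cong nn_integral_suminf) measurable
  also have "\<dots> = (\<integral>\<^sup>+z. (\<Sum>n. ennreal ((\<integral>w. chordal z w ^ Suc n \<partial>\<rho>) / (2 * real (Suc n)))) \<partial>\<nu>)"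
    by (subst 1) auto
  also have "\<dots> = (\<Sum>n. \<integral>\<^sup>+z. ennreal ((\<integral>w. chordal z w ^ Suc n \<partial>\<rho>) / (2 * real (Suc n))) \<partial>\<nu>)"
  proof (intro nn_integral_suminf)
    fix n
    have [measurable]: "(\<lambda>z. \<integral>w. chordal z w ^ Suc n \<partial>\<rho>) \<in> borel_measurable borel"
      by (intro \<rho>.borel_measurable_lebesgue_integral) measurable
    show "(\<lambda>z. ennreal ((\<integral>w. chordal z w ^ Suc n \<partial>\<rho>) / (2 * real (Suc n)))) \<in> borel_measurable \<nu>"
      by measurable
  qed
  also have "\<dots> = (\<Sum>n. ennreal (mutual (Suc n) \<nu> \<rho> / (2 * real (Suc n))))"
    by (subst 2) auto
  finally show ?thesis .
qed

text \<open>\<open>mutual\<close> is a weighted sesquilinear form in the feature moments, so this is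
  its value on the signed measure \<open>\<nu> - \<rho>\<close>: a weighted sum of squares.\<close>

lemma mutual_discrepancy:
  "mutual n \<nu> \<nu> + mutual n \<rho> \<rho> - 2 * mutual n \<nu> \<rho>
    = (\<Sum>j\<le>n. \<Sum>l\<le>n. real ((n choose j) * (n choose l)) *
        (norm ((\<integral>z. feature n j l z \<partial>\<nu>) - (\<integral>z. feature n j l z \<partial>\<rho>)))\<^sup>2)"
proof -
  interpret \<nu>\<nu>: prob_pair E \<nu> \<nu> ..
  interpret \<rho>\<rho>: prob_pair E \<rho> \<rho> ..
  have key: "c * Re (a * cnj a) + c * Re (b * cnj b) - 2 * (c * Re (a * cnj b)) = c * (norm (a - b))\<^sup>2"
    for a b :: complex and c :: real
    unfolding cmod_power2 by (simp add: power2_eq_square algebra_simps)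
  show ?thesis
    unfolding \<nu>\<nu>.mutual_eq_Re \<rho>\<rho>.mutual_eq_Re mutual_eq_Re
      sum_distrib_left sum.distrib[symmetric] sum_subtractf[symmetric]
    by (intro sum.cong refl key)
qed

end

context prob_on_compact
begin

sublocale self: prob_pair E \<nu> \<nu> ..

lemma half_log_integrable: "integrable \<nu> half_log"
  by (intro integrable_cont half_log_cont half_log_meas)

lemma nn_integral_half_log: "(\<integral>\<^sup>+z. ennreal (half_log z) \<partial>\<nu>) = ennreal (\<integral>z. half_log z \<partial>\<nu>)"
  by (intro nn_integral_eq_integral half_log_integrable) (simp add: half_log_nonneg)

lemma integral_half_log_nonneg: "0 \<le> (\<integral>z. half_log z \<partial>\<nu>)"
  by (intro Bochner_Integration.integral_nonneg half_log_nonneg)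

text \<open>\<open>log_kernel_decomp\<close> integrated twice. The subtraction in
  \<open>log_energy\<close> is carried out only once its negative part \<open>Q\<close> is known to
  be finite.\<close>

lemma log_energy_eq:
  "log_energy \<nu> = enn2ereal (chordal_energy \<nu> \<nu>) - ereal (2 * (\<integral>z. half_log z \<partial>\<nu>))"
proof -
  let ?p = "\<lambda>z w. if z = w then \<infinity> else ennreal (- ln (cmod (z - w)))"
  let ?q = "\<lambda>z w. if z = w then 0 else ennreal (ln (cmod (z - w)))"
  let ?a = "\<integral>z. half_log z \<partial>\<nu>"
  define P where "P = (\<integral>\<^sup>+z. \<integral>\<^sup>+w. ?p z w \<partial>\<nu> \<partial>\<nu>)"
  define Q where "Q = (\<integral>\<^sup>+z. \<integral>\<^sup>+w. ?q z w \<partial>\<nu> \<partial>\<nu>)"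
  have [measurable]: "(\<lambda>(z, w). ?p z w) \<in> borel_measurable (borel \<Otimes>\<^sub>M borel)"
    "(\<lambda>(z, w). ?q z w) \<in> borel_measurable (borel \<Otimes>\<^sub>M borel)"
    by measurable
  have aa: "(\<integral>\<^sup>+z. \<integral>\<^sup>+w. ennreal (half_log z + half_log w) \<partial>\<nu> \<partial>\<nu>) = ennreal (2 * ?a)"
  proof -
    have "(\<integral>\<^sup>+w. ennreal (half_log z + half_log w) \<partial>\<nu>) = ennreal (half_log z) + ennreal ?a" for z
      by (simp add: ennreal_plus half_log_nonneg nn_integral_add emeasure_space_1[simplified]
          nn_integral_half_log)
    hence "(\<integral>\<^sup>+z. \<integral>\<^sup>+w. ennreal (half_log z + half_log w) \<partial>\<nu> \<partial>\<nu>) = ennreal ?a + ennreal ?a"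
      by (simp add: nn_integral_add emeasure_space_1[simplified] nn_integral_half_log)
    thus ?thesis using integral_half_log_nonneg by (simp add: ennreal_plus[symmetric] del: ennreal_plus)
  qed
  have "P + ennreal (2 * ?a) = (\<integral>\<^sup>+z. \<integral>\<^sup>+w. ?p z w + ennreal (half_log z + half_log w) \<partial>\<nu> \<partial>\<nu>)"
    unfolding P_def aa[symmetric] by (simp add: nn_integral_add)
  also have "\<dots> = (\<integral>\<^sup>+z. \<integral>\<^sup>+w. chordal_kernel z w + ?q z w \<partial>\<nu> \<partial>\<nu>)"
    by (simp only: log_kernel_decomp)
  also have "\<dots> = chordal_energy \<nu> \<nu> + Q"
    unfolding Q_def chordal_energy_def by (simp add: nn_integral_add)
  finally have eq: "P + ennreal (2 * ?a) = chordal_energy \<nu> \<nu> + Q" .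
  \<comment> \<open>On the support \<open>ln t <= t <= 2 B\<close> for every distance
    \<open>t\<close>, with \<open>B\<close> a bound for \<open>E\<close>.\<close>
  have "Q < top"
  proof -
    obtain B where B: "\<And>z. z \<in> E \<Longrightarrow> norm z \<le> B" "B > 0"
      using compact_imp_bounded[OF compact_E] unfolding bounded_pos by blast
    have "Q \<le> (\<integral>\<^sup>+z. \<integral>\<^sup>+w. ennreal (2 * B) \<partial>\<nu> \<partial>\<nu>)"
      unfolding Q_def
    proof (rule nn_integral_mono_AE)
      show "AE z in \<nu>. (\<integral>\<^sup>+w. ?q z w \<partial>\<nu>) \<le> (\<integral>\<^sup>+w. ennreal (2 * B) \<partial>\<nu>)"
        using AE_in
      proof eventually_elim
        fix z assume z: "z \<in> E"
        show "(\<integral>\<^sup>+w. ?q z w \<partial>\<nu>) \<le> (\<integral>\<^sup>+w. ennreal (2 * B) \<partial>\<nu>)"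
        proof (rule nn_integral_mono_AE)
          show "AE w in \<nu>. ?q z w \<le> ennreal (2 * B)"
            using AE_in
          proof eventually_elim
            fix w assume w: "w \<in> E"
            show "?q z w \<le> ennreal (2 * B)"
            proof (cases "z = w")
              case False
              hence "ln (norm (z - w)) \<le> norm (z - w)"
                using ln_le_minus_one[of "norm (z - w)"] by simp
              also have "\<dots> \<le> 2 * B" using norm_triangle_ineq4[of z w] B(1)[OF z] B(1)[OF w] by linarith
              finally show ?thesis using False by (simp add: ennreal_leI)
            qed simp
          qed
        qed
      qed
    qed
    also have "\<dots> = ennreal (2 * B)" by (simp add: emeasure_space_1[simplified])
    finally show ?thesis by (rule le_less_trans) simp
  qed
  then obtain q where q: "Q = ennreal q" "q \<ge> 0" by (cases Q) auto
  have le: "log_energy \<nu> = enn2ereal P - enn2ereal Q"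
    by (simp add: log_energy_def P_def Q_def)
  show ?thesis
  proof (cases "chordal_energy \<nu> \<nu>")
    case top
    hence "P = top" using eq by (metis ennreal_add_eq_top ennreal_neq_top infinity_ennreal_def top_add)
    thus ?thesis unfolding le top q using q by simp
  next
    case (real j)
    hence "P \<noteq> top" using eq q by (metis ennreal_add_eq_top ennreal_neq_top infinity_ennreal_def top_add)
    then obtain p where p: "P = ennreal p" "p \<ge> 0" by (cases P) auto
    have "ennreal (p + 2 * ?a) = ennreal (j + q)"
      using eq p q real integral_half_log_nonneg by (simp add: ennreal_plus)
    hence "p + 2 * ?a = j + q"
      using p q real integral_half_log_nonneg by (subst (asm) ennreal_inj) auto
    thus ?thesis unfolding le using p q real by simp
  qed
qed

end

text \<open>The linear span of the features whose moments are compared. It turns out closed under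
  products and conjugation, so its real members satisfy the hypotheses of the Stone-Weierstrass
  theorem.\<close>

inductive_set feature_algebra :: "(complex \<Rightarrow> complex) set" where
  base: "j \<le> n \<Longrightarrow> l \<le> n \<Longrightarrow> feature n j l \<in> feature_algebra"
| add: "f \<in> feature_algebra \<Longrightarrow> g \<in> feature_algebra \<Longrightarrow> (\<lambda>z. f z + g z) \<in> feature_algebra"
| scale: "f \<in> feature_algebra \<Longrightarrow> (\<lambda>z. c * f z) \<in> feature_algebra"

lemma feature_mult: "feature n j l z * feature n' j' l' z = feature (n + n') (j + j') (l + l') z"
  by (simp add: feature_def power_add)

lemma feature_algebra_mult:
  assumes "f \<in> feature_algebra" "g \<in> feature_algebra"
  shows "(\<lambda>z. f z * g z) \<in> feature_algebra"
  using assms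
proof (induction f rule: feature_algebra.induct)
  case (base j n l)
  from base(3) show ?case
  proof (induction g rule: feature_algebra.induct)
    case (base j' n' l')
    thus ?case using \<open>j \<le> n\<close> \<open>l \<le> n\<close> by (simp add: feature_mult feature_algebra.base)
  next
    case (add f g)
    thus ?case using feature_algebra.add[OF add.IH] by (simp add: distrib_left)
  next
    case (scale f c)
    thus ?case using feature_algebra.scale[OF scale.IH, of c] by (simp add: mult.left_commute)
  qed
next
  case (add f h)
  thus ?case using feature_algebra.add[OF add.IH] by (simp add: distrib_right)
next
  case (scale f c)
  thus ?case using feature_algebra.scale[OF scale.IH, of c] by (simp add: mult.assoc)
qed

lemma feature_algebra_cnj: "f \<in> feature_algebra \<Longrightarrow> (\<lambda>z. cnj (f z)) \<in> feature_algebra"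
proof (induction f rule: feature_algebra.induct)
  case (base j n l)
  have "(\<lambda>z. cnj (feature n j l z)) = feature n l j"
    unfolding feature_def fun_eq_iff by (simp add: mult.commute)
  thus ?case using base by (simp add: feature_algebra.base)
next
  case (add f g)
  thus ?case using feature_algebra.add[OF add.IH] by simp
next
  case (scale f c)
  thus ?case using feature_algebra.scale[OF scale.IH, of "cnj c"] by simp
qed

lemma feature_algebra_Re:
  assumes "f \<in> feature_algebra"
  shows "(\<lambda>z. complex_of_real (Re (f z))) \<in> feature_algebra"
proof -
  have "(\<lambda>z. 1 / 2 * (f z + cnj (f z))) \<in> feature_algebra"
    by (intro feature_algebra.scale feature_algebra.add feature_algebra_cnj assms)
  thus ?thesis by (simp add: complex_add_cnj)
qed

lemma feature_algebra_cont: "f \<in> feature_algebra \<Longrightarrow> continuous_on A f"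
  by (induction f rule: feature_algebra.induct) (intro continuous_intros feature_cont; assumption)+

lemma feature_algebra_const: "(\<lambda>_. c) \<in> feature_algebra"
proof -
  have "feature 0 0 0 = (\<lambda>_. 1)" by (simp add: feature_def fun_eq_iff)
  thus ?thesis using feature_algebra.scale[OF feature_algebra.base[of 0 0 0], of c] by simp
qed

text \<open>\<open>feature 1 1 1\<close> determines \<open>|z|\<close>, and then
  \<open>feature 1 1 0\<close> determines \<open>z\<close>. Real parts are used because the
  approximation takes place among real functions.\<close>

lemma feature_algebra_separates:
  assumes "z \<noteq> w"
  obtains f where "f \<in> feature_algebra" "Re (f z) \<noteq> Re (f w)"
proof (rule ccontr)
  assume "\<not> thesis"
  with that have re: "Re (f z) = Re (f w)" if "f \<in> feature_algebra" for f using that by blast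
  have "f z = f w" if "f \<in> feature_algebra" for f
    \<comment> \<open>Multiplication by \<open>-\<i>\<close> brings the imaginary part into the real
      part.\<close>
    using re[OF that] re[OF feature_algebra.scale[OF that, of "-\<i>"]] by (simp add: complex_eq_iff)
  hence f: "feature 1 1 0 z = feature 1 1 0 w" "feature 1 1 1 z = feature 1 1 1 w"
    by (simp_all add: feature_algebra.base)
  have "feature 1 1 1 x = of_real (1 - 1 / (1 + (norm x)\<^sup>2))" for x
  proof -
    have "x * cnj x = of_real ((norm x)\<^sup>2)" by (simp only: complex_norm_square)
    hence "feature 1 1 1 x = of_real ((norm x)\<^sup>2 / (1 + (norm x)\<^sup>2))"
      by (simp add: feature_def)
    also have "(norm x)\<^sup>2 / (1 + (norm x)\<^sup>2) = 1 - 1 / (1 + (norm x)\<^sup>2)"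
      using one_plus_norm_square_pos(1)[of x] by (simp add: field_simps)
    finally show ?thesis .
  qed
  with f(2) have "1 / (1 + (norm z)\<^sup>2) = 1 / (1 + (norm w)\<^sup>2)" by (simp only: of_real_eq_iff)
  hence n: "1 + (norm z)\<^sup>2 = 1 + (norm w)\<^sup>2" by simp
  have "z / of_real (1 + (norm z)\<^sup>2) = w / of_real (1 + (norm w)\<^sup>2)"
    using f(1) by (simp add: feature_def)
  thus False unfolding n using assms one_plus_norm_square_pos(2)[of w]
    by (metis divide_cancel_right of_real_eq_0_iff)
qed

context prob_pair
begin

text \<open>Equality of the integrals spreads from the features to their algebra, by
  Stone-Weierstrass to all continuous functions, by a limit to indicators of closed sets, and from
  this intersection-stable generator to all Borel sets.\<close>

lemma eq_if_features_eq:
  assumes feat: "\<And>n j l. j \<le> n \<Longrightarrow> l \<le> n \<Longrightarrow> (\<integral>z. feature n j l z \<partial>\<nu>) = (\<integral>z. feature n j l z \<partial>\<rho>)"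
  shows "\<nu> = \<rho>"
proof -
  have alg_int: "integrable \<nu> f" "integrable \<rho> f" if "f \<in> feature_algebra" for f
    using that
    by (intro \<nu>.integrable_cont \<rho>.integrable_cont feature_algebra_cont borel_measurable_continuous_onI; assumption)+
  have alg: "(\<integral>z. f z \<partial>\<nu>) = (\<integral>z. f z \<partial>\<rho>)" if "f \<in> feature_algebra" for f
    using that by (induction f rule: feature_algebra.induct) (simp_all add: feat alg_int)
  define R where "R = {f. (\<lambda>z. complex_of_real (f z)) \<in> feature_algebra}"
  interpret function_ring_on R E
  proof
    show "compact E" by (rule \<nu>.compact_E)
    show "continuous_on E f" if "f \<in> R" for f
    proof -
      have "continuous_on E (\<lambda>z. Re (complex_of_real (f z)))"
        using that unfolding R_def by (intro continuous_intros feature_algebra_cont) simp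
      thus ?thesis by simp
    qed
    fix f g assume fg: "f \<in> R" "g \<in> R"
    show "(\<lambda>x. f x + g x) \<in> R"
      using feature_algebra.add[of "\<lambda>x. of_real (f x)" "\<lambda>x. of_real (g x)"] fg
      unfolding R_def mem_Collect_eq of_real_add by blast
    show "(\<lambda>x. f x * g x) \<in> R"
      using feature_algebra_mult[of "\<lambda>x. of_real (f x)" "\<lambda>x. of_real (g x)"] fg
      unfolding R_def mem_Collect_eq of_real_mult by blast
  next
    show "(\<lambda>_. c) \<in> R" for c unfolding R_def by (simp add: feature_algebra_const)
  next
    fix x y :: complex assume "x \<noteq> y"
    then obtain f where "f \<in> feature_algebra" "Re (f x) \<noteq> Re (f y)"
      using feature_algebra_separates by metis
    thus "\<exists>f\<in>R. f x \<noteq> f y"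
      unfolding R_def by (intro bexI[of _ "\<lambda>z. Re (f z)"]) (simp_all add: feature_algebra_Re)
  qed
  have R_eq: "(\<integral>z. f z \<partial>\<nu>) = (\<integral>z. f z \<partial>\<rho>)" if "f \<in> R" for f
  proof -
    have "complex_of_real (\<integral>z. f z \<partial>\<nu>) = of_real (\<integral>z. f z \<partial>\<rho>)"
      using alg[of "\<lambda>z. of_real (f z)"] that by (simp add: R_def)
    thus ?thesis by (simp only: of_real_eq_iff)
  qed
  have cont_eq: "(\<integral>z. f z \<partial>\<nu>) = (\<integral>z. f z \<partial>\<rho>)" if f: "continuous_on UNIV f" for f :: "complex \<Rightarrow> real"
  proof (rule ccontr)
    define d where "d = \<bar>(\<integral>z. f z \<partial>\<nu>) - (\<integral>z. f z \<partial>\<rho>)\<bar>"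
    assume "(\<integral>z. f z \<partial>\<nu>) \<noteq> (\<integral>z. f z \<partial>\<rho>)"
    hence d: "d / 4 > 0" by (simp add: d_def)
    have fE: "continuous_on E f" using f continuous_on_subset by blast
    obtain g where g: "g \<in> R" "\<And>z. z \<in> E \<Longrightarrow> \<bar>f z - g z\<bar> < d / 4"
      using Stone_Weierstrass_basic[OF fE d] by blast
    have gc: "continuous_on UNIV g"
    proof -
      have "continuous_on UNIV (\<lambda>z. Re (complex_of_real (g z)))"
        using g(1) unfolding R_def by (intro continuous_intros feature_algebra_cont) simp
      thus ?thesis by simp
    qed
    have close: "\<bar>(\<integral>z. f z \<partial>\<kappa>) - (\<integral>z. g z \<partial>\<kappa>)\<bar> \<le> d / 4" if "prob_on_compact E \<kappa>" for \<kappa>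
    proof -
      interpret \<kappa>: prob_on_compact E \<kappa> by fact
      have i: "integrable \<kappa> f" "integrable \<kappa> g"
        by (intro \<kappa>.integrable_cont borel_measurable_continuous_onI f gc continuous_on_subset[OF f]
            continuous_on_subset[OF gc]; simp)+
      have "norm ((\<integral>z. f z \<partial>\<kappa>) - (\<integral>z. g z \<partial>\<kappa>)) = norm (\<integral>z. f z - g z \<partial>\<kappa>)" using i by simp
      also have "\<dots> \<le> (\<integral>z. norm (f z - g z) \<partial>\<kappa>)" by (rule integral_norm_bound)
      also have "\<dots> \<le> (\<integral>z. d / 4 \<partial>\<kappa>)"
      proof (rule integral_mono_AE)
        show "AE z in \<kappa>. norm (f z - g z) \<le> d / 4"
          using \<kappa>.AE_in by eventually_elim (use g(2) in force)
      qed (use i in auto)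
      finally show ?thesis using \<kappa>.prob_space by simp
    qed
    have "d \<le> d / 4 + d / 4"
      using close[OF \<nu>.prob_on_compact_axioms] close[OF \<rho>.prob_on_compact_axioms] R_eq[OF g(1)] unfolding d_def by linarith
    thus False using d by simp
  qed
  have closed_eq: "measure \<nu> C = measure \<rho> C" if C: "closed C" for C
  proof (cases "C = {}")
    case False
    have C' [measurable]: "C \<in> sets borel" using C by (rule borel_closed)
    \<comment> \<open>Continuous functions between 0 and 1 that tend pointwise to the indicator of
      the closed set \<open>C\<close>.\<close>
    define f where "f = (\<lambda>(i::nat) z. max 0 (1 - real i * infdist z C))"
    have fc: "continuous_on UNIV (f i)" for i unfolding f_def by (intro continuous_intros)
    have fm: "f i \<in> borel_measurable borel" for i by (rule borel_measurable_continuous_onI[OF fc])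
    have lim: "(\<lambda>i. \<integral>z. f i z \<partial>\<kappa>) \<longlonglongrightarrow> measure \<kappa> C" if "prob_on_compact E \<kappa>" for \<kappa>
    proof -
      interpret \<kappa>: prob_on_compact E \<kappa> by fact
      have "(\<lambda>i. \<integral>z. f i z \<partial>\<kappa>) \<longlonglongrightarrow> (\<integral>z. indicator C z \<partial>\<kappa>)"
      proof (rule integral_dominated_convergence[where w = "\<lambda>_. 1"])
        show "(indicator C :: complex \<Rightarrow> real) \<in> borel_measurable \<kappa>" by measurable
        show "f i \<in> borel_measurable \<kappa>" for i
          using fm by measurable
        show "AE z in \<kappa>. norm (f i z) \<le> 1" for i
          by (intro AE_I2) (auto simp: f_def infdist_nonneg)
        have "(\<lambda>i. f i z) \<longlonglongrightarrow> indicator C z" for z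
        proof (cases "z \<in> C")
          case True
          thus ?thesis by (simp add: f_def)
        next
          case z: False
          hence pos: "infdist z C > 0"
            using in_closed_iff_infdist_zero[OF C False] infdist_nonneg[of z C] by auto
          obtain N :: nat where N: "1 < real N * infdist z C" using ex_less_of_nat_mult[OF pos] by blast
          have "f i z = 0" if "i \<ge> N" for i
          proof -
            have "real N * infdist z C \<le> real i * infdist z C" using that pos by (intro mult_right_mono) auto
            thus ?thesis using N by (simp add: f_def)
          qed
          hence "\<forall>\<^sub>F i in sequentially. f i z = 0" unfolding eventually_sequentially by blast
          thus ?thesis using z by (simp add: tendsto_eventually)
        qed
        thus "AE z in \<kappa>. (\<lambda>i. f i z) \<longlonglongrightarrow> indicator C z" by simp
      qed simp
      thus ?thesis using C' by simp
    qed
    from lim[OF \<nu>.prob_on_compact_axioms] lim[OF \<rho>.prob_on_compact_axioms] show ?thesis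
      unfolding cont_eq[OF fc] by (rule LIMSEQ_unique)
  qed simp
  show ?thesis
  proof (rule measure_eqI_generator_eq[where E = "Collect closed" and \<Omega> = UNIV and A = "\<lambda>_. UNIV"])
    show "emeasure \<nu> X = emeasure \<rho> X" if "X \<in> Collect closed" for X
      using closed_eq[of X] that by (simp add: \<nu>.emeasure_eq_measure \<rho>.emeasure_eq_measure)
  qed (auto simp: Int_stable_def borel_eq_closed)
qed

end

text \<open>The hypothesis says that the logarithmic potential of \<open>\<mu>\<close> vanishes on
  \<open>E\<close>. For \<open>\<nu>\<close> of finite energy the mixed terms then cancel the
  \<open>half_log\<close> terms, and the energy of \<open>\<nu>\<close> is that of
  \<open>\<nu> - \<mu>\<close>: a sum of weighted squared moment differences, zero only if all
  moments agree.\<close>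

theorem equilibrium_criterion:
  assumes E: "compact E" and \<mu>: "\<mu> \<in> prob_measures_on E"
    and pot: "\<And>z. z \<in> E \<Longrightarrow>
      (\<integral>\<^sup>+w. chordal_kernel z w \<partial>\<mu>) = ennreal (half_log z + (\<integral>w. half_log w \<partial>\<mu>))"
  shows "log_capacity E = 1" and "equilibrium_measure E = \<mu>"
proof -
  let ?a = "\<lambda>\<kappa>. \<integral>z. half_log z \<partial>\<kappa>"
  interpret \<mu>: prob_on_compact E \<mu> using E \<mu> by unfold_locales
  \<comment> \<open>The mixed energy sees \<open>\<nu>\<close> only through its mean of
    \<open>half_log\<close>.\<close>
  have cross: "chordal_energy \<nu> \<mu> = ennreal (?a \<nu> + ?a \<mu>)" if "\<nu> \<in> prob_measures_on E" for \<nu>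
  proof -
    interpret \<nu>: prob_on_compact E \<nu> using E that by unfold_locales
    have "chordal_energy \<nu> \<mu> = (\<integral>\<^sup>+z. ennreal (half_log z) + ennreal (?a \<mu>) \<partial>\<nu>)"
      unfolding chordal_energy_def
    proof (intro nn_integral_cong_AE)
      show "AE z in \<nu>. (\<integral>\<^sup>+w. chordal_kernel z w \<partial>\<mu>) = ennreal (half_log z) + ennreal (?a \<mu>)"
        using \<nu>.AE_in by eventually_elim (simp add: pot half_log_nonneg \<mu>.integral_half_log_nonneg)
    qed
    also have "\<dots> = ennreal (?a \<nu>) + ennreal (?a \<mu>)"
      by (simp add: nn_integral_add \<nu>.emeasure_space_1[simplified] \<nu>.nn_integral_half_log)
    finally show ?thesis using \<mu>.integral_half_log_nonneg \<nu>.integral_half_log_nonneg by simp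
  qed
  have le\<mu>: "log_energy \<mu> = 0"
    unfolding \<mu>.log_energy_eq cross[OF \<mu>] using \<mu>.integral_half_log_nonneg by simp
  have main: "0 \<le> log_energy \<nu> \<and> (log_energy \<nu> \<le> 0 \<longrightarrow> \<nu> = \<mu>)" if \<nu>: "\<nu> \<in> prob_measures_on E" for \<nu>
  proof (cases "chordal_energy \<nu> \<nu> = top")
    case True
    interpret \<nu>: prob_on_compact E \<nu> using E \<nu> by unfold_locales
    show ?thesis unfolding \<nu>.log_energy_eq True by simp
  next
    case False
    interpret \<nu>: prob_on_compact E \<nu> using E \<nu> by unfold_locales
    interpret pr: prob_pair E \<nu> \<mu> ..
    define t where "t = (\<lambda>\<kappa> \<rho> n. mutual (Suc n) \<kappa> \<rho> / (2 * real (Suc n)))"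
    have t0: "t \<nu> \<nu> n \<ge> 0" "t \<mu> \<mu> n \<ge> 0" "t \<nu> \<mu> n \<ge> 0" for n
      unfolding t_def by (simp_all add: \<nu>.self.mutual_nonneg \<mu>.self.mutual_nonneg pr.mutual_nonneg)
    have en: "chordal_energy \<nu> \<nu> = (\<Sum>n. ennreal (t \<nu> \<nu> n))" "chordal_energy \<mu> \<mu> = (\<Sum>n. ennreal (t \<mu> \<mu> n))"
      "chordal_energy \<nu> \<mu> = (\<Sum>n. ennreal (t \<nu> \<mu> n))"
      unfolding t_def by (rule \<nu>.self.chordal_energy_eq \<mu>.self.chordal_energy_eq pr.chordal_energy_eq)+
    have s: "summable (t \<nu> \<nu>)" "summable (t \<mu> \<mu>)" "summable (t \<nu> \<mu>)"
      using False cross[OF \<mu>] cross[OF \<nu>] unfolding en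
      by (auto intro!: summable_suminf_not_top t0)
    have "ennreal (suminf (t \<mu> \<mu>)) = ennreal (2 * ?a \<mu>)"
      using cross[OF \<mu>] suminf_ennreal2[OF t0(2) s(2)] unfolding en by simp
    hence \<mu>\<mu>: "suminf (t \<mu> \<mu>) = 2 * ?a \<mu>"
      using \<mu>.integral_half_log_nonneg suminf_nonneg[OF s(2) t0(2)] by (subst (asm) ennreal_inj) auto
    have "ennreal (suminf (t \<nu> \<mu>)) = ennreal (?a \<nu> + ?a \<mu>)"
      using cross[OF \<nu>] suminf_ennreal2[OF t0(3) s(3)] unfolding en by simp
    hence \<nu>\<mu>: "suminf (t \<nu> \<mu>) = ?a \<nu> + ?a \<mu>"
      using \<mu>.integral_half_log_nonneg \<nu>.integral_half_log_nonneg suminf_nonneg[OF s(3) t0(3)]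
      by (subst (asm) ennreal_inj) auto
    define D where "D = (\<lambda>n. t \<nu> \<nu> n + t \<mu> \<mu> n - 2 * t \<nu> \<mu> n)"
    define W where "W = (\<lambda>n j l. real ((n choose j) * (n choose l)) *
        (norm ((\<integral>z. feature n j l z \<partial>\<nu>) - (\<integral>z. feature n j l z \<partial>\<mu>)))\<^sup>2)"
    have W0: "W n j l \<ge> 0" for n j l unfolding W_def by simp
    have D: "D n = (\<Sum>j\<le>Suc n. \<Sum>l\<le>Suc n. W (Suc n) j l) / (2 * real (Suc n))" for n
      unfolding W_def pr.mutual_discrepancy[symmetric] D_def t_def
      by (simp only: add_divide_distrib diff_divide_distrib times_divide_eq_right)
    have D0: "D n \<ge> 0" for n unfolding D by (intro divide_nonneg_nonneg sum_nonneg W0) auto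
    have sD: "summable D" unfolding D_def by (intro summable_add summable_diff summable_mult s)
    have "suminf D = suminf (t \<nu> \<nu>) + suminf (t \<mu> \<mu>) - 2 * suminf (t \<nu> \<mu>)"
      unfolding D_def using s
      by (simp add: suminf_add[symmetric] suminf_diff[symmetric] suminf_mult summable_add summable_mult)
    hence "suminf D = suminf (t \<nu> \<nu>) - 2 * ?a \<nu>" using \<mu>\<mu> \<nu>\<mu> by simp
    moreover have "chordal_energy \<nu> \<nu> = ennreal (suminf (t \<nu> \<nu>))"
      unfolding en by (rule suminf_ennreal2[OF t0(1) s(1)])
    ultimately have le: "log_energy \<nu> = ereal (suminf D)"
      unfolding \<nu>.log_energy_eq using suminf_nonneg[OF s(1) t0(1)] by simp
    have "\<nu> = \<mu>" if "suminf D \<le> 0"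
    proof (rule pr.eq_if_features_eq)
      fix n j l :: nat assume jl: "j \<le> n" "l \<le> n"
      show "(\<integral>z. feature n j l z \<partial>\<nu>) = (\<integral>z. feature n j l z \<partial>\<mu>)"
      proof (cases n)
        \<comment> \<open>The kernel series starts at the first power, so the feature of index 0 is
          matched through the total mass 1.\<close>
        case 0
        hence "feature n j l = (\<lambda>_. 1)" using jl by (simp add: feature_def fun_eq_iff)
        thus ?thesis using \<nu>.prob_space \<mu>.prob_space by simp
      next
        case (Suc k)
        have "D k = 0"
          using suminf_eq_zero_iff[OF sD D0] that suminf_nonneg[OF sD D0] by auto
        hence "(\<Sum>j\<le>n. \<Sum>l\<le>n. W n j l) = 0" unfolding D Suc by simp
        hence "W n j l = 0" using jl W0
          by (simp add: sum_nonneg_eq_0_iff sum_nonneg)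
        thus ?thesis unfolding W_def using jl by simp
      qed
    qed
    thus ?thesis unfolding le using suminf_nonneg[OF sD D0] by auto
  qed
  have "minimal_energy E = 0"
    unfolding minimal_energy_def
  proof (rule antisym)
    show "(INF \<nu>\<in>prob_measures_on E. log_energy \<nu>) \<le> 0"
      using INF_lower[OF \<mu>, of log_energy] le\<mu> by simp
    show "0 \<le> (INF \<nu>\<in>prob_measures_on E. log_energy \<nu>)"
      using main by (intro INF_greatest) auto
  qed
  thus "log_capacity E = 1" by (simp add: log_capacity_def)
  show "equilibrium_measure E = \<mu>"
    unfolding equilibrium_measure_def
  proof (rule the_equality)
    show "\<mu> \<in> prob_measures_on E \<and> (\<forall>\<nu>\<in>prob_measures_on E. log_energy \<mu> \<le> log_energy \<nu>)"
    proof (intro conjI ballI \<mu>)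
      fix \<nu> assume "\<nu> \<in> prob_measures_on E"
      from main[OF this] show "log_energy \<mu> \<le> log_energy \<nu>" unfolding le\<mu> by (rule conjunct1)
    qed
    fix \<nu> assume \<nu>: "\<nu> \<in> prob_measures_on E \<and> (\<forall>\<kappa>\<in>prob_measures_on E. log_energy \<nu> \<le> log_energy \<kappa>)"
    hence "log_energy \<nu> \<le> 0" using \<mu> le\<mu> by metis
    thus "\<nu> = \<mu>" using main[of \<nu>] \<nu> by metis
  qed
qed

section \<open>Chebyshev and orthogonal polynomials\<close>

text \<open>Induction on the degree instead of coefficient estimates: for \<open>a\<close> in
  \<open>S\<close> the synthetic quotients at \<open>a\<close> are again bounded at every point of
  \<open>S - {a}\<close>. One extraction makes the quotients converge, a second one the values at
  \<open>a\<close>. Each step uses up one point of the infinite set \<open>S\<close>.\<close>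

lemma monic_polys_pointwise_bounded_subseq:
  assumes "infinite S" "\<And>i. P i \<in> monic_polys n"
    and "\<And>z. z \<in> S \<Longrightarrow> bounded (range (\<lambda>i. poly (P i) z))"
  shows "\<exists>r p. strict_mono (r :: nat \<Rightarrow> nat) \<and> p \<in> monic_polys n
    \<and> (\<forall>z. (\<lambda>i. poly (P (r i)) z) \<longlonglongrightarrow> poly p z)"
  using assms
proof (induction n arbitrary: P S)
  case 0
  have "P i = 1" for i using 0(2)[of i] by (auto simp: monic_polys_def elim!: degree_eq_zeroE)
  thus ?case by (intro exI[of _ id] exI[of _ 1]) (auto simp: strict_mono_def monic_polys_def)
next
  case (Suc n)
  obtain a where a: "a \<in> S" using Suc.prems(1) by fastforce
  define Q where "Q = (\<lambda>i. synthetic_div (P i) a)"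
  have PQ: "poly (P i) z = (z - a) * poly (Q i) z + poly (P i) a" for i z
  proof -
    have "poly (P i) z = poly ([:- a, 1:] * synthetic_div (P i) a + [:poly (P i) a:]) z"
      by (simp only: synthetic_div_correct')
    thus ?thesis by (simp add: Q_def algebra_simps)
  qed
  have "bounded (range (\<lambda>i. poly (Q i) z))" if z: "z \<in> S - {a}" for z
  proof -
    have "bounded (range (\<lambda>i. poly (P i) z - poly (P i) a))"
      using z a Suc.prems(3) by (intro bounded_minus_comp) auto
    hence "bounded ((\<lambda>x. inverse (z - a) * x) ` range (\<lambda>i. poly (P i) z - poly (P i) a))"
      by (rule bounded_linear_image) (rule bounded_linear_mult_right)
    moreover have "inverse (z - a) * (poly (P i) z - poly (P i) a) = poly (Q i) z" for i
      using z by (simp add: PQ[of i z])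
    ultimately show ?thesis by (simp add: image_image)
  qed
  moreover have "infinite (S - {a})" using Suc.prems(1) by simp
  moreover have "Q i \<in> monic_polys n" for i
    unfolding Q_def by (intro monic_polys_synthetic_div Suc.prems)
  ultimately obtain r q where r: "strict_mono (r :: nat \<Rightarrow> nat)" and q: "q \<in> monic_polys n"
    "\<And>z. (\<lambda>i. poly (Q (r i)) z) \<longlonglongrightarrow> poly q z"
    using Suc.IH[of "S - {a}" Q] by blast
  have "bounded (range (\<lambda>i. poly (P (r i)) a))"
    using Suc.prems(3)[OF a] by (rule bounded_subset) auto
  then obtain c s where s: "strict_mono (s :: nat \<Rightarrow> nat)" "((\<lambda>i. poly (P (r i)) a) \<circ> s) \<longlonglongrightarrow> c"
    using bounded_imp_convergent_subsequence by blast
  have "(\<lambda>i. poly (P (r (s i))) z) \<longlonglongrightarrow> poly ([:- a, 1:] * q + [:c:]) z" for z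
  proof -
    have "(\<lambda>i. poly (Q (r (s i))) z) \<longlonglongrightarrow> poly q z"
      using LIMSEQ_subseq_LIMSEQ[OF q(2) s(1)] by (simp add: o_def)
    hence "(\<lambda>i. (z - a) * poly (Q (r (s i))) z + poly (P (r (s i))) a) \<longlonglongrightarrow> (z - a) * poly q z + c"
      using s(2) unfolding o_def by (intro tendsto_intros)
    moreover have "poly ([:- a, 1:] * q + [:c:]) z = (z - a) * poly q z + c" by (simp add: algebra_simps)
    ultimately show ?thesis unfolding PQ[of _ z, symmetric] by simp
  qed
  hence "\<forall>z. (\<lambda>i. poly (P ((r \<circ> s) i)) z) \<longlonglongrightarrow> poly ([:- a, 1:] * q + [:c:]) z"
    unfolding o_def by blast
  thus ?case using monic_polys_linear_mult[OF q(1)] strict_mono_o[OF r s(1)] by blast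
qed

text \<open>Newton's scheme: each new node is met by adding a multiple of the product that vanishes
  at the earlier ones. The degree bound is one above the sharp one for nonempty \<open>A\<close>.
  This costs one point in the count of extremal points, and \<open>n\<close> of them still exceed
  the degree of a difference of two minimisers.\<close>

lemma poly_interpolation_exists:
  assumes "finite A"
  shows "\<exists>f :: 'a :: field poly. degree f \<le> card A \<and> (\<forall>a\<in>A. poly f a = v a)"
  using assms
proof (induction A rule: finite_induct)
  case (insert a A)
  then obtain f where f: "degree f \<le> card A" "\<forall>a\<in>A. poly f a = v a" by blast
  define w where "w = (\<Prod>b\<in>A. [:- b, 1:])"
  have w: "poly w b = 0" if "b \<in> A" for b
    using that insert.hyps(1) by (auto simp: w_def poly_prod)
  have wa: "poly w a \<noteq> 0" using insert.hyps by (auto simp: w_def poly_prod)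
  have dw: "degree w \<le> card A"
    unfolding w_def by (rule order.trans[OF degree_prod_sum_le]) (use insert.hyps in auto)
  let ?g = "f + smult ((v a - poly f a) / poly w a) w"
  have "degree ?g \<le> card (insert a A)"
    using f(1) dw insert.hyps by (intro degree_add_le order.trans[OF degree_smult_le]) auto
  moreover have "\<forall>b\<in>insert a A. poly ?g b = v b" using f(2) w wa by auto
  ultimately show ?case by blast
qed (auto intro: exI[of _ 0])

locale infinite_compact =
  fixes E :: "complex set"
  assumes compact: "compact E" and infinite: "infinite E"
begin

lemma nonempty: "E \<noteq> {}" using infinite by auto

lemma sup_norm_attained:
  obtains z where "z \<in> E" "sup_norm_on E p = norm (poly p z)" "\<And>w. w \<in> E \<Longrightarrow> norm (poly p w) \<le> sup_norm_on E p"
proof -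
  have "continuous_on E (\<lambda>z. norm (poly p z))" by (intro continuous_intros)
  from continuous_attains_sup[OF compact nonempty this]
  obtain z where z: "z \<in> E" "\<And>w. w \<in> E \<Longrightarrow> norm (poly p w) \<le> norm (poly p z)" by blast
  have "sup_norm_on E p = norm (poly p z)"
    unfolding sup_norm_on_def using z by (intro cSup_eq_maximum) auto
  with z that show ?thesis by metis
qed

lemma le_sup_norm: "z \<in> E \<Longrightarrow> norm (poly p z) \<le> sup_norm_on E p"
  by (rule sup_norm_attained[of p]) blast

lemma sup_norm_le: "(\<And>z. z \<in> E \<Longrightarrow> norm (poly p z) \<le> M) \<Longrightarrow> sup_norm_on E p \<le> M"
  by (rule sup_norm_attained[of p]) metis

lemma sup_norm_less: "(\<And>z. z \<in> E \<Longrightarrow> norm (poly p z) < M) \<Longrightarrow> sup_norm_on E p < M"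
  by (rule sup_norm_attained[of p]) metis

lemma sup_norm_pos: "p \<noteq> 0 \<Longrightarrow> 0 < sup_norm_on E p"
proof -
  assume "p \<noteq> 0"
  hence "finite {z. poly p z = 0}" by (rule poly_roots_finite)
  hence "\<not> E \<subseteq> {z. poly p z = 0}" using infinite finite_subset by metis
  then obtain z where "z \<in> E" "poly p z \<noteq> 0" by blast
  thus ?thesis using le_sup_norm[of z p] by (metis less_le_trans zero_less_norm_iff)
qed

text \<open>A minimising sequence is bounded at each point of \<open>E\<close>; a subsequence
  converges pointwise to a monic polynomial, and the bound passes to the limit at each point of
  \<open>E\<close>.\<close>

lemma chebyshev_exists:
  "\<exists>p\<in>monic_polys n. \<forall>q\<in>monic_polys n. sup_norm_on E p \<le> sup_norm_on E q"
proof -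
  define m where "m = Inf (sup_norm_on E ` monic_polys n)"
  have ne: "sup_norm_on E ` monic_polys n \<noteq> {}" using monom_monic by blast
  have bb: "bdd_below (sup_norm_on E ` monic_polys n)"
  proof (rule bdd_belowI2)
    fix p assume "p \<in> monic_polys n"
    hence "p \<noteq> 0" by (auto simp: monic_polys_def)
    thus "0 \<le> sup_norm_on E p" using sup_norm_pos[of p] by simp
  qed
  have m_le: "m \<le> sup_norm_on E q" if "q \<in> monic_polys n" for q
    unfolding m_def using bb that by (intro cInf_lower) auto
  have "\<exists>p\<in>monic_polys n. sup_norm_on E p < m + 1 / real (Suc i)" for i
    using cInf_lessD[OF ne, of "m + 1 / real (Suc i)"] unfolding m_def by auto
  then obtain P where P: "\<And>i. P i \<in> monic_polys n" "\<And>i. sup_norm_on E (P i) < m + 1 / real (Suc i)"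
    by metis
  have "bounded (range (\<lambda>i. poly (P i) z))" if "z \<in> E" for z
    unfolding bounded_iff
  proof (intro exI[of _ "m + 1"] ballI)
    fix x assume "x \<in> range (\<lambda>i. poly (P i) z)"
    then obtain i where "x = poly (P i) z" by blast
    hence "norm x \<le> sup_norm_on E (P i)" using le_sup_norm[OF that] by simp
    also have "\<dots> \<le> m + 1 / real (Suc i)" using P(2)[of i] by simp
    also have "\<dots> \<le> m + 1" by simp
    finally show "norm x \<le> m + 1" .
  qed
  from monic_polys_pointwise_bounded_subseq[OF infinite P(1) this]
  obtain r p where r: "strict_mono (r :: nat \<Rightarrow> nat)" and p: "p \<in> monic_polys n"
    and lim: "\<And>z. (\<lambda>i. poly (P (r i)) z) \<longlonglongrightarrow> poly p z"
    by blast
  have "sup_norm_on E p \<le> m"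
  proof (rule sup_norm_le)
    fix z assume z: "z \<in> E"
    have "(\<lambda>i. m + 1 / real (Suc (r i))) \<longlonglongrightarrow> m + 0"
    proof (intro tendsto_intros)
      have "(\<lambda>i. 1 / real (Suc i)) \<longlonglongrightarrow> 0" using LIMSEQ_inverse_real_of_nat by (simp add: inverse_eq_divide)
      from LIMSEQ_subseq_LIMSEQ[OF this r] show "(\<lambda>i. 1 / real (Suc (r i))) \<longlonglongrightarrow> 0" by (simp add: o_def)
    qed
    moreover have "(\<lambda>i. norm (poly (P (r i)) z)) \<longlonglongrightarrow> norm (poly p z)"
      by (intro tendsto_norm lim)
    moreover have "norm (poly (P (r i)) z) \<le> m + 1 / real (Suc (r i))" for i
      using le_sup_norm[OF z, of "P (r i)"] P(2)[of "r i"] by linarith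
    ultimately show "norm (poly p z) \<le> m"
      using LIMSEQ_le[of _ "norm (poly p z)" _ "m + 0"] by simp
  qed
  hence "\<forall>q\<in>monic_polys n. sup_norm_on E p \<le> sup_norm_on E q"
    using m_le order.trans by blast
  with p show ?thesis by (rule bexI[rotated])
qed

text \<open>Kolmogorov's argument: with fewer extremal points, subtracting a small multiple of a polynomial of
  lower degree interpolating \<open>g\<close> at all of them would decrease the norm.\<close>

lemma chebyshev_extremal_points:
  assumes g: "g \<in> monic_polys n" "\<And>q. q \<in> monic_polys n \<Longrightarrow> sup_norm_on E g \<le> sup_norm_on E q"
    and A: "A = {z \<in> E. norm (poly g z) = sup_norm_on E g}" "finite A"
  shows "n \<le> card A"
proof (rule ccontr)
  assume "\<not> n \<le> card A"
  define M where "M = sup_norm_on E g"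
  have M: "M > 0" unfolding M_def using g(1) by (intro sup_norm_pos) (auto simp: monic_polys_def)
  obtain f where f: "degree f \<le> card A" "\<And>a. a \<in> A \<Longrightarrow> poly f a = poly g a"
    using poly_interpolation_exists[OF A(2), of "poly g"] by blast
  \<comment> \<open>The summand 1 keeps \<open>F\<close> positive when \<open>f\<close> is
    zero.\<close>
  define F where "F = sup_norm_on E f + 1"
  have F: "F > 0" "\<And>z. z \<in> E \<Longrightarrow> norm (poly f z) \<le> F"
  proof -
    obtain z where "z \<in> E" using nonempty by blast
    thus "F > 0" using le_sup_norm[of z f] norm_ge_zero[of "poly f z"] unfolding F_def by linarith
  qed (use le_sup_norm[of _ f] in \<open>force simp: F_def\<close>)
  \<comment> \<open>Off \<open>K\<close> subtracting a small multiple of \<open>f\<close> pulls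
    \<open>g\<close> towards 0. On \<open>K\<close> it may not, but \<open>K\<close> contains no
    extremal point, because there \<open>f = g\<close> and the real part is \<open>M^2\<close>. By
    compactness \<open>|g|\<close> stays below some \<open>M' < M\<close> on
    \<open>K\<close>.\<close>
  define K where "K = {z \<in> E. Re (poly g z * cnj (poly f z)) \<le> M\<^sup>2 / 2}"
  have "closed {z. Re (poly g z * cnj (poly f z)) \<le> M\<^sup>2 / 2}"
    by (intro closed_Collect_le continuous_intros)
  moreover have "K = E \<inter> {z. Re (poly g z * cnj (poly f z)) \<le> M\<^sup>2 / 2}" by (auto simp: K_def)
  ultimately have K: "compact K" using compact by (simp add: compact_Int_closed)
  have gK: "norm (poly g z) < M" if "z \<in> K" for z
  proof -
    have "z \<in> E" using that by (simp add: K_def)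
    hence "norm (poly g z) \<le> M" unfolding M_def by (rule le_sup_norm)
    moreover have "norm (poly g z) \<noteq> M"
    proof
      assume e: "norm (poly g z) = M"
      hence "poly f z = poly g z" using f(2) A(1) \<open>z \<in> E\<close> by (simp add: M_def)
      hence "poly g z * cnj (poly f z) = of_real (M\<^sup>2)"
        using complex_norm_square[of "poly g z"] e by simp
      hence "Re (poly g z * cnj (poly f z)) = M\<^sup>2" by (simp only: Re_complex_of_real)
      moreover have "Re (poly g z * cnj (poly f z)) \<le> M\<^sup>2 / 2" using that by (simp add: K_def)
      moreover have "0 < M\<^sup>2" using M by simp
      ultimately show False by linarith
    qed
    ultimately show ?thesis by simp
  qed
  obtain M' where M': "M' < M" "\<And>z. z \<in> K \<Longrightarrow> norm (poly g z) \<le> M'"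
  proof (cases "K = {}")
    case False
    have "continuous_on K (\<lambda>z. norm (poly g z))" by (intro continuous_intros)
    from continuous_attains_sup[OF K False this] gK that show ?thesis by blast
  qed (use that[of 0] M in auto)
  \<comment> \<open>The first bound yields \<open>e F^2 < M^2\<close>, used off \<open>K\<close>;
    the second yields \<open>e F < M - M'\<close>, used on \<open>K\<close>. The factors 2 make both
    strict.\<close>
  define e where "e = min (M\<^sup>2 / (2 * F\<^sup>2)) ((M - M') / (2 * F))"
  have e: "e > 0" "e * F\<^sup>2 < M\<^sup>2" "e * F < M - M'"
  proof -
    show "e > 0" unfolding e_def using M M' F by simp
    have "e * F\<^sup>2 \<le> M\<^sup>2 / (2 * F\<^sup>2) * F\<^sup>2" unfolding e_def by (intro mult_right_mono) auto
    also have "\<dots> = M\<^sup>2 / 2" using F by simp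
    also have "\<dots> < M\<^sup>2" using M by simp
    finally show "e * F\<^sup>2 < M\<^sup>2" .
    have "e * F \<le> (M - M') / (2 * F) * F" unfolding e_def using F by (intro mult_right_mono) auto
    also have "\<dots> = (M - M') / 2" using F by simp
    also have "\<dots> < M - M'" using M' by simp
    finally show "e * F < M - M'" .
  qed
  let ?q = "g - smult (of_real e) f"
  have "?q \<in> monic_polys n"
    using \<open>\<not> n \<le> card A\<close> f(1) by (intro monic_polys_diff_lower g disjI2 le_less_trans[OF degree_smult_le]) auto
  hence "M \<le> sup_norm_on E ?q" unfolding M_def by (rule g)
  moreover have "sup_norm_on E ?q < M"
  proof (rule sup_norm_less)
    fix z assume z: "z \<in> E"
    show "norm (poly ?q z) < M"
    proof (cases "z \<in> K")
      case True
      have "norm (poly ?q z) \<le> norm (poly g z) + norm (of_real e * poly f z)"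
        by (simp only: poly_diff poly_smult norm_triangle_ineq4)
      also have "\<dots> \<le> M' + e * F"
        using M'(2)[OF True] F(2)[OF z] e(1) by (intro add_mono) (auto simp: norm_mult)
      also have "\<dots> < M" using e by simp
      finally show ?thesis .
    next
      case False
      have "(norm (poly ?q z))\<^sup>2 = (norm (poly g z))\<^sup>2 - 2 * e * Re (poly g z * cnj (poly f z)) + e\<^sup>2 * (norm (poly f z))\<^sup>2"
        unfolding cmod_power2 by (simp add: power2_eq_square algebra_simps)
      also have "\<dots> \<le> M\<^sup>2 - 2 * e * (M\<^sup>2 / 2) + e\<^sup>2 * F\<^sup>2"
      proof (intro add_mono diff_mono mult_left_mono power_mono)
        show "norm (poly g z) \<le> M" unfolding M_def by (rule le_sup_norm[OF z])
        show "M\<^sup>2 / 2 \<le> Re (poly g z * cnj (poly f z))" using False z by (simp add: K_def)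
      qed (use F(2)[OF z] e in auto)
      also have "\<dots> = M\<^sup>2 - e * (M\<^sup>2 - e * F\<^sup>2)" by (simp add: power2_eq_square algebra_simps)
      also have "\<dots> < M\<^sup>2" using e by simp
      finally show ?thesis using M by (intro power2_less_imp_less[of _ M]) auto
    qed
  qed
  ultimately show False by simp
qed

text \<open>The midpoint \<open>g\<close> of two minimisers is again one. At its extremal points the
  parallelogram law forces \<open>p = q\<close>; there are at least \<open>n\<close> such points,
  too many for the nonzero polynomial \<open>p - q\<close> of degree below \<open>n\<close>.\<close>

lemma chebyshev_unique:
  assumes p: "p \<in> monic_polys n" "\<And>q. q \<in> monic_polys n \<Longrightarrow> sup_norm_on E p \<le> sup_norm_on E q"
    and q: "q \<in> monic_polys n" "\<And>r. r \<in> monic_polys n \<Longrightarrow> sup_norm_on E q \<le> sup_norm_on E r"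
  shows "p = q"
proof (rule ccontr)
  assume "p \<noteq> q"
  hence d: "p - q \<noteq> 0" "degree (p - q) < n" using monic_polys_diff[OF p(1) q(1)] by auto
  define M where "M = sup_norm_on E p"
  have Mq: "M = sup_norm_on E q" unfolding M_def using p q by (intro antisym) auto
  define g where "g = p - smult (1 / 2) (p - q)"
  have g: "g \<in> monic_polys n"
    unfolding g_def using d by (intro monic_polys_diff_lower p) simp
  have pg: "poly g z = (poly p z + poly q z) / 2" for z
    by (simp add: g_def field_simps)
  have "sup_norm_on E g \<le> M"
  proof (rule sup_norm_le)
    fix z assume "z \<in> E"
    hence "norm (poly p z) \<le> M" "norm (poly q z) \<le> M" unfolding M_def using le_sup_norm Mq M_def by metis+
    moreover have "2 * norm (poly g z) \<le> norm (poly p z) + norm (poly q z)"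
      unfolding pg using norm_triangle_ineq[of "poly p z" "poly q z"] by (simp add: norm_divide)
    ultimately show "norm (poly g z) \<le> M" by linarith
  qed
  moreover have "M \<le> sup_norm_on E g" unfolding M_def by (rule p(2)[OF g])
  ultimately have gM: "sup_norm_on E g = M" by simp
  define A where "A = {z \<in> E. norm (poly g z) = sup_norm_on E g}"
  have "A \<subseteq> {z. poly (p - q) z = 0}"
  proof
    fix z assume z: "z \<in> A"
    define a b where "a = poly p z" and "b = poly q z"
    have ab: "norm a \<le> M" "norm b \<le> M" unfolding a_def b_def
      using z le_sup_norm[of z p] le_sup_norm[of z q] Mq by (auto simp: A_def M_def)
    have "norm (a + b) = 2 * M"
      using z unfolding A_def gM pg a_def b_def by (simp add: norm_divide)
    moreover have "(norm (a - b))\<^sup>2 = 2 * (norm a)\<^sup>2 + 2 * (norm b)\<^sup>2 - (norm (a + b))\<^sup>2"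
      unfolding cmod_power2 by (simp add: power2_eq_square algebra_simps)
    moreover have "(norm a)\<^sup>2 \<le> M\<^sup>2" "(norm b)\<^sup>2 \<le> M\<^sup>2" using ab by (auto intro: power_mono)
    ultimately have "(norm (a - b))\<^sup>2 \<le> 0" by (simp add: power_mult_distrib)
    thus "z \<in> {z. poly (p - q) z = 0}" by (simp add: a_def b_def)
  qed
  moreover have fin: "finite {z. poly (p - q) z = 0}" using d by (intro poly_roots_finite)
  ultimately have "finite A" "card A \<le> card {z. poly (p - q) z = 0}"
    by (auto intro: finite_subset card_mono)
  moreover have "card {z. poly (p - q) z = 0} \<le> degree (p - q)" using d by (intro card_poly_roots_bound)
  moreover have "n \<le> card A"
    using \<open>finite A\<close> by (intro chebyshev_extremal_points[OF g _ A_def]) (use p gM M_def in auto)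
  ultimately show False using d by linarith
qed

lemma chebyshev_poly_props:
  "chebyshev_poly E n \<in> monic_polys n"
  "q \<in> monic_polys n \<Longrightarrow> sup_norm_on E (chebyshev_poly E n) \<le> sup_norm_on E q"
proof -
  have "\<exists>!p. p \<in> monic_polys n \<and> (\<forall>q\<in>monic_polys n. sup_norm_on E p \<le> sup_norm_on E q)"
    using chebyshev_exists[of n] chebyshev_unique[of _ n] by (metis (no_types, lifting))
  from theI'[OF this] show "chebyshev_poly E n \<in> monic_polys n"
    "q \<in> monic_polys n \<Longrightarrow> sup_norm_on E (chebyshev_poly E n) \<le> sup_norm_on E q"
    unfolding chebyshev_poly_def by blast+
qed

end

section \<open>Orthogonal polynomials for a definite inner product\<close>

locale nondegenerate_prob = prob_on_compact +
  assumes nondegenerate: "p \<noteq> 0 \<Longrightarrow> (\<integral>z. (norm (poly p z))\<^sup>2 \<partial>\<nu>) \<noteq> 0"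
begin

definition inner :: "complex poly \<Rightarrow> complex poly \<Rightarrow> complex" where
  "inner p q = (\<integral>z. poly p z * cnj (poly q z) \<partial>\<nu>)"

lemma inner_integrable: "integrable \<nu> (\<lambda>z. poly p z * cnj (poly q z))"
  by (intro integrable_cont borel_measurable_continuous_onI continuous_intros)

lemma square_integrable: "integrable \<nu> (\<lambda>z. (norm (poly p z))\<^sup>2)"
  by (intro integrable_cont borel_measurable_continuous_onI continuous_intros)

lemma inner_simps:
  "inner (p - q) r = inner p r - inner q r"
  "inner p (q + r) = inner p q + inner p r"
  "inner (smult c p) q = c * inner p q"
  "inner p (smult c q) = cnj c * inner p q"
  "inner 0 q = 0" "inner p 0 = 0"
  unfolding inner_def using inner_integrable
  by (simp_all add: left_diff_distrib distrib_left mult.assoc mult.left_commute[of _ "cnj c"])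

lemma inner_self: "inner p p = of_real (\<integral>z. (norm (poly p z))\<^sup>2 \<partial>\<nu>)"
  unfolding inner_def complex_norm_square[symmetric] by (rule integral_complex_of_real)

text \<open>Gram-Schmidt in a nested induction: the inner one raises the range of degrees to which
  \<open>p\<close> is orthogonal, subtracting a multiple of the orthogonal polynomial of degree
  \<open>k\<close> that the outer one supplies.\<close>

lemma orthogonal_exists:
  "\<exists>p\<in>monic_polys n. \<forall>q. (q = 0 \<or> degree q < n) \<longrightarrow> inner p q = 0"
proof (induction n rule: less_induct)
  case (less n)
  have "\<exists>p\<in>monic_polys n. \<forall>q. (q = 0 \<or> degree q < k) \<longrightarrow> inner p q = 0" if "k \<le> n" for k
    using that
  proof (induction k)
    case 0
    thus ?case using monom_monic by (auto simp: inner_simps)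
  next
    case (Suc k)
    then obtain p where p: "p \<in> monic_polys n" "\<And>q. q = 0 \<or> degree q < k \<Longrightarrow> inner p q = 0" by auto
    obtain P where P: "P \<in> monic_polys k" "\<And>q. q = 0 \<or> degree q < k \<Longrightarrow> inner P q = 0"
      using less[of k] Suc.prems by auto
    have PP: "inner P P \<noteq> 0"
      unfolding inner_self of_real_eq_0_iff
      by (rule nondegenerate) (use P(1) in \<open>auto simp: monic_polys_def\<close>)
    have dP: "degree P = k" "coeff P k = 1" using P(1) by (auto simp: monic_polys_def)
    define c where "c = inner p P / inner P P"
    have "p - smult c P \<in> monic_polys n"
      using dP Suc.prems by (intro monic_polys_diff_lower p disjI2 le_less_trans[OF degree_smult_le]) auto
    moreover have "inner (p - smult c P) q = 0" if q: "q = 0 \<or> degree q < Suc k" for q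
    proof -
      define a where "a = coeff q k"
      define q' where "q' = q - smult a P"
      have "degree q' \<le> k"
        unfolding q'_def using q dP by (intro degree_diff_le order.trans[OF degree_smult_le]) auto
      moreover have "coeff q' k = 0" unfolding q'_def a_def using dP by simp
      ultimately have q': "q' = 0 \<or> degree q' < k"
        by (metis le_neq_implies_less leading_coeff_0_iff)
      have "q = smult a P + q'" by (simp add: q'_def)
      thus ?thesis using p(2)[OF q'] P(2)[OF q'] PP by (simp add: inner_simps c_def)
    qed
    ultimately show ?case by blast
  qed
  from this[of n] show ?case by simp
qed

text \<open>The difference of two solutions is orthogonal to itself, hence zero by definiteness.
  Minimality is Pythagoras for \<open>q = ?p + d\<close>, where \<open>d\<close> is zero or of lower
  degree.\<close>

lemma orthogonal_poly_props:
  "orthogonal_poly \<nu> n \<in> monic_polys n"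
  "q \<in> monic_polys n \<Longrightarrow> (\<integral>z. (norm (poly (orthogonal_poly \<nu> n) z))\<^sup>2 \<partial>\<nu>) \<le> (\<integral>z. (norm (poly q z))\<^sup>2 \<partial>\<nu>)"
proof -
  let ?O = "\<lambda>p. p \<in> monic_polys n \<and> (\<forall>q. degree q < n \<longrightarrow> inner p q = 0)"
  have "\<exists>!p. ?O p"
  proof (rule ex_ex1I)
    show "\<exists>p. ?O p" using orthogonal_exists[of n] by blast
    fix p p' assume pp: "?O p" "?O p'"
    have "inner (p - p') (p - p') = 0"
      using monic_polys_diff[of p n p'] pp by (auto simp: inner_simps)
    hence "p - p' = 0" unfolding inner_self of_real_eq_0_iff using nondegenerate by blast
    thus "p = p'" by simp
  qed
  from theI'[OF this] have O: "orthogonal_poly \<nu> n \<in> monic_polys n"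
    "\<And>q. degree q < n \<Longrightarrow> inner (orthogonal_poly \<nu> n) q = 0"
    unfolding orthogonal_poly_def inner_def by blast+
  show "orthogonal_poly \<nu> n \<in> monic_polys n" by (rule O)
  assume q: "q \<in> monic_polys n"
  let ?p = "orthogonal_poly \<nu> n"
  define d where "d = q - ?p"
  have "inner ?p d = 0"
    using monic_polys_diff[OF q O(1)] O(2)[of d] by (auto simp: d_def inner_simps)
  hence "Re (inner ?p d) = 0" by simp
  hence z: "(\<integral>z. Re (poly ?p z * cnj (poly d z)) \<partial>\<nu>) = 0"
    unfolding inner_def integral_Re[OF inner_integrable] .
  have ri: "integrable \<nu> (\<lambda>z. Re (poly ?p z * cnj (poly d z)))"
    by (rule integrable_Re[OF inner_integrable])
  have "(norm (poly q z))\<^sup>2 = (norm (poly ?p z))\<^sup>2 + 2 * Re (poly ?p z * cnj (poly d z)) + (norm (poly d z))\<^sup>2" for z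
  proof -
    have "poly q z = poly ?p z + poly d z" by (simp add: d_def)
    thus ?thesis unfolding cmod_power2 by (simp add: power2_eq_square algebra_simps)
  qed
  hence "(\<integral>z. (norm (poly q z))\<^sup>2 \<partial>\<nu>)
      = (\<integral>z. (norm (poly ?p z))\<^sup>2 + 2 * Re (poly ?p z * cnj (poly d z)) + (norm (poly d z))\<^sup>2 \<partial>\<nu>)"
    by (simp only:)
  also have "\<dots> = (\<integral>z. (norm (poly ?p z))\<^sup>2 \<partial>\<nu>) + 2 * (\<integral>z. Re (poly ?p z * cnj (poly d z)) \<partial>\<nu>)
      + (\<integral>z. (norm (poly d z))\<^sup>2 \<partial>\<nu>)"
    by (simp only: Bochner_Integration.integral_add Bochner_Integration.integrable_add integrable_mult_right
        integral_mult_right_zero ri square_integrable)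
  also have "\<dots> \<ge> (\<integral>z. (norm (poly ?p z))\<^sup>2 \<partial>\<nu>)"
    unfolding z by (simp add: Bochner_Integration.integral_nonneg)
  finally show "(\<integral>z. (norm (poly ?p z))\<^sup>2 \<partial>\<nu>) \<le> (\<integral>z. (norm (poly q z))\<^sup>2 \<partial>\<nu>)" .
qed

end

section \<open>The equilibrium measure of the star\<close>

text \<open>The mean value property for the real part of \<open>Ln (1 - r cnj v u)\<close>, which is
  0 at the centre. For \<open>r < 1\<close> the argument has positive real part and avoids the
  branch cut.\<close>

lemma mean_log_one_minus:
  assumes "norm v = 1" "0 < r" "r < 1"
  shows "(\<integral>u. ln (norm (1 - of_real r * cnj v * u)) \<partial>circle_measure) = 0"
proof -
  \<comment> \<open>Cut off outside the closed disc to obtain a function that is Borel measurable on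
    the whole plane.\<close>
  define g where "g = (\<lambda>u. indicator (cball 0 1) u *\<^sub>R Ln (1 - of_real r * cnj v * u))"
  have re: "Re (1 - of_real r * cnj v * u) > 0" if "norm u \<le> 1" for u
  proof -
    have "norm (of_real r * cnj v * u) \<le> r" using assms that by (simp add: norm_mult mult_left_le)
    hence "Re (of_real r * cnj v * u) \<le> r" using complex_Re_le_cmod order.trans by blast
    thus ?thesis using assms by simp
  qed
  have nonpos: "1 - of_real r * cnj v * u \<notin> \<real>\<^sub>\<le>\<^sub>0" if "norm u \<le> 1" for u
    using re[OF that] by (auto simp: complex_nonpos_Reals_iff)
  have hol: "(\<lambda>u. Ln (1 - of_real r * cnj v * u)) holomorphic_on cball 0 1"
    by (intro holomorphic_intros) (use nonpos in auto)
  have g_meas [measurable]: "g \<in> borel_measurable borel"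
    unfolding g_def
    by (intro borel_measurable_continuous_on_indicator holomorphic_on_imp_continuous_on hol) auto
  have g_hol: "g holomorphic_on cball 0 1"
    by (rule holomorphic_transform[OF hol]) (simp add: g_def)
  have "g 0 = 0" by (simp add: g_def)
  hence "(\<integral>u. g u \<partial>circle_measure) = 0" using circle_mean_value[OF g_meas g_hol] by simp
  moreover have "integrable circle_measure g"
  proof (rule circle_integrable_continuous)
    have "continuous_on (cball 0 1) g"
      using g_hol by (rule holomorphic_on_imp_continuous_on)
    thus "continuous_on (sphere 0 1) g" using continuous_on_subset sphere_cball by blast
  qed measurable
  ultimately have "(\<integral>u. Re (g u) \<partial>circle_measure) = 0" by (subst integral_Re) auto
  moreover have "(\<integral>u. Re (g u) \<partial>circle_measure) = (\<integral>u. ln (norm (1 - of_real r * cnj v * u)) \<partial>circle_measure)"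
  proof (intro integral_cong_AE)
    show "AE u in circle_measure. Re (g u) = ln (norm (1 - of_real r * cnj v * u))"
      using AE_circle_measure
    proof eventually_elim
      fix u :: complex assume u: "norm u = 1"
      have "1 - of_real r * cnj v * u \<noteq> 0"
      proof
        assume "1 - of_real r * cnj v * u = 0"
        hence "Re (1 - of_real r * cnj v * u) = 0" by (simp only: zero_complex.sel)
        with re[of u] u show False by linarith
      qed
      thus "Re (g u) = ln (norm (1 - of_real r * cnj v * u))" using u by (simp add: g_def)
    qed
  qed measurable
  ultimately show ?thesis by simp
qed

lemma norm_diff_eq_norm_one_minus:
  assumes "norm v = 1"
  shows "norm (1 - cnj v * u) = norm (u - v)"
proof -
  have "cnj v * (u - v) = - (1 - cnj v * u)"
    using assms complex_norm_square[of v] by (simp add: algebra_simps)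
  hence "norm (cnj v) * norm (u - v) = norm (1 - cnj v * u)" by (metis norm_minus_cancel norm_mult)
  thus ?thesis using assms by simp
qed

text \<open>The limit \<open>r \<longlonglongrightarrow> 1\<close> of
  \<open>mean_log_one_minus\<close>. Fatou's lemma first gives integrability and the absence of mass
  at \<open>v\<close>; dominated convergence then carries the value over, with a majorant supplied
  by \<open>norm_one_plus_scaled_ge\<close>.\<close>

lemma circle_log_potential:
  assumes v: "norm v = 1"
  shows "AE u in circle_measure. u \<noteq> v"
    and "integrable circle_measure (\<lambda>u. ln (norm (u - v)))"
    and "(\<integral>u. ln (norm (u - v)) \<partial>circle_measure) = 0"
proof -
  \<comment> \<open>The shift by 2 keeps every \<open>r n\<close> strictly positive.\<close>
  define r where "r = (\<lambda>n. 1 - 1 / real (n + 2))"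
  have r: "0 < r n" "r n < 1" for n by (auto simp: r_def field_simps)
  have rlim: "r \<longlonglongrightarrow> 1"
  proof -
    have "(\<lambda>n. 1 - 1 / real (n + 2)) \<longlonglongrightarrow> 1 - 0"
      by (intro tendsto_intros LIMSEQ_ignore_initial_segment[OF lim_1_over_n])
    thus ?thesis by (simp add: r_def)
  qed
  \<comment> \<open>The constant \<open>ln 2\<close> makes the functions nonnegative on the circle,
    where the modulus is at most 2, as Fatou's lemma requires.\<close>
  define h where "h = (\<lambda>n u. ln 2 - ln (norm (1 - of_real (r n) * cnj v * u)))"
  have hm [measurable]: "h n \<in> borel_measurable borel" for n unfolding h_def by measurable
  have bounds: "norm (1 - of_real (r n) * cnj v * u) \<le> 2" "0 < norm (1 - of_real (r n) * cnj v * u)"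
    "norm (u - v) \<le> 2 * norm (1 - of_real (r n) * cnj v * u)" if u: "norm u = 1" for u n
  proof -
    have nr: "norm (of_real (r n) * cnj v * u) = r n" using u v r[of n] by (simp add: norm_mult)
    show "norm (1 - of_real (r n) * cnj v * u) \<le> 2"
      using norm_triangle_ineq4[of 1 "of_real (r n) * cnj v * u"] nr r[of n] by simp
    show "0 < norm (1 - of_real (r n) * cnj v * u)"
      using norm_triangle_ineq2[of 1 "of_real (r n) * cnj v * u"] nr r[of n] by auto
    have "(1 + r n) / 2 * norm (1 + (- (cnj v * u))) \<le> norm (1 + of_real (r n) * (- (cnj v * u)))"
      by (intro norm_one_plus_scaled_ge r) (use u v in \<open>simp add: norm_mult\<close>)
    hence "(1 + r n) / 2 * norm (u - v) \<le> norm (1 - of_real (r n) * cnj v * u)"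
      by (simp add: norm_diff_eq_norm_one_minus[OF v] mult.assoc)
    moreover have "1 / 2 * norm (u - v) \<le> (1 + r n) / 2 * norm (u - v)"
      using r[of n] by (intro mult_right_mono) auto
    ultimately show "norm (u - v) \<le> 2 * norm (1 - of_real (r n) * cnj v * u)" by simp
  qed
  have h0: "0 \<le> h n u" if "norm u = 1" for n u
    using bounds[OF that, of n] unfolding h_def by simp
  have h_le: "h n u \<le> 2 * ln 2 - ln (norm (u - v))" if "norm u = 1" "u \<noteq> v" for n u
  proof -
    have "ln (norm (u - v)) \<le> ln (2 * norm (1 - of_real (r n) * cnj v * u))"
      using bounds[OF that(1), of n] that(2) by simp
    also have "\<dots> = ln 2 + ln (norm (1 - of_real (r n) * cnj v * u))"
      using bounds(2)[OF that(1), of n] by (subst ln_mult) auto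
    finally show ?thesis by (simp add: h_def)
  qed
  have int_h: "integrable circle_measure (h n)" for n
  proof (rule circle_integrable_continuous)
    show "continuous_on (sphere 0 1) (h n)"
      unfolding h_def by (intro continuous_intros) (use bounds(2)[of _ n] in auto)
  qed measurable
  have mean_h: "(\<integral>u. h n u \<partial>circle_measure) = ln 2" for n
  proof -
    have "integrable circle_measure (\<lambda>u. ln 2 - h n u)" using int_h by simp
    hence "integrable circle_measure (\<lambda>u. ln (norm (1 - of_real (r n) * cnj v * u)))"
      by (simp add: h_def)
    thus ?thesis
      unfolding h_def using mean_log_one_minus[OF v r, of n] circle.prob_space by simp
  qed
  have nn_h: "(\<integral>\<^sup>+u. ennreal (h n u) \<partial>circle_measure) = ennreal (ln 2)" for n
  proof -
    have "AE u in circle_measure. 0 \<le> h n u" using AE_circle_measure by eventually_elim (rule h0)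
    from nn_integral_eq_integral[OF int_h this] show ?thesis by (simp add: mean_h)
  qed
  have arg_lim: "(\<lambda>n. norm (1 - of_real (r n) * cnj v * u)) \<longlonglongrightarrow> norm (u - v)" for u
  proof -
    have "(\<lambda>n. norm (1 - of_real (r n) * cnj v * u)) \<longlonglongrightarrow> norm (1 - of_real 1 * cnj v * u)"
      by (intro tendsto_intros rlim)
    thus ?thesis by (simp add: norm_diff_eq_norm_one_minus[OF v])
  qed
  have h_lim: "(\<lambda>n. h n u) \<longlonglongrightarrow> ln 2 - ln (norm (u - v))" if "u \<noteq> v" for u
    unfolding h_def by (intro tendsto_intros arg_lim) (use that in simp)
  have h_lim_v: "(\<lambda>n. ennreal (h n v)) \<longlonglongrightarrow> top"
  proof -
    have eq: "h n v = ln 2 + ln (real (n + 2))" for n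
    proof -
      have vv: "cnj v * v = 1" using complex_norm_square[of v] v by (simp add: mult.commute)
      have "1 - of_real (r n) * cnj v * v = complex_of_real (1 - r n)"
        by (simp add: mult.assoc vv)
      hence "norm (1 - of_real (r n) * cnj v * v) = 1 - r n"
        using r[of n] by (simp only: norm_of_real)
      thus ?thesis by (simp add: h_def r_def ln_div)
    qed
    have "filterlim (\<lambda>n. ln 2 + ln (real (n + 2))) at_top sequentially"
      by (intro filterlim_tendsto_add_at_top[OF tendsto_const]
          filterlim_compose[OF ln_at_top] filterlim_compose[OF filterlim_real_sequentially]
          filterlim_add_const_nat_at_top)
    thus ?thesis unfolding eq ennreal_tendsto_top_eq_at_top .
  qed
  \<comment> \<open>Infinite at \<open>v\<close> on purpose: finiteness of its integral then shows
    that \<open>v\<close> has measure 0.\<close>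
  define G where "G = (\<lambda>u. if u = v then top else ennreal (ln 2 - ln (norm (u - v))))"
  have "(\<integral>\<^sup>+u. G u \<partial>circle_measure) \<le> (\<integral>\<^sup>+u. liminf (\<lambda>n. ennreal (h n u)) \<partial>circle_measure)"
  proof (intro nn_integral_mono)
    fix u
    have "(\<lambda>n. ennreal (h n u)) \<longlonglongrightarrow> G u"
      using h_lim[of u] h_lim_v by (auto simp: G_def intro: tendsto_ennrealI)
    thus "G u \<le> liminf (\<lambda>n. ennreal (h n u))" by (simp add: lim_imp_Liminf)
  qed
  also have "\<dots> \<le> liminf (\<lambda>n. \<integral>\<^sup>+u. ennreal (h n u) \<partial>circle_measure)"
    by (rule nn_integral_liminf) measurable
  also have "\<dots> = ennreal (ln 2)" unfolding nn_h by (simp add: Liminf_const)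
  finally have G_fin: "(\<integral>\<^sup>+u. G u \<partial>circle_measure) \<le> ennreal (ln 2)" .

  have Gm [measurable]: "G \<in> borel_measurable borel" unfolding G_def by measurable
  have "AE u in circle_measure. G u \<noteq> top"
  proof (rule nn_integral_noteq_infinite[unfolded infinity_ennreal_def])
    show "(\<integral>\<^sup>+u. G u \<partial>circle_measure) \<noteq> top" using G_fin by (auto simp: top_unique)
  qed measurable
  thus ne: "AE u in circle_measure. u \<noteq> v" by eventually_elim (auto simp: G_def)
  have le2: "ln (norm (u - v)) \<le> ln 2" if "norm u = 1" "u \<noteq> v" for u
    using norm_triangle_ineq4[of u v] that v by simp
  have int0: "integrable circle_measure (\<lambda>u. ln 2 - ln (norm (u - v)))"
  proof (rule integrableI_bounded)
    have "(\<integral>\<^sup>+u. ennreal (norm (ln 2 - ln (norm (u - v)))) \<partial>circle_measure) \<le> (\<integral>\<^sup>+u. G u \<partial>circle_measure)"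
    proof (rule nn_integral_mono_AE)
      show "AE u in circle_measure. ennreal (norm (ln 2 - ln (norm (u - v)))) \<le> G u"
        using ne AE_circle_measure
      proof eventually_elim
        fix u :: complex assume "u \<noteq> v" "norm u = 1"
        thus "ennreal (norm (ln 2 - ln (norm (u - v)))) \<le> G u" using le2[of u] by (simp add: G_def)
      qed
    qed
    also have "\<dots> < \<infinity>" using G_fin by (simp add: le_less_trans)
    finally show "(\<integral>\<^sup>+u. ennreal (norm (ln 2 - ln (norm (u - v)))) \<partial>circle_measure) < \<infinity>" .
  qed measurable
  have "integrable circle_measure (\<lambda>u. ln 2 - (ln 2 - ln (norm (u - v))))"
    by (rule Bochner_Integration.integrable_diff[OF _ int0]) simp
  moreover have "ln 2 - (ln 2 - t) = t" for t :: real by simp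
  ultimately show int: "integrable circle_measure (\<lambda>u. ln (norm (u - v)))" by (simp only:)
  have "(\<lambda>n. \<integral>u. h n u \<partial>circle_measure) \<longlonglongrightarrow> (\<integral>u. ln 2 - ln (norm (u - v)) \<partial>circle_measure)"
  proof (rule integral_dominated_convergence[where w = "\<lambda>u. 2 * ln 2 - ln (norm (u - v))"])
    show "AE u in circle_measure. (\<lambda>n. h n u) \<longlonglongrightarrow> ln 2 - ln (norm (u - v))"
      using ne by eventually_elim (rule h_lim)
    show "AE u in circle_measure. norm (h n u) \<le> 2 * ln 2 - ln (norm (u - v))" for n
      using ne AE_circle_measure
    proof eventually_elim
      fix u :: complex assume "u \<noteq> v" "norm u = 1"
      thus "norm (h n u) \<le> 2 * ln 2 - ln (norm (u - v))" using h0[of u n] h_le[of u n] by simp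
    qed
    show "integrable circle_measure (\<lambda>u. 2 * ln 2 - ln (norm (u - v)))"
      using int by (intro Bochner_Integration.integrable_diff) auto
  qed measurable
  hence "ln 2 = (\<integral>u. ln 2 - ln (norm (u - v)) \<partial>circle_measure)"
    unfolding mean_h by (simp add: LIMSEQ_const_iff)
  also have "\<dots> = ln 2 - (\<integral>u. ln (norm (u - v)) \<partial>circle_measure)"
    using int circle.prob_space by simp
  finally show "(\<integral>u. ln (norm (u - v)) \<partial>circle_measure) = 0" by simp
qed

section \<open>Rotations and roots: the measure on the star\<close>

definition unity_root :: "nat \<Rightarrow> nat \<Rightarrow> complex" where
  "unity_root m j = exp (2 * of_real pi * \<i> * of_nat j / of_nat m)"

lemma unity_root_power: "m > 0 \<Longrightarrow> unity_root m j ^ m = 1"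
  using complex_root_unity[of m j] by (simp add: unity_root_def)

lemma norm_unity_root [simp]: "norm (unity_root m j) = 1"
  by (simp add: unity_root_def norm_exp_eq_Re)

lemma unity_root_eq_iff: "m > 0 \<Longrightarrow> unity_root m j = unity_root m k \<longleftrightarrow> j mod m = k mod m"
  using complex_root_unity_eq[of m j k] by (simp add: unity_root_def)

lemma unity_root_power_eq: "unity_root m j ^ s = unity_root m s ^ j"
  by (simp add: unity_root_def exp_of_nat_mult[symmetric] mult_ac)

text \<open>As polynomials in \<open>z\<close> both sides are monic of degree \<open>m\<close> and
  vanish at the \<open>m\<close> points \<open>unity_root m j * y\<close>. These are distinct for
  \<open>y\<close> nonzero.\<close>

lemma prod_minus_unity_root:
  assumes m: "m > 0"
  shows "(\<Prod>j<m. z - unity_root m j * y) = z ^ m - y ^ m"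
proof (cases "y = 0")
  case True
  thus ?thesis using m by simp
next
  case False
  define p where "p = (\<Prod>j<m. [:- (unity_root m j * y), 1:])"
  define q where "q = monom 1 m - [:y ^ m:]"
  have p: "p \<in> monic_polys m" unfolding p_def by (rule prod_linear_monic)
  have q: "q \<in> monic_polys m"
    unfolding q_def using m by (intro monic_polys_diff_lower monom_monic) auto
  have "p = q"
  proof (rule ccontr)
    assume "p \<noteq> q"
    hence d: "p - q \<noteq> 0" "degree (p - q) < m" using monic_polys_diff[OF p q] by auto
    let ?A = "(\<lambda>j. unity_root m j * y) ` {..<m}"
    have "inj_on (\<lambda>j. unity_root m j * y) {..<m}"
      using False m by (auto simp: inj_on_def unity_root_eq_iff)
    hence "card ?A = m" by (simp add: card_image)
    moreover have "?A \<subseteq> {x. poly (p - q) x = 0}"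
    proof
      fix x assume "x \<in> ?A"
      then obtain j where j: "j < m" "x = unity_root m j * y" by blast
      have "poly p x = 0" unfolding p_def poly_prod using j by (intro prod_zero) auto
      moreover have "poly q x = 0"
        using m by (simp add: q_def poly_monom j power_mult_distrib unity_root_power)
      ultimately show "x \<in> {x. poly (p - q) x = 0}" by simp
    qed
    hence "card ?A \<le> card {x. poly (p - q) x = 0}"
      using d by (intro card_mono poly_roots_finite)
    moreover have "card {x. poly (p - q) x = 0} \<le> degree (p - q)" using d by (intro card_poly_roots_bound)
    ultimately show False using d by linarith
  qed
  hence "poly p z = poly q z" by simp
  thus ?thesis by (simp add: p_def q_def poly_prod poly_monom)
qed

text \<open>A Borel choice of an m-th root of the real number \<open>2 Re u\<close>; for a negative
  number the factor \<open>cis (pi / m)\<close> supplies the sign. The other roots come from the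
  rotations in \<open>star_measure\<close>.\<close>

definition branch_root :: "nat \<Rightarrow> complex \<Rightarrow> complex" where
  "branch_root m u = of_real (root m \<bar>2 * Re u\<bar>) * (if Re u < 0 then cis (pi / real m) else 1)"

lemma branch_root_power:
  assumes "m > 0"
  shows "branch_root m u ^ m = xproj u"
proof -
  have "real m * (pi / real m) = pi" using assms by simp
  hence "cis (pi / real m) ^ m = -1" by (simp only: Complex.DeMoivre cis_pi)
  moreover have "complex_of_real (root m \<bar>2 * Re u\<bar>) ^ m = of_real \<bar>2 * Re u\<bar>"
    using assms by (simp flip: of_real_power)
  ultimately show ?thesis by (simp add: branch_root_def power_mult_distrib xproj_def)
qed

lemma branch_root_meas [measurable]: "branch_root m \<in> borel_measurable borel"
proof -
  have [measurable]: "root m \<in> borel_measurable borel"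
    by (intro borel_measurable_continuous_onI continuous_intros)
  show ?thesis unfolding branch_root_def by measurable
qed

text \<open>Encoded as the image of a uniform rotation and a uniform point of the circle, so that
  integrals become averages over the \<open>m\<close> rotated roots.\<close>

definition star_measure :: "nat \<Rightarrow> complex measure" where
  "star_measure m = distr (measure_pmf (pmf_of_set {..<m}) \<Otimes>\<^sub>M circle_measure) borel
     (\<lambda>(j, u). unity_root m j * branch_root m u)"

lemma star_map_meas [measurable]:
  "(\<lambda>(j, u). unity_root m j * branch_root m u) \<in> borel_measurable (measure_pmf M \<Otimes>\<^sub>M circle_measure)"
proof -
  have [measurable]: "unity_root m \<in> borel_measurable (measure_pmf M)" by simp
  show ?thesis by measurable
qed

lemma compact_star_set:
  assumes "m > 0"
  shows "compact (star_set m)"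
proof -
  have "compact (complex_of_real ` {-2..2})" by (intro compact_continuous_image continuous_intros) auto
  hence "closed ((\<lambda>z. z ^ m) -` (complex_of_real ` {-2..2}))"
    by (intro continuous_closed_vimage compact_imp_closed continuous_intros) auto
  moreover have "(\<lambda>z. z ^ m) -` (complex_of_real ` {-2..2}) = star_set m" by (auto simp: star_set_def)
  moreover have "bounded (star_set m)"
    unfolding bounded_iff
  proof (intro exI[of _ 2] ballI)
    fix z assume "z \<in> star_set m"
    then obtain x where "z ^ m = of_real x" "x \<in> {-2..2}" by (auto simp: star_set_def)
    hence "norm z ^ m \<le> 2" by (simp add: norm_power[symmetric] abs_le_iff)
    show "norm z \<le> 2"
    proof (rule ccontr)
      assume "\<not> norm z \<le> 2"
      hence "norm z ^ 1 \<le> norm z ^ m" using assms by (intro power_increasing) auto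
      thus False using \<open>norm z ^ m \<le> 2\<close> \<open>\<not> norm z \<le> 2\<close> by simp
    qed
  qed
  ultimately show ?thesis by (simp add: compact_eq_bounded_closed)
qed

lemma star_point:
  assumes "m > 0" "norm u = 1"
  shows "unity_root m j * branch_root m u \<in> star_set m"
proof -
  have "(unity_root m j * branch_root m u) ^ m = of_real (2 * Re u)"
    using assms by (simp only: power_mult_distrib unity_root_power branch_root_power xproj_def mult_1_left)
  moreover have "\<bar>Re u\<bar> \<le> 1" using abs_Re_le_cmod[of u] assms by simp
  ultimately show ?thesis unfolding star_set_def by (auto intro!: image_eqI[of _ _ "2 * Re u"])
qed

lemma star_set_param:
  assumes "z \<in> star_set m"
  obtains v where "norm v = 1" "z ^ m = xproj v"
proof -
  obtain x where x: "z ^ m = of_real x" "- 2 \<le> x" "x \<le> 2" using assms by (auto simp: star_set_def)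
  hence x2: "\<bar>x / 2\<bar> \<le> 1" by (simp add: abs_le_iff)
  have "norm (cis (arccos (x / 2))) = 1" by simp
  moreover have "xproj (cis (arccos (x / 2))) = of_real x"
    unfolding xproj_def using x2 by (simp add: cos_arccos_abs)
  ultimately show ?thesis using that x(1) by metis
qed

lemma infinite_star_set:
  assumes "m > 0"
  shows "infinite (star_set m)"
proof
  assume "finite (star_set m)"
  hence "finite ((\<lambda>z. z ^ m) ` star_set m)" by simp
  moreover have "complex_of_real ` {-2..2} \<subseteq> (\<lambda>z. z ^ m) ` star_set m"
  proof
    fix w assume w: "w \<in> complex_of_real ` {-2..2}"
    obtain z where "z ^ m = w" using assms by (metis exists_complex_root bot_nat_0.not_eq_extremum)
    with w show "w \<in> (\<lambda>z. z ^ m) ` star_set m" by (auto simp: star_set_def)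
  qed
  ultimately have "finite (complex_of_real ` {-2..2})" by (rule finite_subset[rotated])
  hence "finite {-2..2::real}" by (rule finite_imageD) (simp add: inj_on_def)
  thus False by (simp add: infinite_Icc)
qed

lemma nn_integral_star_measure:
  assumes m: "m > 0" and [measurable]: "f \<in> borel_measurable borel"
  shows "(\<integral>\<^sup>+z. f z \<partial>star_measure m)
    = (\<integral>\<^sup>+u. (\<Sum>j<m. f (unity_root m j * branch_root m u)) \<partial>circle_measure) / of_nat m"
proof -
  have "(\<integral>\<^sup>+z. f z \<partial>star_measure m)
      = (\<integral>\<^sup>+p. f (case p of (j, u) \<Rightarrow> unity_root m j * branch_root m u)
          \<partial>(measure_pmf (pmf_of_set {..<m}) \<Otimes>\<^sub>M circle_measure))"
    unfolding star_measure_def by (rule nn_integral_distr) auto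
  also have "\<dots> = (\<integral>\<^sup>+j. \<integral>\<^sup>+u. f (unity_root m j * branch_root m u) \<partial>circle_measure \<partial>measure_pmf (pmf_of_set {..<m}))"
    by (subst circle.nn_integral_fst[symmetric]) auto
  also have "\<dots> = (\<Sum>j<m. \<integral>\<^sup>+u. f (unity_root m j * branch_root m u) \<partial>circle_measure) / of_nat m"
    using m by (subst nn_integral_pmf_of_set) (auto simp: ennreal_of_nat_eq_real_of_nat)
  also have "(\<Sum>j<m. \<integral>\<^sup>+u. f (unity_root m j * branch_root m u) \<partial>circle_measure)
      = (\<integral>\<^sup>+u. (\<Sum>j<m. f (unity_root m j * branch_root m u)) \<partial>circle_measure)"
    by (rule nn_integral_sum[symmetric]) measurable
  finally show ?thesis .
qed

lemma star_measure_prob: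
  assumes m: "m > 0"
  shows "star_measure m \<in> prob_measures_on (star_set m)"
proof -
  have E: "star_set m \<in> sets borel" using compact_star_set[OF m] by (simp add: borel_closed compact_imp_closed)
  interpret P: pair_prob_space "measure_pmf (pmf_of_set {..<m})" circle_measure ..
  have "prob_space (star_measure m)"
    unfolding star_measure_def by (rule P.prob_space_distr) measurable
  moreover have s: "sets (star_measure m) = sets borel" by (simp add: star_measure_def)
  moreover have "emeasure (star_measure m) (star_set m) = 1"
  proof -
    have "emeasure (star_measure m) (star_set m) = (\<integral>\<^sup>+z. indicator (star_set m) z \<partial>star_measure m)"
      using E s by simp
    also have "\<dots> = (\<integral>\<^sup>+u. (\<Sum>j<m. indicator (star_set m) (unity_root m j * branch_root m u)) \<partial>circle_measure) / of_nat m"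
      using E by (intro nn_integral_star_measure[OF m]) auto
    also have "(\<integral>\<^sup>+u. (\<Sum>j<m. indicator (star_set m) (unity_root m j * branch_root m u)) \<partial>circle_measure)
        = (\<integral>\<^sup>+u. of_nat m \<partial>circle_measure)"
    proof (rule nn_integral_cong_AE)
      show "AE u in circle_measure. (\<Sum>j<m. indicator (star_set m) (unity_root m j * branch_root m u)) = (of_nat m :: ennreal)"
        using AE_circle_measure by eventually_elim (simp add: star_point[OF m])
    qed
    also have "\<dots> / of_nat m = (of_nat m / of_nat m :: ennreal)"
      by (simp add: circle.emeasure_space_1[simplified])
    also have "\<dots> = 1" using m by (intro ennreal_divide_self) (simp_all add: ennreal_of_nat_eq_real_of_nat)
    finally show ?thesis .
  qed
  ultimately show ?thesis by (simp add: prob_measures_on_def)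
qed

lemma integral_star_measure:
  fixes f :: "complex \<Rightarrow> real"
  assumes m: "m > 0" and f: "f \<in> borel_measurable borel" "continuous_on (star_set m) f"
  shows "(\<integral>z. f z \<partial>star_measure m)
      = (\<integral>u. (\<Sum>j<m. f (unity_root m j * branch_root m u)) \<partial>circle_measure) / real m"
    and "integrable circle_measure (\<lambda>u. f (unity_root m j * branch_root m u))"
proof -
  note [measurable] = f(1)
  interpret \<mu>: prob_on_compact "star_set m" "star_measure m"
    using compact_star_set[OF m] star_measure_prob[OF m] by unfold_locales
  interpret P: pair_prob_space "measure_pmf (pmf_of_set {..<m})" circle_measure ..
  have "bounded (f ` star_set m)"
    by (intro compact_imp_bounded compact_continuous_image f compact_star_set m)
  then obtain B where "\<forall>x\<in>f ` star_set m. norm x \<le> B" unfolding bounded_iff by blast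
  hence B: "norm (f (unity_root m j * branch_root m u)) \<le> B" if "norm u = 1" for u j
    using star_point[OF m that, of j] by auto
  show int: "integrable circle_measure (\<lambda>u. f (unity_root m j * branch_root m u))" for j
    by (rule circle_integrable_bounded[OF _ B]) measurable
  let ?T = "\<lambda>(j, u). unity_root m j * branch_root m u"
  have "integrable (star_measure m) f" by (rule \<mu>.integrable_cont[OF f])
  hence pint: "integrable (measure_pmf (pmf_of_set {..<m}) \<Otimes>\<^sub>M circle_measure) (\<lambda>p. f (?T p))"
    unfolding star_measure_def by (subst (asm) integrable_distr_eq) auto
  have "(\<integral>z. f z \<partial>star_measure m) = (\<integral>p. f (?T p) \<partial>(measure_pmf (pmf_of_set {..<m}) \<Otimes>\<^sub>M circle_measure))"
    unfolding star_measure_def by (rule integral_distr) auto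
  also have "\<dots> = (\<integral>j. \<integral>u. f (unity_root m j * branch_root m u) \<partial>circle_measure \<partial>measure_pmf (pmf_of_set {..<m}))"
    using P.integral_fst'[OF pint] by simp
  also have "\<dots> = (\<Sum>j<m. \<integral>u. f (unity_root m j * branch_root m u) \<partial>circle_measure) / real m"
    using m by (subst integral_pmf_of_set) auto
  also have "(\<Sum>j<m. \<integral>u. f (unity_root m j * branch_root m u) \<partial>circle_measure)
      = (\<integral>u. (\<Sum>j<m. f (unity_root m j * branch_root m u)) \<partial>circle_measure)"
    by (rule Bochner_Integration.integral_sum[symmetric]) (rule int)
  finally show "(\<integral>z. f z \<partial>star_measure m)
      = (\<integral>u. (\<Sum>j<m. f (unity_root m j * branch_root m u)) \<partial>circle_measure) / real m" .
qed

text \<open>Write \<open>z^m = v + 1/v\<close>. The product of the distances from \<open>z\<close>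
  to the \<open>m\<close> rotated roots is \<open>|z^m - xproj u| = |u - v| |u - cnj v|\<close>, and
  the logarithm of each factor has mean 0 on the circle. Only the \<open>half_log\<close> terms
  survive.\<close>

lemma star_potential:
  assumes m: "m > 0" and z: "z \<in> star_set m"
  shows "(\<integral>\<^sup>+w. chordal_kernel z w \<partial>star_measure m) = ennreal (half_log z + (\<integral>w. half_log w \<partial>star_measure m))"
proof -
  obtain v where v: "norm v = 1" "z ^ m = xproj v" using star_set_param[OF z] by blast
  have cv: "norm (cnj v) = 1" using v by simp
  let ?w = "\<lambda>j u. unity_root m j * branch_root m u"
  define L where "L = (\<lambda>u. ln (norm (u - v)) + ln (norm (u - cnj v)))"
  define S where "S = (\<lambda>u. \<Sum>j<m. half_log (?w j u))"
  define \<Phi> where "\<Phi> = (\<lambda>u. real m * half_log z + S u - L u)"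
  have key: "(\<Sum>j<m. chordal_kernel z (?w j u)) = ennreal (\<Phi> u) \<and> 0 \<le> \<Phi> u"
    if u: "norm u = 1" "u \<noteq> v" "u \<noteq> cnj v" for u
  proof -
    have "u * (z ^ m - branch_root m u ^ m) = - ((u - v) * (u - cnj v))"
    proof -
      have "u * cnj u = 1" "v * cnj v = 1" using u v by (simp_all add: complex_norm_square[symmetric])
      thus ?thesis unfolding branch_root_power[OF m] v(2) xproj_eq by (simp add: algebra_simps)
    qed
    hence "norm u * norm (z ^ m - branch_root m u ^ m) = norm (u - v) * norm (u - cnj v)"
      by (metis norm_minus_cancel norm_mult)
    hence prod: "(\<Prod>j<m. norm (z - ?w j u)) = norm (u - v) * norm (u - cnj v)"
      using u unfolding prod_norm prod_minus_unity_root[OF m] by simp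
    have "(\<Prod>j<m. norm (z - ?w j u)) \<noteq> 0" unfolding prod using u by simp
    hence nz: "norm (z - ?w j u) \<noteq> 0" if "j < m" for j
      using that unfolding prod_zero_iff[OF finite_lessThan] by blast
    have Ls: "L u = (\<Sum>j<m. ln (norm (z - ?w j u)))"
      using u ln_prod[of "{..<m}" "\<lambda>j. norm (z - ?w j u)"] nz unfolding prod L_def by (simp add: ln_mult)
    have each: "chordal_kernel z (?w j u) = ennreal (half_log z + half_log (?w j u) - ln (norm (z - ?w j u)))"
      "0 \<le> half_log z + half_log (?w j u) - ln (norm (z - ?w j u))" if "j < m" for j
    proof -
      have ne: "z \<noteq> ?w j u" using nz[OF that] by auto
      show "chordal_kernel z (?w j u) = ennreal (half_log z + half_log (?w j u) - ln (norm (z - ?w j u)))"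
        by (rule chordal_kernel_off_diag[OF ne])
      have "0 < 1 - chordal z (?w j u)" using chordal_le_1[of z "?w j u"] chordal_eq_1_iff[of z "?w j u"] ne by auto
      thus "0 \<le> half_log z + half_log (?w j u) - ln (norm (z - ?w j u))"
        unfolding half_log_diff_ln[OF ne] by simp
    qed
    have \<Phi>: "\<Phi> u = (\<Sum>j<m. half_log z + half_log (?w j u) - ln (norm (z - ?w j u)))"
      unfolding \<Phi>_def S_def Ls by (simp add: sum.distrib sum_subtractf)
    have "(\<Sum>j<m. chordal_kernel z (?w j u)) = (\<Sum>j<m. ennreal (half_log z + half_log (?w j u) - ln (norm (z - ?w j u))))"
      by (intro sum.cong refl each(1)) simp
    also have "\<dots> = ennreal (\<Phi> u)" unfolding \<Phi> by (intro sum_ennreal each(2)) simp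
    finally show ?thesis unfolding \<Phi> by (intro conjI sum_nonneg each(2)) auto
  qed
  have S_int: "integrable circle_measure S" and S_mean: "(\<integral>u. S u \<partial>circle_measure) = real m * (\<integral>w. half_log w \<partial>star_measure m)"
    unfolding S_def
    using integral_star_measure[OF m half_log_meas half_log_cont] m by simp_all
  have L_int: "integrable circle_measure L" and L_mean: "(\<integral>u. L u \<partial>circle_measure) = 0"
    unfolding L_def using circle_log_potential(2,3)[OF v(1)] circle_log_potential(2,3)[OF cv] by simp_all
  have \<Phi>_int: "integrable circle_measure \<Phi>" unfolding \<Phi>_def using S_int L_int by simp
  have "(\<integral>\<^sup>+u. (\<Sum>j<m. chordal_kernel z (?w j u)) \<partial>circle_measure) = (\<integral>\<^sup>+u. ennreal (\<Phi> u) \<partial>circle_measure)"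
  proof (rule nn_integral_cong_AE)
    show "AE u in circle_measure. (\<Sum>j<m. chordal_kernel z (?w j u)) = ennreal (\<Phi> u)"
      using AE_circle_measure circle_log_potential(1)[OF v(1)] circle_log_potential(1)[OF cv]
      by eventually_elim (use key in blast)
  qed
  also have "\<dots> = ennreal (\<integral>u. \<Phi> u \<partial>circle_measure)"
  proof (rule nn_integral_eq_integral[OF \<Phi>_int])
    show "AE u in circle_measure. 0 \<le> \<Phi> u"
      using AE_circle_measure circle_log_potential(1)[OF v(1)] circle_log_potential(1)[OF cv]
      by eventually_elim (use key in blast)
  qed
  also have "(\<integral>u. \<Phi> u \<partial>circle_measure) = real m * (half_log z + (\<integral>w. half_log w \<partial>star_measure m))"
    unfolding \<Phi>_def using S_int L_int S_mean L_mean circle.prob_space by (simp add: distrib_left)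
  finally have main: "(\<integral>\<^sup>+u. (\<Sum>j<m. chordal_kernel z (?w j u)) \<partial>circle_measure)
      = ennreal (real m * (half_log z + (\<integral>w. half_log w \<partial>star_measure m)))" .
  have [measurable]: "chordal_kernel z \<in> borel_measurable borel" by measurable
  have "(\<integral>\<^sup>+w. chordal_kernel z w \<partial>star_measure m)
      = ennreal (real m * (half_log z + (\<integral>w. half_log w \<partial>star_measure m))) / of_nat m"
    unfolding main[symmetric] by (rule nn_integral_star_measure[OF m]) measurable
  also have "\<dots> = ennreal (half_log z + (\<integral>w. half_log w \<partial>star_measure m))"
  proof -
    have "0 \<le> half_log z + (\<integral>w. half_log w \<partial>star_measure m)"
      by (intro add_nonneg_nonneg half_log_nonneg Bochner_Integration.integral_nonneg)
    thus ?thesis using m by (simp add: ennreal_of_nat_eq_real_of_nat divide_ennreal)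
  qed
  finally show ?thesis .
qed

lemma star_capacity: "m > 0 \<Longrightarrow> log_capacity (star_set m) = 1"
  and star_equilibrium: "m > 0 \<Longrightarrow> equilibrium_measure (star_set m) = star_measure m"
  using equilibrium_criterion[OF compact_star_set star_measure_prob star_potential] by auto

text \<open>The potential is finite on the star while the kernel is infinite on the diagonal, so
  there are no atoms; a nonzero polynomial has only finitely many zeros.\<close>

lemma star_measure_nondegenerate:
  assumes m: "m > 0"
  shows "nondegenerate_prob (star_set m) (star_measure m)"
proof -
  interpret \<mu>: prob_on_compact "star_set m" "star_measure m"
    using compact_star_set[OF m] star_measure_prob[OF m] by unfold_locales
  have no_atom: "AE w in star_measure m. w \<noteq> z" for z
  proof (cases "z \<in> star_set m")
    case True
    have [measurable]: "chordal_kernel z \<in> borel_measurable borel" by measurable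
    have "AE w in star_measure m. chordal_kernel z w \<noteq> \<infinity>"
      by (rule nn_integral_noteq_infinite) (simp_all add: star_potential[OF m True])
    thus ?thesis by eventually_elim (auto simp: chordal_kernel_diag)
  next
    case False
    show ?thesis using \<mu>.AE_in by eventually_elim (use False in auto)
  qed
  show ?thesis
  proof unfold_locales
    fix p :: "complex poly" assume p: "p \<noteq> 0"
    show "(\<integral>z. (norm (poly p z))\<^sup>2 \<partial>star_measure m) \<noteq> 0"
    proof
      assume "(\<integral>z. (norm (poly p z))\<^sup>2 \<partial>star_measure m) = 0"
      moreover have "integrable (star_measure m) (\<lambda>z. (norm (poly p z))\<^sup>2)"
        by (intro \<mu>.integrable_cont borel_measurable_continuous_onI continuous_intros)
      ultimately have "AE z in star_measure m. poly p z = 0"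
        by (subst (asm) integral_nonneg_eq_0_iff_AE) auto
      moreover have "AE w in star_measure m. \<forall>z\<in>{z. poly p z = 0}. w \<noteq> z"
        using poly_roots_finite[OF p] no_atom by (intro AE_finite_allI) auto
      ultimately have "AE z in star_measure m. False" by eventually_elim auto
      thus False by simp
    qed
  qed
qed

section \<open>Asymptotics\<close>

text \<open>For \<open>l < m\<close>, with \<open>Q\<close> this polynomial,
  \<open>z^l Q(z^m)\<close> collects the terms of \<open>p\<close> whose exponent is congruent to
  \<open>l\<close> modulo \<open>m\<close> and at most \<open>k m + l\<close>.\<close>

definition residue_part :: "nat \<Rightarrow> nat \<Rightarrow> nat \<Rightarrow> complex poly \<Rightarrow> complex poly" where
  "residue_part m l k p = (\<Sum>i\<le>k. monom (coeff p (i * m + l)) i)"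

lemma residue_part_monic:
  assumes "p \<in> monic_polys (k * m + l)"
  shows "residue_part m l k p \<in> monic_polys k"
proof -
  have lc: "coeff p (k * m + l) = 1" using assms by (auto simp: monic_polys_def)
  have c: "coeff (residue_part m l k p) i = (if i \<le> k then coeff p (i * m + l) else 0)" for i
    by (simp add: residue_part_def coeff_sum)
  have "degree (residue_part m l k p) \<le> k" by (rule degree_le) (simp add: c)
  moreover have "k \<le> degree (residue_part m l k p)" by (rule le_degree) (simp add: c lc)
  ultimately show ?thesis by (simp add: monic_polys_def c lc)
qed

text \<open>Orthogonality of characters: otherwise the ratio of the geometric sum is an m-th root of
  unity different from 1.\<close>

lemma sum_unity_root:
  assumes m: "m > 0"
  shows "(\<Sum>j<m. cnj (unity_root m l ^ j) * unity_root m s ^ j) = (if s mod m = l mod m then of_nat m else 0)"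
proof (cases "s mod m = l mod m")
  case True
  hence "unity_root m s = unity_root m l" using m by (simp add: unity_root_eq_iff)
  moreover have "cnj (unity_root m l ^ j) * unity_root m l ^ j = 1" for j
    using complex_norm_square[of "unity_root m l ^ j"] by (simp add: norm_power mult.commute)
  ultimately show ?thesis using True by simp
next
  case False
  define c where "c = cnj (unity_root m l) * unity_root m s"
  have "c \<noteq> 1"
  proof
    assume "c = 1"
    hence "unity_root m l * c = unity_root m l" by simp
    moreover have "unity_root m l * cnj (unity_root m l) = 1" by (simp add: complex_norm_square[symmetric])
    ultimately have "unity_root m s = unity_root m l" by (simp add: c_def mult.assoc[symmetric])
    thus False using False m by (simp add: unity_root_eq_iff)
  qed
  moreover have "c ^ m = 1"
    using m by (simp add: c_def power_mult_distrib unity_root_power flip: complex_cnj_power)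
  ultimately have "(\<Sum>j<m. c ^ j) = 0" by (simp add: sum_gp_strict)
  thus ?thesis using False by (simp add: c_def power_mult_distrib)
qed

text \<open>Discrete Fourier projection onto one residue class: rotation by
  \<open>unity_root m j\<close> multiplies the term of exponent \<open>s\<close> by the j-th power
  of \<open>unity_root m s\<close>.\<close>

lemma residue_part_average:
  assumes m: "m > 0" and l: "l < m" and p: "degree p = k * m + l"
  shows "(\<Sum>j<m. cnj (unity_root m l ^ j) * poly p (unity_root m j * y))
    = of_nat m * (y ^ l * poly (residue_part m l k p) (y ^ m))"
proof -
  let ?n = "k * m + l"
  have "(\<Sum>j<m. cnj (unity_root m l ^ j) * poly p (unity_root m j * y))
      = (\<Sum>j<m. \<Sum>s\<le>?n. coeff p s * y ^ s * (cnj (unity_root m l ^ j) * unity_root m s ^ j))"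
    by (simp add: poly_altdef p sum_distrib_left power_mult_distrib unity_root_power_eq[of m _ _] mult_ac)
  also have "\<dots> = (\<Sum>s\<le>?n. coeff p s * y ^ s * (\<Sum>j<m. cnj (unity_root m l ^ j) * unity_root m s ^ j))"
    unfolding sum_distrib_left by (rule sum.swap)
  also have "\<dots> = (\<Sum>s\<le>?n. if s mod m = l then of_nat m * (coeff p s * y ^ s) else 0)"
    unfolding sum_unity_root[OF m] using l by (intro sum.cong) auto
  also have "\<dots> = (\<Sum>s\<in>{s. s \<le> ?n \<and> s mod m = l}. of_nat m * (coeff p s * y ^ s))"
    by (simp add: sum.inter_filter[symmetric] atMost_def Collect_conj_eq[symmetric])
  also have "\<dots> = (\<Sum>i\<le>k. of_nat m * (coeff p (i * m + l) * y ^ (i * m + l)))"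
  proof (rule sum.reindex_bij_witness[of _ "\<lambda>i. i * m + l" "\<lambda>s. s div m"])
    fix s assume s: "s \<in> {s. s \<le> ?n \<and> s mod m = l}"
    show 1: "s div m * m + l = s" using s div_mult_mod_eq[of s m] by simp
    have "s div m \<le> ?n div m" using s by (intro div_le_mono) simp
    thus "s div m \<in> {..k}" using l by simp
    show "of_nat m * (coeff p (s div m * m + l) * y ^ (s div m * m + l)) = of_nat m * (coeff p s * y ^ s)"
      by (simp only: 1)
  qed (use l in auto)
  also have "\<dots> = of_nat m * (y ^ l * poly (residue_part m l k p) (y ^ m))"
    by (simp add: residue_part_def poly_sum poly_monom sum_distrib_left power_add power_mult[symmetric] mult_ac)
  finally show ?thesis .
qed

lemma residue_part_norm_le:
  assumes "m > 0" "l < m" "degree p = k * m + l"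
  shows "real m * norm (y ^ l * poly (residue_part m l k p) (y ^ m))
      \<le> (\<Sum>j<m. norm (poly p (unity_root m j * y)))"
proof -
  have "real m * norm (y ^ l * poly (residue_part m l k p) (y ^ m))
      = norm (\<Sum>j<m. cnj (unity_root m l ^ j) * poly p (unity_root m j * y))"
    unfolding residue_part_average[OF assms] by (simp add: norm_mult)
  also have "\<dots> \<le> (\<Sum>j<m. norm (cnj (unity_root m l ^ j) * poly p (unity_root m j * y)))"
    by (rule norm_sum)
  also have "\<dots> = (\<Sum>j<m. norm (poly p (unity_root m j * y)))"
    by (simp add: norm_mult norm_power)
  finally show ?thesis .
qed

text \<open>Cauchy-Schwarz over the \<open>m\<close> rotations.\<close>

lemma residue_part_square_le:
  assumes "m > 0" "l < m" "degree p = k * m + l"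
  shows "(norm (y ^ l * poly (residue_part m l k p) (y ^ m)))\<^sup>2
      \<le> (\<Sum>j<m. (norm (poly p (unity_root m j * y)))\<^sup>2) / real m"
proof -
  let ?a = "norm (y ^ l * poly (residue_part m l k p) (y ^ m))"
  have "(real m * ?a)\<^sup>2 \<le> (\<Sum>j<m. norm (poly p (unity_root m j * y)))\<^sup>2"
    using residue_part_norm_le[OF assms] by (intro power_mono) auto
  also have "\<dots> \<le> (\<Sum>j<m. (norm (poly p (unity_root m j * y)))\<^sup>2) * real m"
    using sum_squared_le_sum_of_squares[of "\<lambda>j. norm (poly p (unity_root m j * y))" "{..<m}"] by simp
  finally show ?thesis
    using assms(1) by (simp add: power2_eq_square field_simps)
qed

lemma norm_branch_root_power: "m > 0 \<Longrightarrow> norm (branch_root m u) ^ m = norm (xproj u)"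
  by (simp only: norm_power[symmetric] branch_root_power)

text \<open>Here \<open>y\<close> stands for \<open>|z|\<close> with \<open>z^m = x\<close>, so the
  true weight is \<open>y^l = |x|^(l/m)\<close>. The exponent \<open>1 - l/m\<close> in the bound
  for \<open>|H|\<close> completes it to the full power \<open>|x|\<close>, which the extra factor
  of \<open>x Q(x)\<close> matches.\<close>

lemma star_weight_minorant:
  assumes m: "m > 0" and l: "l < m" and e: "0 < e" "e < 1"
  obtains h :: "real poly" where "poly h 0 = 1"
    "\<And>u. norm u \<le> 1 \<Longrightarrow> poly (map_poly complex_of_real h) u \<noteq> 0"
    "\<And>u y. norm u = 1 \<Longrightarrow> 0 \<le> y \<Longrightarrow> y ^ m = norm (xproj u) \<Longrightarrow>
      (1 - e) * norm (xproj u) \<le> norm (poly (map_poly complex_of_real h) u) * y ^ l"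
proof -
  let ?b = "real (m - l) / real m"
  have b: "0 \<le> ?b" "?b \<le> 1" using m by auto
  obtain h :: "real poly" where h: "poly h 0 = 1"
    "\<And>u. norm u \<le> 1 \<Longrightarrow> poly (map_poly complex_of_real h) u \<noteq> 0"
    "\<And>u. norm u = 1 \<Longrightarrow> (1 - e) * norm (xproj u) powr ?b \<le> norm (poly (map_poly complex_of_real h) u)"
    using weight_minorant[OF b e] by metis
  show ?thesis
  proof (rule that[OF h(1,2)])
    fix u y assume u: "norm u = 1" and y: "0 \<le> y" "y ^ m = norm (xproj u)"
    show "(1 - e) * norm (xproj u) \<le> norm (poly (map_poly complex_of_real h) u) * y ^ l"
    proof (cases "y = 0")
      case True
      hence "norm (xproj u) = 0" using y m by (metis power_0_left less_irrefl)
      thus ?thesis using y by simp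
    next
      case False
      hence y0: "y > 0" using y by simp
      have "(y ^ m) powr ?b = y ^ (m - l)"
      proof -
        have "(y ^ m) powr ?b = y powr (real m * ?b)"
          using y0 by (simp add: powr_realpow[symmetric] powr_powr)
        also have "real m * ?b = real (m - l)" using m by simp
        finally show ?thesis using y0 by (simp only: powr_realpow)
      qed
      hence "(1 - e) * y ^ (m - l) \<le> norm (poly (map_poly complex_of_real h) u)"
        using h(3)[OF u] y by simp
      hence "(1 - e) * y ^ (m - l) * y ^ l \<le> norm (poly (map_poly complex_of_real h) u) * y ^ l"
        using y by (intro mult_right_mono) auto
      moreover have "y ^ (m - l) * y ^ l = norm (xproj u)"
        unfolding y(2)[symmetric] using l by (simp add: power_add[symmetric])
      ultimately show ?thesis by (simp add: mult.assoc)
    qed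
  qed
qed

lemma star_weight_majorant:
  assumes m: "m > 0" and l: "l < m" and e: "0 < e" "e < 1"
  obtains h :: "real poly" where "poly h 0 = 1"
    "\<And>u. norm u \<le> 1 \<Longrightarrow> poly (map_poly complex_of_real h) u \<noteq> 0"
    "\<And>u y. norm u = 1 \<Longrightarrow> 0 \<le> y \<Longrightarrow> y ^ m = norm (xproj u) \<Longrightarrow>
      norm (poly (map_poly complex_of_real h) u) * y ^ l \<le> 1 + e"
proof (cases "l = 0")
  \<comment> \<open>Treated apart because \<open>0 powr 0 = 0\<close> while
    \<open>y ^ 0 = 1\<close>: at \<open>y = 0\<close> the bound with \<open>powr\<close> would give
    nothing.\<close>
  case True
  show ?thesis by (rule that[of 1]) (use True e in auto)
next
  case False
  let ?b = "real l / real m"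
  have b: "0 \<le> ?b" "?b \<le> 1" using m l by auto
  obtain h :: "real poly" where h: "poly h 0 = 1"
    "\<And>u. norm u \<le> 1 \<Longrightarrow> poly (map_poly complex_of_real h) u \<noteq> 0"
    "\<And>u. norm u = 1 \<Longrightarrow> norm (poly (map_poly complex_of_real h) u) * norm (xproj u) powr ?b \<le> 1 + e"
    using weight_majorant[OF b e] by metis
  show ?thesis
  proof (rule that[OF h(1,2)])
    fix u y assume u: "norm u = 1" and y: "0 \<le> y" "y ^ m = norm (xproj u)"
    have "(y ^ m) powr ?b = y ^ l"
    proof (cases "y = 0")
      case True
      thus ?thesis using m False by (simp add: power_0_left)
    next
      case y0: False
      hence y0: "y > 0" using y by simp
      have "(y ^ m) powr ?b = y powr (real m * ?b)"
        using y0 by (simp add: powr_realpow[symmetric] powr_powr)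
      also have "real m * ?b = real l" using m by simp
      finally show ?thesis using y0 by (simp only: powr_realpow)
    qed
    thus "norm (poly (map_poly complex_of_real h) u) * y ^ l \<le> 1 + e"
      using h(3)[OF u] y by simp
  qed
qed

definition widom_close :: "nat \<Rightarrow> nat \<Rightarrow> real \<Rightarrow> bool" where
  "widom_close m n e \<longleftrightarrow>
     (1 - e)\<^sup>2 * 2 \<le> (widom_L2 (star_set m) n)\<^sup>2 \<and> (widom_L2 (star_set m) n)\<^sup>2 \<le> (1 + e)\<^sup>2 * 2 \<and>
     (1 - e) * 2 \<le> widom_sup (star_set m) n \<and> widom_sup (star_set m) n \<le> (1 + e) * 2"

section \<open>Comparison of the star with the weighted interval\<close>

locale star =
  fixes m :: nat
  assumes m: "m > 0"
begin

sublocale E: infinite_compact "star_set m"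
  using compact_star_set[OF m] infinite_star_set[OF m] by unfold_locales

sublocale \<mu>: nondegenerate_prob "star_set m" "star_measure m"
  by (rule star_measure_nondegenerate[OF m])

lemma widom_sup_eq: "widom_sup (star_set m) n = sup_norm_on (star_set m) (chebyshev_poly (star_set m) n)"
  by (simp add: widom_sup_def star_capacity[OF m])

lemma widom_L2_eq: "(widom_L2 (star_set m) n)\<^sup>2
    = (\<integral>z. (norm (poly (orthogonal_poly (star_measure m) n) z))\<^sup>2 \<partial>star_measure m)"
  by (simp add: widom_L2_def star_capacity[OF m] star_equilibrium[OF m] L2_norm_poly_def
      Bochner_Integration.integral_nonneg)

lemma square_integral:
  "(\<integral>z. (norm (poly p z))\<^sup>2 \<partial>star_measure m)
    = (\<integral>u. (\<Sum>j<m. (norm (poly p (unity_root m j * branch_root m u)))\<^sup>2) / real m \<partial>circle_measure)"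
  "integrable circle_measure (\<lambda>u. (\<Sum>j<m. (norm (poly p (unity_root m j * branch_root m u)))\<^sup>2) / real m)"
proof -
  have c: "continuous_on A (\<lambda>z. (norm (poly p z))\<^sup>2)" for A by (intro continuous_intros)
  hence b: "(\<lambda>z. (norm (poly p z))\<^sup>2) \<in> borel_measurable borel" by (rule borel_measurable_continuous_onI)
  show "(\<integral>z. (norm (poly p z))\<^sup>2 \<partial>star_measure m)
    = (\<integral>u. (\<Sum>j<m. (norm (poly p (unity_root m j * branch_root m u)))\<^sup>2) / real m \<partial>circle_measure)"
    using integral_star_measure(1)[OF m b c] by simp
  show "integrable circle_measure (\<lambda>u. (\<Sum>j<m. (norm (poly p (unity_root m j * branch_root m u)))\<^sup>2) / real m)"
    using integral_star_measure(2)[OF m b c] by (intro integrable_divide Bochner_Integration.integrable_sum)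
qed

text \<open>Averaging over rotations increases neither norm and leaves \<open>z^l Q(z^m)\<close>
  with \<open>Q\<close> monic of degree \<open>k\<close>. The Bernstein-Szego bounds are applied to
  \<open>x Q(x)\<close>.\<close>

lemma lower_bounds:
  assumes l: "l < m" and e: "0 < e" "e < 1"
  shows "\<exists>K. \<forall>k\<ge>K. (1 - e)\<^sup>2 * 2 \<le> (widom_L2 (star_set m) (k * m + l))\<^sup>2
    \<and> (1 - e) * 2 \<le> widom_sup (star_set m) (k * m + l)"
proof -
  obtain h :: "real poly" where h: "poly h 0 = 1"
    "\<And>u. norm u \<le> 1 \<Longrightarrow> poly (map_poly complex_of_real h) u \<noteq> 0"
    "\<And>u y. norm u = 1 \<Longrightarrow> 0 \<le> y \<Longrightarrow> y ^ m = norm (xproj u) \<Longrightarrow>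
      (1 - e) * norm (xproj u) \<le> norm (poly (map_poly complex_of_real h) u) * y ^ l"
    using star_weight_minorant[OF m l e] by metis
  define H where "H = poly (map_poly complex_of_real h)"
  show ?thesis
  proof (intro exI[of _ "degree h"] allI impI)
    fix k assume k: "degree h \<le> k"
    \<comment> \<open>\<open>Suc k\<close> is the degree of \<open>x Q(x)\<close>; hence
      \<open>degree h <= k\<close> suffices as threshold.\<close>
    interpret bernstein_szego h "Suc k" H
      using h(1,2) k by unfold_locales (simp_all add: H_def)
    let ?n = "k * m + l"
    have key: "pCons 0 (residue_part m l k p) \<in> monic_polys (Suc k)"
      "norm u = 1 \<Longrightarrow> (1 - e) * norm (poly (pCons 0 (residue_part m l k p)) (xproj u))
        \<le> norm (H u) * norm (branch_root m u ^ l * poly (residue_part m l k p) (branch_root m u ^ m))"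
      if p: "p \<in> monic_polys ?n" for p u
    proof -
      show "pCons 0 (residue_part m l k p) \<in> monic_polys (Suc k)"
        by (intro monic_polys_pCons residue_part_monic p)
      assume u: "norm u = 1"
      have "(1 - e) * norm (xproj u) \<le> norm (H u) * norm (branch_root m u) ^ l"
        unfolding H_def by (rule h(3)[OF u]) (simp_all add: norm_branch_root_power m)
      from mult_right_mono[OF this, of "norm (poly (residue_part m l k p) (xproj u))"]
      show "(1 - e) * norm (poly (pCons 0 (residue_part m l k p)) (xproj u))
        \<le> norm (H u) * norm (branch_root m u ^ l * poly (residue_part m l k p) (branch_root m u ^ m))"
        by (simp add: norm_mult norm_power branch_root_power[OF m] mult.assoc)
    qed
    have "(1 - e)\<^sup>2 * 2 \<le> (widom_L2 (star_set m) ?n)\<^sup>2"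
    proof -
      let ?p = "orthogonal_poly (star_measure m) ?n"
      have p: "?p \<in> monic_polys ?n" by (rule \<mu>.orthogonal_poly_props)
      hence dp: "degree ?p = k * m + l" by (simp add: monic_polys_def)
      let ?Q = "residue_part m l k ?p"
      let ?R = "pCons 0 ?Q"
      have int: "integrable circle_measure (\<lambda>u. (norm (poly ?R (xproj u)))\<^sup>2 / (norm (H u))\<^sup>2)"
        by (intro circle_integrable_continuous continuous_intros) measurable
      have "(1 - e)\<^sup>2 * 2 \<le> (1 - e)\<^sup>2 * (\<integral>u. (norm (poly ?R (xproj u)))\<^sup>2 / (norm (H u))\<^sup>2 \<partial>circle_measure)"
        by (intro mult_left_mono mean_square_ge key p) simp
      also have "\<dots> = (\<integral>u. (1 - e)\<^sup>2 * ((norm (poly ?R (xproj u)))\<^sup>2 / (norm (H u))\<^sup>2) \<partial>circle_measure)"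
        by (rule integral_mult_right_zero[symmetric])
      also have "\<dots> \<le> (\<integral>u. (\<Sum>j<m. (norm (poly ?p (unity_root m j * branch_root m u)))\<^sup>2) / real m \<partial>circle_measure)"
      proof (rule integral_mono_AE)
        show "AE u in circle_measure. (1 - e)\<^sup>2 * ((norm (poly ?R (xproj u)))\<^sup>2 / (norm (H u))\<^sup>2)
            \<le> (\<Sum>j<m. (norm (poly ?p (unity_root m j * branch_root m u)))\<^sup>2) / real m"
          using AE_circle_measure
        proof eventually_elim
          fix u :: complex assume u: "norm u = 1"
          let ?t = "norm (branch_root m u ^ l * poly ?Q (branch_root m u ^ m))"
          have Hu: "norm (H u) > 0" using H_nz[of u] u by simp
          have "((1 - e) * norm (poly ?R (xproj u)))\<^sup>2 \<le> (norm (H u) * ?t)\<^sup>2"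
            using key(2)[OF p u] e by (intro power_mono) auto
          hence "(1 - e)\<^sup>2 * ((norm (poly ?R (xproj u)))\<^sup>2 / (norm (H u))\<^sup>2) \<le> ?t\<^sup>2"
            using Hu by (simp only: power_mult_distrib times_divide_eq_right pos_divide_le_eq zero_less_power mult.commute)
          also have "\<dots> \<le> (\<Sum>j<m. (norm (poly ?p (unity_root m j * branch_root m u)))\<^sup>2) / real m"
            by (rule residue_part_square_le[OF m l dp])
          finally show "(1 - e)\<^sup>2 * ((norm (poly ?R (xproj u)))\<^sup>2 / (norm (H u))\<^sup>2)
            \<le> (\<Sum>j<m. (norm (poly ?p (unity_root m j * branch_root m u)))\<^sup>2) / real m" .
        qed
        show "integrable circle_measure (\<lambda>u. (1 - e)\<^sup>2 * ((norm (poly ?R (xproj u)))\<^sup>2 / (norm (H u))\<^sup>2))"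
          by (rule integrable_mult_right[OF int])
      qed (rule square_integral)
      also have "\<dots> = (widom_L2 (star_set m) ?n)\<^sup>2" unfolding widom_L2_eq square_integral ..
      finally show ?thesis .
    qed
    moreover have "(1 - e) * 2 \<le> widom_sup (star_set m) ?n"
    proof -
      let ?p = "chebyshev_poly (star_set m) ?n"
      let ?W = "widom_sup (star_set m) ?n"
      have p: "?p \<in> monic_polys ?n" by (rule E.chebyshev_poly_props)
      hence dp: "degree ?p = k * m + l" by (simp add: monic_polys_def)
      let ?Q = "residue_part m l k ?p"
      have "2 \<le> ?W / (1 - e)"
      proof (rule sup_ge[OF key(1)[OF p]])
        fix u :: complex assume u: "norm u = 1"
        let ?t = "norm (branch_root m u ^ l * poly ?Q (branch_root m u ^ m))"
        have "real m * ?t \<le> (\<Sum>j<m. norm (poly ?p (unity_root m j * branch_root m u)))"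
          by (rule residue_part_norm_le[OF m l dp])
        also have "\<dots> \<le> (\<Sum>j<m. ?W)"
          unfolding widom_sup_eq by (intro sum_mono E.le_sup_norm star_point m u)
        finally have "?t \<le> ?W" using m by simp
        hence "norm (H u) * ?t \<le> norm (H u) * ?W" by (intro mult_left_mono) auto
        with key(2)[OF p u] have "(1 - e) * norm (poly (pCons 0 ?Q) (xproj u)) \<le> norm (H u) * ?W"
          by (rule order.trans)
        thus "norm (poly (pCons 0 ?Q) (xproj u)) \<le> ?W / (1 - e) * norm (H u)"
          using e by (simp add: field_simps)
      qed
      thus ?thesis using e by (simp add: field_simps)
    qed
    ultimately show "(1 - e)\<^sup>2 * 2 \<le> (widom_L2 (star_set m) ?n)\<^sup>2 \<and> (1 - e) * 2 \<le> widom_sup (star_set m) ?n" ..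
  qed
qed

text \<open>The trial polynomial \<open>z^l P(z^m)\<close> uses the extremal \<open>P\<close> of a
  weight \<open>1 / |H|\<close> that dominates \<open>|z|^l\<close> up to the factor
  \<open>1 + e\<close>. Its modulus is the same at all rotations of a point, so symmetrisation loses
  nothing.\<close>

lemma upper_bounds:
  assumes l: "l < m" and e: "0 < e" "e < 1"
  shows "\<exists>K. \<forall>k\<ge>K. (widom_L2 (star_set m) (k * m + l))\<^sup>2 \<le> (1 + e)\<^sup>2 * 2
    \<and> widom_sup (star_set m) (k * m + l) \<le> (1 + e) * 2"
proof -
  obtain h :: "real poly" where h: "poly h 0 = 1"
    "\<And>u. norm u \<le> 1 \<Longrightarrow> poly (map_poly complex_of_real h) u \<noteq> 0"
    "\<And>u y. norm u = 1 \<Longrightarrow> 0 \<le> y \<Longrightarrow> y ^ m = norm (xproj u) \<Longrightarrow>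
      norm (poly (map_poly complex_of_real h) u) * y ^ l \<le> 1 + e"
    using star_weight_majorant[OF m l e] by metis
  define H where "H = poly (map_poly complex_of_real h)"
  show ?thesis
  proof (intro exI[of _ "Suc (degree h)"] allI impI)
    fix k assume k: "Suc (degree h) \<le> k"
    interpret bernstein_szego h k H
      using h(1,2) k by unfold_locales (simp_all add: H_def)
    let ?n = "k * m + l"
    obtain P where P: "P \<in> monic_polys k"
      "\<And>u. norm u = 1 \<Longrightarrow> poly P (xproj u) = of_real (extremal_value u)"
      using extremal_poly_exists by metis
    define q where "q = monom 1 l * pcompose P (monom 1 m)"
    have q: "q \<in> monic_polys ?n" unfolding q_def by (rule monic_polys_pcompose_monom[OF m P(1)])
    have qn: "norm (poly q z) = norm z ^ l * \<bar>extremal_value u\<bar>" if "norm u = 1" "z ^ m = xproj u" for z u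
      using that P(2) by (simp add: q_def poly_monom poly_pcompose norm_mult norm_power)
    have Hz: "norm (H u) * norm z ^ l \<le> 1 + e" if "norm u = 1" "z ^ m = xproj u" for z u
      unfolding H_def using that by (intro h(3)) (simp_all add: norm_power[symmetric])
    have "(widom_L2 (star_set m) ?n)\<^sup>2 \<le> (1 + e)\<^sup>2 * 2"
    proof -
      have "(widom_L2 (star_set m) ?n)\<^sup>2 \<le> (\<integral>z. (norm (poly q z))\<^sup>2 \<partial>star_measure m)"
        unfolding widom_L2_eq by (rule \<mu>.orthogonal_poly_props(2)[OF q])
      also have "\<dots> \<le> (\<integral>u. (1 + e)\<^sup>2 * ((extremal_value u)\<^sup>2 / (norm (H u))\<^sup>2) \<partial>circle_measure)"
        unfolding square_integral
      proof (rule integral_mono_AE)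
        show "AE u in circle_measure. (\<Sum>j<m. (norm (poly q (unity_root m j * branch_root m u)))\<^sup>2) / real m
          \<le> (1 + e)\<^sup>2 * ((extremal_value u)\<^sup>2 / (norm (H u))\<^sup>2)"
          using AE_circle_measure
        proof eventually_elim
          fix u :: complex assume u: "norm u = 1"
          have Hu: "norm (H u) > 0" using H_nz[of u] u by simp
          have "(norm (poly q (unity_root m j * branch_root m u)))\<^sup>2
              \<le> (1 + e)\<^sup>2 * ((extremal_value u)\<^sup>2 / (norm (H u))\<^sup>2)" for j
          proof -
            let ?z = "unity_root m j * branch_root m u"
            have z: "?z ^ m = xproj u"
              by (simp add: power_mult_distrib unity_root_power m branch_root_power)
            have "norm ?z ^ l \<le> (1 + e) / norm (H u)" using Hz[OF u z] Hu by (simp add: field_simps)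
            hence "norm (poly q ?z) \<le> (1 + e) / norm (H u) * \<bar>extremal_value u\<bar>"
              unfolding qn[OF u z] by (intro mult_right_mono) auto
            hence "(norm (poly q ?z))\<^sup>2 \<le> ((1 + e) / norm (H u) * \<bar>extremal_value u\<bar>)\<^sup>2"
              by (intro power_mono) auto
            thus ?thesis by (simp add: power_mult_distrib power_divide)
          qed
          hence "(\<Sum>j<m. (norm (poly q (unity_root m j * branch_root m u)))\<^sup>2)
              \<le> (\<Sum>j<m. (1 + e)\<^sup>2 * ((extremal_value u)\<^sup>2 / (norm (H u))\<^sup>2))"
            by (intro sum_mono)
          thus "(\<Sum>j<m. (norm (poly q (unity_root m j * branch_root m u)))\<^sup>2) / real m
            \<le> (1 + e)\<^sup>2 * ((extremal_value u)\<^sup>2 / (norm (H u))\<^sup>2)"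
            using m by (simp add: pos_divide_le_eq mult.commute)
        qed
        show "integrable circle_measure (\<lambda>u. (1 + e)\<^sup>2 * ((extremal_value u)\<^sup>2 / (norm (H u))\<^sup>2))"
          by (rule integrable_mult_right[OF extremal_square_integrable])
      qed (rule square_integral)
      also have "\<dots> = (1 + e)\<^sup>2 * 2"
        by (simp only: integral_mult_right_zero mean_square_extremal)
      finally show ?thesis .
    qed
    moreover have "widom_sup (star_set m) ?n \<le> (1 + e) * 2"
    proof -
      have "widom_sup (star_set m) ?n \<le> sup_norm_on (star_set m) q"
        unfolding widom_sup_eq by (rule E.chebyshev_poly_props(2)[OF q])
      also have "\<dots> \<le> (1 + e) * 2"
      proof (rule E.sup_norm_le)
        fix z assume "z \<in> star_set m"
        then obtain u where u: "norm u = 1" "z ^ m = xproj u" using star_set_param by blast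
        have "norm (poly q z) \<le> norm z ^ l * (2 * norm (H u))"
          unfolding qn[OF u] by (intro mult_left_mono abs_extremal_value u) auto
        also have "\<dots> = norm (H u) * norm z ^ l * 2" by simp
        also have "\<dots> \<le> (1 + e) * 2" by (intro mult_right_mono Hz u) auto
        finally show "norm (poly q z) \<le> (1 + e) * 2" .
      qed
      finally show ?thesis .
    qed
    ultimately show "(widom_L2 (star_set m) ?n)\<^sup>2 \<le> (1 + e)\<^sup>2 * 2 \<and> widom_sup (star_set m) ?n \<le> (1 + e) * 2" ..
  qed
qed

text \<open>The thresholds depend on the residue of \<open>n\<close> modulo \<open>m\<close> through
  the approximating polynomial, and there are only finitely many residues.\<close>

lemma eventually_widom_close:
  assumes e: "0 < e" "e < 1"
  shows "\<forall>\<^sub>F n in sequentially. widom_close m n e"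
proof -
  have "\<exists>K. \<forall>k\<ge>K. widom_close m (k * m + l) e" if l: "l < m" for l
  proof -
    obtain K1 K2 where
      "\<forall>k\<ge>K1. (1 - e)\<^sup>2 * 2 \<le> (widom_L2 (star_set m) (k * m + l))\<^sup>2 \<and> (1 - e) * 2 \<le> widom_sup (star_set m) (k * m + l)"
      "\<forall>k\<ge>K2. (widom_L2 (star_set m) (k * m + l))\<^sup>2 \<le> (1 + e)\<^sup>2 * 2 \<and> widom_sup (star_set m) (k * m + l) \<le> (1 + e) * 2"
      using lower_bounds[OF l e] upper_bounds[OF l e] by blast
    thus ?thesis unfolding widom_close_def by (intro exI[of _ "max K1 K2"]) auto
  qed
  hence "\<forall>l\<in>{..<m}. \<forall>\<^sub>F k in sequentially. widom_close m (k * m + l) e"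
    unfolding eventually_sequentially by blast
  hence "\<forall>\<^sub>F k in sequentially. \<forall>l\<in>{..<m}. widom_close m (k * m + l) e"
    by (intro eventually_ball_finite) auto
  then obtain K where K: "\<And>k l. K \<le> k \<Longrightarrow> l < m \<Longrightarrow> widom_close m (k * m + l) e"
    unfolding eventually_sequentially by auto
  show ?thesis
    unfolding eventually_sequentially
  proof (intro exI[of _ "K * m"] allI impI)
    fix n assume "K * m \<le> n"
    hence "K * m div m \<le> n div m" by (rule div_le_mono)
    hence "K \<le> n div m" using m by simp
    from K[OF this, of "n mod m"] m show "widom_close m n e" by simp
  qed
qed

lemma widom_limits:
  "(\<lambda>n. (widom_L2 (star_set m) n)\<^sup>2) \<longlonglongrightarrow> 2"
  "(\<lambda>n. widom_sup (star_set m) n) \<longlonglongrightarrow> 2"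
proof -
  have close: "\<forall>\<^sub>F n in sequentially. \<bar>(widom_L2 (star_set m) n)\<^sup>2 - 2\<bar> < d \<and> \<bar>widom_sup (star_set m) n - 2\<bar> < d"
    if "d > 0" for d :: real
  proof -
    \<comment> \<open>The errors are at most \<open>4 e + 2 e^2 <= 6 e\<close>, strictly below
      \<open>7 e <= d\<close>; the cap 1/2 keeps \<open>e < 1\<close>.\<close>
    define e where "e = min (d / 7) (1 / 2)"
    have e: "0 < e" "e < 1" "7 * e \<le> d" using that by (auto simp: e_def min_def)
    have e2: "e * e \<le> e" using e by (simp add: mult_left_le)
    show ?thesis
      using eventually_widom_close[OF e(1,2)]
    proof eventually_elim
      fix n assume c: "widom_close m n e"
      have sq: "(1 - e)\<^sup>2 * 2 = 2 - 4 * e + 2 * (e * e)" "(1 + e)\<^sup>2 * 2 = 2 + 4 * e + 2 * (e * e)"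
        "(1 - e) * 2 = 2 - 2 * e" "(1 + e) * 2 = 2 + 2 * e"
        by (simp_all add: power2_eq_square algebra_simps)
      show "\<bar>(widom_L2 (star_set m) n)\<^sup>2 - 2\<bar> < d \<and> \<bar>widom_sup (star_set m) n - 2\<bar> < d"
        using c e e2 zero_le_square[of e] unfolding widom_close_def sq abs_less_iff
        by (elim conjE, intro conjI) linarith+
    qed
  qed
  show "(\<lambda>n. (widom_L2 (star_set m) n)\<^sup>2) \<longlonglongrightarrow> 2" "(\<lambda>n. widom_sup (star_set m) n) \<longlonglongrightarrow> 2"
    unfolding tendsto_iff dist_real_def using close by (auto simp: eventually_conj_iff)
qed

end

theorem corollary1:
  fixes m :: nat
  assumes "m > 0"
  shows "\<exists>L :: real. (\<lambda>n. (widom_L2 (star_set m) n)\<^sup>2) \<longlonglongrightarrow> L \<and>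
                     (\<lambda>n. widom_sup (star_set m) n) \<longlonglongrightarrow> L"
proof -
  interpret star m using assms by unfold_locales
  from widom_limits show ?thesis by blast
qed

end
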